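(* Let $p\in\mathbb C[z,w]$ be a non-zero homogeneous polynomial, $q(\zeta)=p(\zeta,1)$, $\mathcal M=[p]$, let $Q=e_0\otimes e_0$ be the orthogonal projection of $\mathcal M$ onto the line spanned by $e_0=p/\|p\|$, and put $K=P_zP_w-Q$. Then both $K^*K$ and $X_{\mathcal M}^*X_{\mathcal M}$ are trace class, and $$\det(I-K^*K)=\det(I-X_{\mathcal M}^*X_{\mathcal M})=\frac{\mathfrak M(q)^2}{\|q\|_2^2}.$$ Furthermore, $$\sum_{r=1}^{\infty}\frac1r\|X_{\mathcal M}\|_{\mathcal S_{2r}}^{2r}=\log\frac{\|q\|_2^2}{\mathfrak M(q)^2},$$ and the same identity holds with $X_{\mathcal M}$ replaced by $K$.
   Context: $H^2(\mathbb D^2)$ is the Hardy space of the bidisc, $m$ is normalized Haar measure on $\mathbb T$, and $[p]$ is the closure of $p\,\mathbb C[z,w]$ in $H^2(\mathbb D^2)$. For $\mathcal M=[p]$ put $R_z=M_z|_{\mathcal M}$, $R_w=M_w|_{\mathcal M}$, $P_z=I-R_zR_z^*=P_{\mathcal M\ominus z\mathcal M}$, $P_w=I-R_wR_w^*=P_{\mathcal M\ominus w\mathcal M}$, and $X_{\mathcal M}=[R_z^*,R_w]=R_z^*R_w-R_wR_z^*$. $\mathfrak M(q)=\exp\left(\int_{\mathbb T}\log|q|\,dm\right)$ is the Mahler measure and $\|q\|_2$ is the norm of $L^2(\mathbb T,m)$. $\mathcal S_r$ is the Schatten class with $\|T\|_{\mathcal S_r}^r=\sum_j s_j(T)^r$,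 and $\det$ is the Fredholm determinant. *)

theory Defs
  imports "HOL-Analysis.Analysis" "HOL-Computational_Algebra.Polynomial"
begin

section \<open>Complex inner product spaces\<close>

text \<open>
  The distribution only has real inner product spaces.  A complex one is a real one whose real inner
  product is the real part of a complex one; \<open>cinner\<close> is linear in its first argument.  The norm
  and the topology are those of \<^class>\<open>real_inner\<close>.
\<close>

class complex_inner = real_inner +
  fixes scaleC :: "complex \<Rightarrow> 'a \<Rightarrow> 'a"  (infixr "*\<^sub>C" 75)
    and cinner :: "'a \<Rightarrow> 'a \<Rightarrow> complex"
  assumes scaleC_add_right: "a *\<^sub>C (x + y) = a *\<^sub>C x + a *\<^sub>C y"
    and scaleC_add_left: "(a + b) *\<^sub>C x = a *\<^sub>C x + b *\<^sub>C x"
    and scaleC_scaleC: "a *\<^sub>C (b *\<^sub>C x) = (a * b) *\<^sub>C x"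
    and scaleC_one: "1 *\<^sub>C x = x"
    and scaleR_scaleC: "r *\<^sub>R x = complex_of_real r *\<^sub>C x"
    and cinner_commute: "cinner x y = cnj (cinner y x)"
    and cinner_add_left: "cinner (x + y) z = cinner x z + cinner y z"
    and cinner_scaleC_left: "cinner (a *\<^sub>C x) y = a * cinner x y"
    and inner_cinner: "inner x y = Re (cinner x y)"

lemma vector_space_scaleC: "vector_space (scaleC :: complex \<Rightarrow> 'a \<Rightarrow> 'a::complex_inner)"
  by unfold_locales (auto simp: scaleC_add_right scaleC_add_left scaleC_scaleC scaleC_one)

definition cdim :: "'a::complex_inner set \<Rightarrow> nat"
  where "cdim = vector_space.dim scaleC"


section \<open>Operators on a closed subspace\<close>

text \<open>
  An operator on the closed subspace \<open>M\<close> is a function of which only the values on \<open>M\<close>,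
  which must lie in \<open>M\<close>, matter.  The adjoint is taken in the Hilbert space \<open>M\<close>.
\<close>

definition clinear_on :: "'a::complex_inner set \<Rightarrow> ('a \<Rightarrow> 'a) \<Rightarrow> bool"
  where "clinear_on M T \<longleftrightarrow> T ` M \<subseteq> M \<and>
    (\<forall>x\<in>M. \<forall>y\<in>M. T (x + y) = T x + T y) \<and> (\<forall>c. \<forall>x\<in>M. T (c *\<^sub>C x) = c *\<^sub>C T x)"

definition adj_on :: "'a::complex_inner set \<Rightarrow> ('a \<Rightarrow> 'a) \<Rightarrow> 'a \<Rightarrow> 'a"
  where "adj_on M T y = (THE z. z \<in> M \<and> (\<forall>x\<in>M. cinner (T x) y = cinner x z))"

definition compact_op_on :: "'a::complex_inner set \<Rightarrow> ('a \<Rightarrow> 'a) \<Rightarrow> bool"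
  where "compact_op_on M T \<longleftrightarrow> clinear_on M T \<and> compact (closure (T ` (M \<inter> cball 0 1)))"

definition eigenspace_on :: "'a::complex_inner set \<Rightarrow> ('a \<Rightarrow> 'a) \<Rightarrow> complex \<Rightarrow> 'a set"
  where "eigenspace_on M T \<mu> = {x \<in> M. T x = \<mu> *\<^sub>C x}"

definition gen_eigenspace_on :: "'a::complex_inner set \<Rightarrow> ('a \<Rightarrow> 'a) \<Rightarrow> complex \<Rightarrow> 'a set"
  where "gen_eigenspace_on M T \<mu> = {x \<in> M. \<exists>n. ((\<lambda>y. T y - \<mu> *\<^sub>C y) ^^ n) x = 0}"

text \<open>
  The nonzero singular values of a compact \<open>T\<close> are the numbers \<open>s > 0\<close> for which \<open>s\<^sup>2\<close> is an
  eigenvalue of \<open>T\<^sup>*T\<close>, each repeated as often as its (finite) multiplicity.  The repetition is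
  expressed by the second component of the index \<open>(s, k)\<close>; as only sums over all singular
  values are formed, they need not be arranged in decreasing order.
\<close>

definition singular_values_on :: "'a::complex_inner set \<Rightarrow> ('a \<Rightarrow> 'a) \<Rightarrow> (real \<times> nat) set"
  where "singular_values_on M T = {(s, k). s > 0 \<and>
    k < cdim (eigenspace_on M (\<lambda>x. adj_on M T (T x)) (complex_of_real (s\<^sup>2)))}"

definition schatten_class_on :: "'a::complex_inner set \<Rightarrow> real \<Rightarrow> ('a \<Rightarrow> 'a) set"
  where "schatten_class_on M r = {T. compact_op_on M T \<and>
    (\<lambda>(s, k). s powr r) summable_on singular_values_on M T}"

definition schatten_norm_on :: "'a::complex_inner set \<Rightarrow> real \<Rightarrow> ('a \<Rightarrow> 'a) \<Rightarrow> real"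
  where "schatten_norm_on M r T =
    (\<Sum>\<^sub>\<infinity>(s, k)\<in>singular_values_on M T. s powr r) powr (1 / r)"

abbreviation trace_class_on :: "'a::complex_inner set \<Rightarrow> ('a \<Rightarrow> 'a) \<Rightarrow> bool"
  where "trace_class_on M T \<equiv> T \<in> schatten_class_on M 1"

text \<open>
  The Fredholm determinant of \<open>T = I - A\<close> with \<open>A\<close> trace class is \<open>\<Prod>\<^sub>j (1 - \<lambda>\<^sub>j(A))\<close>, where the
  nonzero eigenvalues of \<open>A\<close> are repeated according to algebraic multiplicity.  The factors are
  the eigenvalues of \<open>T\<close> other than 1; the product is unconditional, i.e.\ the limit over
  all finite sets of them.
\<close>

definition fredholm_det_on :: "'a::complex_inner set \<Rightarrow> ('a \<Rightarrow> 'a) \<Rightarrow> complex"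
  where "fredholm_det_on M T =
    Lim (finite_subsets_at_top {\<mu>. \<mu> \<noteq> 1 \<and> eigenspace_on M T \<mu> \<noteq> {0}})
      (\<lambda>F. \<Prod>\<mu>\<in>F. \<mu> ^ cdim (gen_eigenspace_on M T \<mu>))"


section \<open>The Hardy space of the bidisc\<close>

definition bidisc :: "(complex \<times> complex) set"
  where "bidisc = ball 0 1 \<times> ball 0 1"

definition square_summable :: "(nat \<times> nat \<Rightarrow> complex) \<Rightarrow> bool"
  where "square_summable a \<longleftrightarrow> (\<lambda>k. (cmod (a k))\<^sup>2) summable_on UNIV"

text \<open>Functions on the bidisc are extended by 0 to a total function.\<close>

definition hardy_expansion :: "(nat \<times> nat \<Rightarrow> complex) \<Rightarrow> (complex \<times> complex \<Rightarrow> complex) \<Rightarrow> bool"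
  where "hardy_expansion a f \<longleftrightarrow> square_summable a \<and>
    (\<forall>(z, w)\<in>bidisc. ((\<lambda>(i, j). a (i, j) * z ^ i * w ^ j) has_sum f (z, w)) UNIV) \<and>
    (\<forall>x. x \<notin> bidisc \<longrightarrow> f x = 0)"

lemma square_summable_0: "square_summable (\<lambda>k. 0)"
  by (simp add: square_summable_def)

lemma square_summable_cmult:
  assumes "square_summable a" shows "square_summable (\<lambda>k. c * a k)"
  using summable_on_cmult_right[OF assms[unfolded square_summable_def], of "(cmod c)\<^sup>2"]
  by (simp add: square_summable_def norm_mult power_mult_distrib)

lemma square_summable_add:
  assumes "square_summable a" "square_summable b"
  shows "square_summable (\<lambda>k. a k + b k)"
  unfolding square_summable_def
proof (rule summable_on_comparison_test)
  show "(\<lambda>k. 2 * (cmod (a k))\<^sup>2 + 2 * (cmod (b k))\<^sup>2) summable_on UNIV"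
    using assms unfolding square_summable_def
    by (intro summable_on_add summable_on_cmult_right)
  fix k
  have "(cmod (a k + b k))\<^sup>2 \<le> (cmod (a k) + cmod (b k))\<^sup>2"
    by (intro power_mono norm_triangle_ineq) auto
  also have "\<dots> \<le> 2 * (cmod (a k))\<^sup>2 + 2 * (cmod (b k))\<^sup>2"
    using sum_squares_ge_zero[of "cmod (a k) - cmod (b k)" 0]
    by (simp add: power2_eq_square algebra_simps)
  finally show "(cmod (a k + b k))\<^sup>2 \<le> 2 * (cmod (a k))\<^sup>2 + 2 * (cmod (b k))\<^sup>2" .
qed auto

lemma square_summable_mult:
  assumes "square_summable a" "square_summable b"
  shows "(\<lambda>k. cmod (a k * b k)) summable_on UNIV"
proof (rule abs_summable_product)
  show "(\<lambda>k. cmod (a k * a k)) summable_on UNIV" "(\<lambda>k. cmod (b k * b k)) summable_on UNIV"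
    using assms by (simp_all add: square_summable_def norm_mult power2_eq_square)
qed

lemma square_summable_monomials:
  assumes "(z, w) \<in> bidisc"
  shows "square_summable (\<lambda>(i, j). z ^ i * w ^ j)"
proof -
  have n: "cmod z ^ 2 < 1" "cmod w ^ 2 < 1"
    using assms by (auto simp: bidisc_def power_less_one_iff abs_square_less_1)
  have g: "((\<lambda>i. (r::real) ^ i) has_sum (1 / (1 - r))) UNIV" if "0 \<le> r" "r < 1" for r
    using that by (intro sums_nonneg_imp_has_sum geometric_sums) auto
  have "(\<lambda>(i, j). (cmod z ^ 2) ^ i * (cmod w ^ 2) ^ j) summable_on UNIV \<times> UNIV"
  proof (rule summable_on_SigmaI)
    show "((\<lambda>j. case (i, j) of (i, j) \<Rightarrow> (cmod z ^ 2) ^ i * (cmod w ^ 2) ^ j) has_sum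
        (cmod z ^ 2) ^ i * (1 / (1 - cmod w ^ 2))) UNIV" for i
      unfolding prod.case using n by (intro has_sum_cmult_right g) auto
    show "(\<lambda>i. (cmod z ^ 2) ^ i * (1 / (1 - cmod w ^ 2))) summable_on UNIV"
      using n by (intro summable_on_cmult_left has_sum_imp_summable[OF g]) auto
  qed auto
  moreover have "(cmod (case k of (i, j) \<Rightarrow> z ^ i * w ^ j))\<^sup>2 =
      (case k of (i, j) \<Rightarrow> (cmod z ^ 2) ^ i * (cmod w ^ 2) ^ j)" for k
    by (cases k) (simp add: norm_mult norm_power power_mult_distrib mult.commute flip: power_mult)
  ultimately show ?thesis
    by (simp add: square_summable_def)
qed

lemma hardy_expansion_ex:
  assumes "square_summable a"
  shows "hardy_expansion a (\<lambda>(z, w). if (z, w) \<in> bidisc then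
           (\<Sum>\<^sub>\<infinity>(i, j). a (i, j) * z ^ i * w ^ j) else 0)"
proof -
  have "(\<lambda>(i, j). a (i, j) * z ^ i * w ^ j) summable_on UNIV" if "(z, w) \<in> bidisc" for z w
    using abs_summable_summable[OF square_summable_mult[OF assms square_summable_monomials[OF that]]]
    by (simp add: case_prod_unfold mult.assoc)
  then show ?thesis
    using assms by (auto simp: hardy_expansion_def intro!: has_sum_infsum)
qed

lemma powser_eq_0:
  fixes a :: "nat \<Rightarrow> complex"
  assumes "\<And>z. cmod z < 1 \<Longrightarrow> (\<lambda>n. a n * z ^ n) sums 0"
  shows "a n = 0"
proof -
  have "conv_radius a \<ge> cmod (1 / 2)"
    using assms[of "1 / 2"] by (intro conv_radius_geI) (auto simp: sums_iff)
  then have "fps_conv_radius (Abs_fps a) > 0"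
    unfolding fps_conv_radius_def fps_nth_Abs_fps
    by (rule less_le_trans[rotated]) auto
  moreover have "\<forall>\<^sub>F z in nhds 0. eval_fps (Abs_fps a) z = eval_fps 0 z"
    unfolding eventually_nhds_metric
    using assms by (intro exI[of _ 1]) (auto simp: eval_fps_def sums_iff)
  ultimately have "Abs_fps a = 0"
    by (intro eval_fps_eqD) auto
  then show ?thesis
    by (metis fps_nth_Abs_fps fps_zero_nth)
qed

lemma hardy_expansion_0_imp:
  assumes "hardy_expansion a (\<lambda>x. 0)"
  shows "a = (\<lambda>k. 0)"
proof -
  have a: "square_summable a"
    and s: "\<And>z w. (z, w) \<in> bidisc \<Longrightarrow> ((\<lambda>(i, j). a (i, j) * z ^ i * w ^ j) has_sum 0) UNIV"
    using assms by (auto simp: hardy_expansion_def)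
  have row: "(\<lambda>j. a (i, j) * w ^ j) summable_on UNIV" if w: "cmod w < 1" for i w
  proof -
    have zw: "(1 / 2, w) \<in> bidisc" using w by (auto simp: bidisc_def)
    have "(\<lambda>(i, j). a (i, j) * (1 / 2) ^ i * w ^ j) summable_on UNIV \<times> UNIV"
      using s[OF zw] by (auto simp: summable_on_def)
    from summable_on_SigmaD1[OF this, of i]
    have "(\<lambda>j. 2 ^ i * (a (i, j) * (1 / 2) ^ i * w ^ j)) summable_on UNIV"
      by (intro summable_on_cmult_right) auto
    then show ?thesis by (simp add: field_simps)
  qed
  have "(\<Sum>\<^sub>\<infinity>j. a (i, j) * w ^ j) = 0" if w: "cmod w < 1" for i w
  proof (rule powser_eq_0[of "\<lambda>i. \<Sum>\<^sub>\<infinity>j. a (i, j) * w ^ j"])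
    fix z :: complex assume "cmod z < 1"
    then have "((\<lambda>(i, j). a (i, j) * z ^ i * w ^ j) has_sum 0) (UNIV \<times> UNIV)"
      using s[of z w] w by (auto simp: bidisc_def)
    then have "((\<lambda>i. (\<Sum>\<^sub>\<infinity>j. a (i, j) * w ^ j) * z ^ i) has_sum 0) UNIV"
    proof (rule has_sum_SigmaD)
      fix i
      have "((\<lambda>j. a (i, j) * w ^ j * z ^ i) has_sum (\<Sum>\<^sub>\<infinity>j. a (i, j) * w ^ j) * z ^ i) UNIV"
        by (intro has_sum_cmult_left has_sum_infsum row w)
      then show "((\<lambda>j. (case (i, j) of (i, j) \<Rightarrow> a (i, j) * z ^ i * w ^ j)) has_sum
          (\<Sum>\<^sub>\<infinity>j. a (i, j) * w ^ j) * z ^ i) UNIV"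
        by (simp add: mult_ac)
    qed
    then show "(\<lambda>i. (\<Sum>\<^sub>\<infinity>j. a (i, j) * w ^ j) * z ^ i) sums 0"
      by (rule has_sum_imp_sums)
  qed
  then have "a (i, j) = 0" for i j
    by (intro powser_eq_0[of "\<lambda>j. a (i, j)"] has_sum_imp_sums)
      (use has_sum_infsum[OF row[of _ i]] in auto)
  then show ?thesis by auto
qed

lemma hardy_expansion_add:
  assumes "hardy_expansion a f" "hardy_expansion b g"
  shows "hardy_expansion (\<lambda>k. a k + b k) (\<lambda>x. f x + g x)"
proof -
  have "((\<lambda>(i, j). (a (i, j) + b (i, j)) * z ^ i * w ^ j) has_sum f (z, w) + g (z, w)) UNIV"
    if "(z, w) \<in> bidisc" for z w
  proof -
    have "((\<lambda>(i, j). a (i, j) * z ^ i * w ^ j) has_sum f (z, w)) UNIV"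
      "((\<lambda>(i, j). b (i, j) * z ^ i * w ^ j) has_sum g (z, w)) UNIV"
      using assms that by (auto simp: hardy_expansion_def)
    from has_sum_add[OF this] show ?thesis
      by (simp add: case_prod_unfold ring_distribs)
  qed
  then show ?thesis
    using assms by (auto simp: hardy_expansion_def square_summable_add)
qed

lemma hardy_expansion_cmult:
  assumes "hardy_expansion a f"
  shows "hardy_expansion (\<lambda>k. c * a k) (\<lambda>x. c * f x)"
proof -
  have "((\<lambda>(i, j). c * a (i, j) * z ^ i * w ^ j) has_sum c * f (z, w)) UNIV"
    if "(z, w) \<in> bidisc" for z w
    using assms that has_sum_cmult_right[of "\<lambda>(i, j). a (i, j) * z ^ i * w ^ j" UNIV "f (z, w)" c]
    by (auto simp: hardy_expansion_def case_prod_unfold mult_ac)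
  then show ?thesis
    using assms by (auto simp: hardy_expansion_def square_summable_cmult)
qed

lemma hardy_expansion_0: "hardy_expansion (\<lambda>k. 0) (\<lambda>x. 0)"
  by (auto simp: hardy_expansion_def square_summable_0 case_prod_unfold)

lemma hardy_expansion_unique:
  assumes "hardy_expansion a f" "hardy_expansion b f"
  shows "a = b"
proof -
  have "hardy_expansion (\<lambda>k. a k + (-1) * b k) (\<lambda>x. f x + (-1) * f x)"
    by (intro hardy_expansion_add hardy_expansion_cmult assms)
  then have "(\<lambda>k. a k + (-1) * b k) = (\<lambda>k. 0)"
    by (intro hardy_expansion_0_imp) simp
  then show ?thesis by (auto simp: fun_eq_iff)
qed

typedef hardy = "{f. \<exists>a. hardy_expansion a f}"
  using hardy_expansion_0 by blast

definition hardy_coeff :: "hardy \<Rightarrow> nat \<times> nat \<Rightarrow> complex"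
  where "hardy_coeff f = (THE a. hardy_expansion a (Rep_hardy f))"

lemma hardy_expansion_coeff: "hardy_expansion (hardy_coeff f) (Rep_hardy f)"
proof -
  obtain a where "hardy_expansion a (Rep_hardy f)" using Rep_hardy[of f] by blast
  then have "\<exists>!a. hardy_expansion a (Rep_hardy f)" using hardy_expansion_unique by blast
  then show ?thesis unfolding hardy_coeff_def by (rule theI')
qed

lemma square_summable_hardy_coeff: "square_summable (hardy_coeff f)"
  using hardy_expansion_coeff by (auto simp: hardy_expansion_def)

lemma hardy_coeff_eqI: "hardy_expansion a (Rep_hardy f) \<Longrightarrow> hardy_coeff f = a"
  using hardy_expansion_coeff hardy_expansion_unique by blast

lemma hardy_coeff_Abs: "hardy_expansion a f \<Longrightarrow> hardy_coeff (Abs_hardy f) = a"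
  proof -
  assume "hardy_expansion a f"
  then show ?thesis by (metis Abs_hardy_inverse hardy_coeff_eqI mem_Collect_eq)
qed

lemma hardy_coeff_inject: "hardy_coeff f = hardy_coeff g \<longleftrightarrow> f = g"
proof
  assume eq: "hardy_coeff f = hardy_coeff g"
  have "Rep_hardy f (z, w) = Rep_hardy g (z, w)" for z w
  proof (cases "(z, w) \<in> bidisc")
    case True
    let ?t = "\<lambda>(i, j). hardy_coeff f (i, j) * z ^ i * w ^ j"
    have "(?t has_sum Rep_hardy f (z, w)) UNIV" "(?t has_sum Rep_hardy g (z, w)) UNIV"
      using True hardy_expansion_coeff[of f] hardy_expansion_coeff[of g]
      unfolding hardy_expansion_def eq by auto
    then show ?thesis by (rule has_sum_unique)
  next
    case False
    then show ?thesis
      using hardy_expansion_coeff[of f] hardy_expansion_coeff[of g]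
      unfolding hardy_expansion_def by metis
  qed
  then show "f = g" by (simp add: Rep_hardy_inject[symmetric] fun_eq_iff)
qed simp

instantiation hardy :: complex_inner
begin

definition "0 = Abs_hardy (\<lambda>x. 0)"
definition "f + g = Abs_hardy (\<lambda>x. Rep_hardy f x + Rep_hardy g x)"
definition "- f = Abs_hardy (\<lambda>x. - Rep_hardy f x)"
definition minus_hardy_def: "f - g = Abs_hardy (\<lambda>x. Rep_hardy f x - Rep_hardy g x)"
definition "c *\<^sub>C f = Abs_hardy (\<lambda>x. c * Rep_hardy f x)"
definition "r *\<^sub>R f = Abs_hardy (\<lambda>x. complex_of_real r * Rep_hardy f x)"
definition "cinner f g = (\<Sum>\<^sub>\<infinity>k. hardy_coeff f k * cnj (hardy_coeff g k))"
definition "inner f g = Re (cinner f (g :: hardy))"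
definition norm_hardy_def: "norm f = sqrt (inner f (f :: hardy))"
definition sgn_hardy_def: "sgn f = inverse (norm f) *\<^sub>R (f :: hardy)"
definition dist_hardy_def: "dist f g = norm (f - g :: hardy)"
definition uniformity_hardy_def:
  "(uniformity :: (hardy \<times> hardy) filter) = (INF e\<in>{0 <..}. principal {(x, y). dist x y < e})"
definition open_hardy_def:
  "open (U :: hardy set) \<longleftrightarrow> (\<forall>x\<in>U. eventually (\<lambda>(x', y). x' = x \<longrightarrow> y \<in> U) uniformity)"

lemma hardy_coeff_0: "hardy_coeff 0 = (\<lambda>k. 0)"
  unfolding zero_hardy_def by (rule hardy_coeff_Abs[OF hardy_expansion_0])

lemma hardy_coeff_add: "hardy_coeff (f + g) = (\<lambda>k. hardy_coeff f k + hardy_coeff g k)"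
  unfolding plus_hardy_def
  by (rule hardy_coeff_Abs[OF hardy_expansion_add[OF hardy_expansion_coeff hardy_expansion_coeff]])

lemma hardy_coeff_scaleC: "hardy_coeff (c *\<^sub>C f) = (\<lambda>k. c * hardy_coeff f k)"
  unfolding scaleC_hardy_def
  by (rule hardy_coeff_Abs[OF hardy_expansion_cmult[OF hardy_expansion_coeff]])

lemma scaleR_hardy_scaleC: "r *\<^sub>R f = complex_of_real r *\<^sub>C (f :: hardy)"
  by (simp add: scaleR_hardy_def scaleC_hardy_def)

lemma hardy_coeff_uminus: "hardy_coeff (- f) = (\<lambda>k. - hardy_coeff f k)"
  using hardy_coeff_scaleC[of "-1" f] by (simp add: scaleC_hardy_def uminus_hardy_def)

lemma hardy_coeff_minus: "hardy_coeff (f - g) = (\<lambda>k. hardy_coeff f k - hardy_coeff g k)"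
  using hardy_coeff_Abs[OF hardy_expansion_add[OF hardy_expansion_coeff[of f]
        hardy_expansion_cmult[OF hardy_expansion_coeff[of g], of "-1"]]]
  by (simp add: minus_hardy_def)

lemmas hardy_coeff_simps =
  hardy_coeff_0 hardy_coeff_add hardy_coeff_scaleC hardy_coeff_uminus hardy_coeff_minus

lemma cinner_hardy_summable:
  "(\<lambda>k. hardy_coeff f k * cnj (hardy_coeff g k)) summable_on UNIV"
proof -
  have "square_summable (\<lambda>k. cnj (hardy_coeff g k))"
    using square_summable_hardy_coeff[of g] by (simp add: square_summable_def)
  from square_summable_mult[OF square_summable_hardy_coeff this, of f]
  show ?thesis by (rule abs_summable_summable)
qed

lemma inner_hardy_self: "inner f f = (\<Sum>\<^sub>\<infinity>k. (cmod (hardy_coeff f k))\<^sup>2)"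
proof -
  have "cinner f f = (\<Sum>\<^sub>\<infinity>k. complex_of_real ((cmod (hardy_coeff f k))\<^sup>2))"
    by (simp only: cinner_hardy_def complex_norm_square)
  also have "\<dots> = complex_of_real (\<Sum>\<^sub>\<infinity>k. (cmod (hardy_coeff f k))\<^sup>2)"
    using has_sum_infsum[OF square_summable_hardy_coeff[of f, unfolded square_summable_def]]
    by (intro infsumI) (simp only: has_sum_of_real_iff)
  finally show ?thesis by (simp add: inner_hardy_def)
qed

instance
proof
  fix f g h :: hardy and a b :: complex and r s :: real
  show "f + g + h = f + (g + h)" "f + g = g + f" "0 + f = f" "- f + f = 0" "f - g = f + - g"
    "a *\<^sub>C (f + g) = a *\<^sub>C f + a *\<^sub>C g" "(a + b) *\<^sub>C f = a *\<^sub>C f + b *\<^sub>C f"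
    "a *\<^sub>C (b *\<^sub>C f) = (a * b) *\<^sub>C f" "1 *\<^sub>C f = f"
    "r *\<^sub>R (f + g) = r *\<^sub>R f + r *\<^sub>R g" "(r + s) *\<^sub>R f = r *\<^sub>R f + s *\<^sub>R f"
    "r *\<^sub>R s *\<^sub>R f = (r * s) *\<^sub>R f" "1 *\<^sub>R f = f"
    by (simp_all add: hardy_coeff_simps scaleR_hardy_scaleC algebra_simps flip: hardy_coeff_inject)
  show "r *\<^sub>R f = complex_of_real r *\<^sub>C f"
    by (rule scaleR_hardy_scaleC)
  show comm: "cinner f g = cnj (cinner g f)" for f g :: hardy
    by (simp add: cinner_hardy_def mult.commute flip: infsum_cnj)
  show add: "cinner (f + g) h = cinner f h + cinner g h"
    by (simp add: cinner_hardy_def hardy_coeff_simps ring_distribs infsum_add cinner_hardy_summable)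
  show scale: "cinner (a *\<^sub>C f) g = a * cinner f g" for a
    by (simp add: cinner_hardy_def hardy_coeff_simps mult.assoc infsum_cmult_right
        cinner_hardy_summable)
  show "inner f g = Re (cinner f g)"
    by (rule inner_hardy_def)
  show "inner f g = inner g f"
    unfolding inner_hardy_def by (subst comm) simp
  show "inner (f + g) h = inner f h + inner g h"
    by (simp add: inner_hardy_def add)
  show "inner (r *\<^sub>R f) g = r * inner f g"
    by (simp add: inner_hardy_def scale scaleR_hardy_scaleC)
  show "0 \<le> inner f f"
    by (auto simp: inner_hardy_self intro!: infsum_nonneg)
  show "inner f f = 0 \<longleftrightarrow> f = 0"
  proof
    assume "inner f f = 0"
    then have "(cmod (hardy_coeff f k))\<^sup>2 = 0" for k
      using square_summable_hardy_coeff[of f] unfolding inner_hardy_self square_summable_def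
      by (intro nonneg_infsum_le_0D[of "\<lambda>k. (cmod (hardy_coeff f k))\<^sup>2" UNIV]) auto
    then show "f = 0"
      by (auto simp: hardy_coeff_0 fun_eq_iff simp flip: hardy_coeff_inject)
  qed (simp add: inner_hardy_self hardy_coeff_0)
qed (simp_all add: norm_hardy_def sgn_hardy_def dist_hardy_def uniformity_hardy_def open_hardy_def)

end

definition mult_z :: "hardy \<Rightarrow> hardy"
  where "mult_z f = Abs_hardy (\<lambda>(z, w). z * Rep_hardy f (z, w))"

definition mult_w :: "hardy \<Rightarrow> hardy"
  where "mult_w f = Abs_hardy (\<lambda>(z, w). w * Rep_hardy f (z, w))"


lemma hardy_expansion_mult_z:
  assumes "hardy_expansion a f"
  shows "hardy_expansion (\<lambda>(i, j). if i = 0 then 0 else a (i - 1, j)) (\<lambda>(z, w). z * f (z, w))"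
proof -
  let ?b = "\<lambda>(i, j). if i = 0 then 0 else a (i - 1, j)" and ?S = "\<lambda>(i, j). (Suc i, j)"
  have inj: "inj ?S" by (auto simp: inj_on_def)
  have rng: "(i, j) \<in> range ?S \<longleftrightarrow> i \<noteq> 0" for i j
    by (cases i) auto
  have "(\<lambda>k. (cmod (?b k))\<^sup>2) summable_on range ?S"
    using assms summable_on_reindex[OF inj, of "\<lambda>k. (cmod (?b k))\<^sup>2"]
    by (simp add: o_def case_prod_unfold hardy_expansion_def square_summable_def)
  then have "square_summable ?b"
    unfolding square_summable_def
    by (rule summable_on_cong_neutral[THEN iffD1, rotated -1]) (auto simp: rng split: if_splits)
  moreover have "((\<lambda>(i, j). ?b (i, j) * z ^ i * w ^ j) has_sum z * f (z, w)) UNIV"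
    if "(z, w) \<in> bidisc" for z w
  proof -
    let ?g = "\<lambda>(i, j). ?b (i, j) * z ^ i * w ^ j"
    have "((\<lambda>k. z * (case k of (i, j) \<Rightarrow> a (i, j) * z ^ i * w ^ j)) has_sum z * f (z, w)) UNIV"
      using assms that by (intro has_sum_cmult_right) (auto simp: hardy_expansion_def)
    then have "(?g has_sum z * f (z, w)) (range ?S)"
      unfolding has_sum_reindex[OF inj] by (simp add: o_def case_prod_unfold mult_ac)
    then show ?thesis
      by (rule has_sum_cong_neutral[THEN iffD1, rotated -1]) (auto simp: rng split: if_splits)
  qed
  ultimately show ?thesis
    using assms by (auto simp: hardy_expansion_def)
qed

lemma hardy_expansion_mult_w:
  assumes "hardy_expansion a f"
  shows "hardy_expansion (\<lambda>(i, j). if j = 0 then 0 else a (i, j - 1)) (\<lambda>(z, w). w * f (z, w))"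
proof -
  let ?b = "\<lambda>(i, j). if j = 0 then 0 else a (i, j - 1)" and ?S = "\<lambda>(i, j). (i, Suc j)"
  have inj: "inj ?S" by (auto simp: inj_on_def)
  have rng: "(i, j) \<in> range ?S \<longleftrightarrow> j \<noteq> 0" for i j
    by (cases j) auto
  have "(\<lambda>k. (cmod (?b k))\<^sup>2) summable_on range ?S"
    using assms summable_on_reindex[OF inj, of "\<lambda>k. (cmod (?b k))\<^sup>2"]
    by (simp add: o_def case_prod_unfold hardy_expansion_def square_summable_def)
  then have "square_summable ?b"
    unfolding square_summable_def
    by (rule summable_on_cong_neutral[THEN iffD1, rotated -1]) (auto simp: rng split: if_splits)
  moreover have "((\<lambda>(i, j). ?b (i, j) * z ^ i * w ^ j) has_sum w * f (z, w)) UNIV"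
    if "(z, w) \<in> bidisc" for z w
  proof -
    let ?g = "\<lambda>(i, j). ?b (i, j) * z ^ i * w ^ j"
    have "((\<lambda>k. w * (case k of (i, j) \<Rightarrow> a (i, j) * z ^ i * w ^ j)) has_sum w * f (z, w)) UNIV"
      using assms that by (intro has_sum_cmult_right) (auto simp: hardy_expansion_def)
    then have "(?g has_sum w * f (z, w)) (range ?S)"
      unfolding has_sum_reindex[OF inj] by (simp add: o_def case_prod_unfold mult_ac)
    then show ?thesis
      by (rule has_sum_cong_neutral[THEN iffD1, rotated -1]) (auto simp: rng split: if_splits)
  qed
  ultimately show ?thesis
    using assms by (auto simp: hardy_expansion_def)
qed

lemma Rep_hardy_mult_z: "Rep_hardy (mult_z f) (z, w) = z * Rep_hardy f (z, w)"
  unfolding mult_z_def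
  by (subst Abs_hardy_inverse)
     (use hardy_expansion_mult_z[OF hardy_expansion_coeff[of f]] in auto)

lemma Rep_hardy_mult_w: "Rep_hardy (mult_w f) (z, w) = w * Rep_hardy f (z, w)"
  unfolding mult_w_def
  by (subst Abs_hardy_inverse)
     (use hardy_expansion_mult_w[OF hardy_expansion_coeff[of f]] in auto)


section \<open>Polynomials and submodules\<close>

text \<open>
  The ring \<open>\<complex>[z,w]\<close> is \<^typ>\<open>complex poly poly\<close>, i.e. \<open>\<complex>[z][w]\<close>: the coefficient of \<open>z\<^sup>iw\<^sup>j\<close> in \<open>p\<close> is
  \<open>coeff (coeff p j) i\<close>.  In particular \<open>poly p 1\<close> is the one-variable polynomial \<open>p(\<zeta>,1)\<close>.
\<close>

definition poly2 :: "complex poly poly \<Rightarrow> complex \<Rightarrow> complex \<Rightarrow> complex"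
  where "poly2 p z w = poly (poly p [:w:]) z"

definition homogeneous_poly :: "complex poly poly \<Rightarrow> bool"
  where "homogeneous_poly p \<longleftrightarrow> (\<exists>d. \<forall>i j. coeff (coeff p j) i \<noteq> 0 \<longrightarrow> i + j = d)"

definition hardy_of_poly :: "complex poly poly \<Rightarrow> hardy"
  where "hardy_of_poly p = Abs_hardy (\<lambda>(z, w). if (z, w) \<in> bidisc then poly2 p z w else 0)"

lemma hardy_expansion_poly:
  "hardy_expansion (\<lambda>(i, j). coeff (coeff p j) i)
     (\<lambda>(z, w). if (z, w) \<in> bidisc then poly2 p z w else 0)"
proof -
  define N where "N = Max ((\<lambda>j. degree (coeff p j)) ` {..degree p})"
  have N: "degree (coeff p j) \<le> N" if "j \<le> degree p" for j
    unfolding N_def using that by (intro Max_ge) auto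
  have "coeff (coeff p j) i = 0" if "(i, j) \<notin> {..N} \<times> {..degree p}" for i j
  proof (cases "j \<le> degree p")
    case True
    then show ?thesis using N[OF True] that by (intro coeff_eq_0) auto
  qed (simp add: coeff_eq_0)
  then have supp: "i \<le> N \<and> j \<le> degree p" if "coeff (coeff p j) i \<noteq> 0" for i j
    using that by auto
  have "square_summable (\<lambda>(i, j). coeff (coeff p j) i)"
    unfolding square_summable_def
    by (rule summable_on_cong_neutral[THEN iffD1, OF _ _ _ summable_on_finite[of "{..N} \<times> {..degree p}"]])
       (auto dest: supp)
  moreover have "((\<lambda>(i, j). coeff (coeff p j) i * z ^ i * w ^ j) has_sum poly2 p z w) UNIV" for z w
  proof -
    have "poly2 p z w = (\<Sum>j\<le>degree p. poly (coeff p j) z * w ^ j)"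
      by (simp add: poly2_def poly_altdef[of p] poly_sum poly_power)
    also have "\<dots> = (\<Sum>j\<le>degree p. \<Sum>i\<le>N. coeff (coeff p j) i * z ^ i * w ^ j)"
    proof (rule sum.cong[OF refl])
      fix j assume "j \<in> {..degree p}"
      then have "(\<Sum>i\<le>N. coeff (coeff p j) i * z ^ i) =
          (\<Sum>i\<le>degree (coeff p j). coeff (coeff p j) i * z ^ i)"
        using N[of j] by (intro sum.mono_neutral_right) (auto simp: coeff_eq_0)
      then show "poly (coeff p j) z * w ^ j = (\<Sum>i\<le>N. coeff (coeff p j) i * z ^ i * w ^ j)"
        by (simp add: poly_altdef flip: sum_distrib_right)
    qed
    also have "\<dots> = (\<Sum>(i, j)\<in>{..N} \<times> {..degree p}. coeff (coeff p j) i * z ^ i * w ^ j)"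
      by (subst sum.swap) (simp add: sum.cartesian_product)
    finally show ?thesis
      by (intro has_sum_cong_neutral[THEN iffD1, OF _ _ _
            has_sum_finiteI[of "{..N} \<times> {..degree p}"]]) (auto dest: supp)
  qed
  ultimately show ?thesis
    by (auto simp: hardy_expansion_def)
qed

lemma hardy_coeff_of_poly: "hardy_coeff (hardy_of_poly p) = (\<lambda>(i, j). coeff (coeff p j) i)"
  unfolding hardy_of_poly_def by (rule hardy_coeff_Abs[OF hardy_expansion_poly])

definition submodule_of :: "complex poly poly \<Rightarrow> hardy set"
  where "submodule_of p = closure (range (\<lambda>r. hardy_of_poly (p * r)))"

text \<open>
  For \<open>M\<close> invariant under both multiplications, the operators \<open>R\<^sub>z\<close> and \<open>R\<^sub>w\<close> on \<open>M\<close> are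
  \<^const>\<open>mult_z\<close> and \<^const>\<open>mult_w\<close>.
\<close>

definition defect_z :: "hardy set \<Rightarrow> hardy \<Rightarrow> hardy"
  where "defect_z M f = f - mult_z (adj_on M mult_z f)"

definition defect_w :: "hardy set \<Rightarrow> hardy \<Rightarrow> hardy"
  where "defect_w M f = f - mult_w (adj_on M mult_w f)"

definition cross_commutator :: "hardy set \<Rightarrow> hardy \<Rightarrow> hardy"
  where "cross_commutator M f = adj_on M mult_z (mult_w f) - mult_w (adj_on M mult_z f)"

definition rank_one_proj :: "'a::complex_inner \<Rightarrow> 'a \<Rightarrow> 'a"
  where "rank_one_proj e f = cinner f e *\<^sub>C e"


section \<open>Mahler measure\<close>

definition circle_haar :: "complex measure"
  where "circle_haar = distr (uniform_measure lborel {0..<2 * pi}) borel cis"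

definition mahler_measure :: "complex poly \<Rightarrow> real"
  where "mahler_measure q = exp (LINT \<zeta>|circle_haar. ln (cmod (poly q \<zeta>)))"

definition circle_L2_norm :: "complex poly \<Rightarrow> real"
  where "circle_L2_norm q = sqrt (LINT \<zeta>|circle_haar. (cmod (poly q \<zeta>))\<^sup>2)"

end

(*
  The space [p] is graded by degree, and the polynomials p * r with r homogeneous of degree n form a copy
  of the polynomials of degree at most n in L^2(|q|^2 dm), on which w acts as the inclusion and z as
  multiplication by the variable.  The orthogonal polynomials of this weight (E n below) span the defect
  space of w, the reversed ones (F n) that of z.  By the Szego recursion, written purely in terms of the
  two commuting isometries, K and X are weighted matchings between these two orthonormal systems, with the
  same singular values |a n|, the moduli of the Verblunsky coefficients.  Since
  |E (n+1)|^2 = |E n|^2 (1 - |a n|^2), the determinants are the limit of |E n|^2 / |p|^2, which Szego's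
  extremal problem identifies: reflecting the zeros of q into the exterior of the disc changes neither |q|
  on the circle nor the norms, and turns q into c * prod (1 - b z) with |b| <= 1, where 1 / (1 - b z) is
  approximated by Cesaro means and |c| is the Mahler measure.
*)
theory Submission
  imports Defs "HOL-Computational_Algebra.Fundamental_Theorem_Algebra"
begin

text \<open>The projection Q is what makes K a strict contraction: \<open>E 0\<close> and
  \<open>F 0\<close> are both \<open>p\<close>, so \<open>p\<close> is fixed by both defect
  projections, and the resulting singular value 1 would make the determinant vanish. Once it is
  removed, K sends \<open>e (Suc n)\<close> to \<open>- a n\<close> times \<open>f (Suc n)\<close>,
  while X sends \<open>f n\<close> to \<open>cnj (a n)\<close> times \<open>e n\<close>. The index
  shift is harmless because determinants and Schatten norms see only the multiset of moduli. The
  spectral claims thus need only that all moduli are below 1 and that their squares are summable.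
  Both follow from the positivity of the Mahler measure \<open>m\<close>: the norms of the
  \<open>F n\<close> stay above \<open>m\<close>, so the product of the numbers
  \<open>1 - (cmod (a n))^2\<close> has a nonzero limit. The Schatten series is then the expansion
  of \<open>- ln (1 - x)\<close> in powers of \<open>x\<close>, summed over the squared moduli
  \<open>x\<close>; all terms are nonnegative, so the order of summation is free. The delicate case
  is a zero of q on the circle, which reflection leaves where it is: there the reciprocal of a
  factor is not square integrable and the logarithm of its modulus is unbounded.\<close>

interpretation complex_vector: vector_space "scaleC :: complex \<Rightarrow> 'a \<Rightarrow> 'a::complex_inner"
  by (rule vector_space_scaleC)

section \<open>Complex inner products and complex subspaces\<close>

lemma cinner_add_right: "cinner x (y + z) = cinner x y + cinner x z"
  for x :: "'a::complex_inner"
  by (metis cinner_add_left cinner_commute complex_cnj_add)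

lemma cinner_scaleC_right: "cinner x (c *\<^sub>C y) = cnj c * cinner x y"
  for x :: "'a::complex_inner"
  by (metis cinner_commute cinner_scaleC_left complex_cnj_mult)

lemma cinner_zero_left [simp]: "cinner 0 x = 0" for x :: "'a::complex_inner"
  by (metis add_cancel_right_right cinner_add_left)

lemma cinner_zero_right [simp]: "cinner x 0 = 0" for x :: "'a::complex_inner"
  by (metis add_cancel_right_right cinner_add_right)

lemma cinner_minus_left: "cinner (- x) y = - cinner x y" for x :: "'a::complex_inner"
  by (metis add_eq_0_iff cinner_add_left cinner_zero_left add.right_inverse)

lemma cinner_minus_right: "cinner x (- y) = - cinner x y" for x :: "'a::complex_inner"
  by (metis add_eq_0_iff cinner_add_right cinner_zero_right add.right_inverse)

lemma cinner_diff_left: "cinner (x - y) z = cinner x z - cinner y z" for x :: "'a::complex_inner"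
  using cinner_add_left[of x "- y" z] by (simp add: cinner_minus_left)

lemma cinner_diff_right: "cinner x (y - z) = cinner x y - cinner x z" for x :: "'a::complex_inner"
  using cinner_add_right[of x y "- z"] by (simp add: cinner_minus_right)

lemma cinner_sum_left: "cinner (sum f A) y = (\<Sum>i\<in>A. cinner (f i) y)" for y :: "'a::complex_inner"
  by (induction A rule: infinite_finite_induct) (auto simp: cinner_add_left)

lemma cinner_sum_right: "cinner y (sum f A) = (\<Sum>i\<in>A. cinner y (f i))" for y :: "'a::complex_inner"
  by (induction A rule: infinite_finite_induct) (auto simp: cinner_add_right)

lemmas cinner_simps = cinner_add_left cinner_add_right cinner_diff_left cinner_diff_right
  cinner_scaleC_left cinner_scaleC_right cinner_minus_left cinner_minus_right

lemma cinner_self: "cinner x x = complex_of_real ((norm x)\<^sup>2)" for x :: "'a::complex_inner"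
proof (rule complex_eqI)
  show "Re (cinner x x) = Re (complex_of_real ((norm x)\<^sup>2))"
    by (simp add: power2_norm_eq_inner inner_cinner)
  have "Im (cinner x x) = - Im (cinner x x)"
    using arg_cong[OF cinner_commute[of x x], of Im] by simp
  then show "Im (cinner x x) = Im (complex_of_real ((norm x)\<^sup>2))" by simp
qed

lemma norm_scaleC: "norm (c *\<^sub>C x) = cmod c * norm x" for x :: "'a::complex_inner"
proof -
  have "complex_of_real ((norm (c *\<^sub>C x))\<^sup>2) = of_real ((cmod c * norm x)\<^sup>2)"
    unfolding cinner_self[symmetric]
    by (simp only: cinner_scaleC_left cinner_scaleC_right)
      (simp add: cinner_self power_mult_distrib mult.assoc[symmetric] mult.commute[of "cnj c"] flip: complex_norm_square)
  then have "(norm (c *\<^sub>C x))\<^sup>2 = (cmod c * norm x)\<^sup>2"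
    by (simp only: of_real_eq_iff)
  then show ?thesis by (rule power2_eq_imp_eq) auto
qed

text \<open>A unimodular multiple of \<open>x\<close> makes the inner product real and nonnegative,
  which reduces the claim to the real Cauchy-Schwarz inequality.\<close>

lemma cinner_cauchy_schwarz: "cmod (cinner x y) \<le> norm x * norm y" for x :: "'a::complex_inner"
proof (cases "cinner x y = 0")
  case False
  define c where "c = cnj (sgn (cinner x y))"
  have c: "cmod c = 1" using False by (simp add: c_def norm_sgn)
  have "of_real (cmod (cinner x y)) = c * cinner x y"
    using False by (simp add: c_def sgn_div_norm scaleR_conv_of_real mult.commute[of "cnj _"]
        complex_norm_square[symmetric] power2_eq_square divide_simps)
  then have "cmod (cinner x y) = Re (cinner (c *\<^sub>C x) y)"
    by (metis Re_complex_of_real cinner_scaleC_left)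
  also have "\<dots> \<le> norm (c *\<^sub>C x) * norm y"
    unfolding inner_cinner[symmetric] by (rule norm_cauchy_schwarz)
  finally show ?thesis by (simp add: norm_scaleC c)
qed simp

lemma bounded_bilinear_cinner: "bounded_bilinear (cinner :: 'a \<Rightarrow> 'a::complex_inner \<Rightarrow> complex)"
  by (unfold_locales, simp_all add: cinner_simps scaleR_scaleC scaleR_conv_of_real)
     (intro exI[of _ 1], auto simp: cinner_cauchy_schwarz)

interpretation cinner: bounded_bilinear "cinner :: 'a \<Rightarrow> 'a::complex_inner \<Rightarrow> complex"
  by (rule bounded_bilinear_cinner)

lemma bounded_bilinear_scaleC:
  "bounded_bilinear (scaleC :: complex \<Rightarrow> 'a \<Rightarrow> 'a::complex_inner)"
  by (unfold_locales, simp_all add: scaleR_scaleC scaleR_conv_of_real scaleC_add_left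
        scaleC_add_right scaleC_scaleC mult_ac)
     (intro exI[of _ 1], auto simp: norm_scaleC)

interpretation scaleC: bounded_bilinear "scaleC :: complex \<Rightarrow> 'a \<Rightarrow> 'a::complex_inner"
  by (rule bounded_bilinear_scaleC)

abbreviation csubspace :: "'a::complex_inner set \<Rightarrow> bool"
  where "csubspace \<equiv> complex_vector.subspace"

lemma csubspace_closure:
  assumes "csubspace (S :: 'a::complex_inner set)"
  shows "csubspace (closure S)"
proof (rule complex_vector.subspaceI)
  show "0 \<in> closure S"
    using complex_vector.subspace_0[OF assms] closure_subset by blast
  fix x y c assume x: "x \<in> closure S"
  then obtain f where f: "\<And>n. f n \<in> S" "f \<longlonglongrightarrow> x" unfolding closure_sequential by blast
  show "c *\<^sub>C x \<in> closure S"
    unfolding closure_sequential using f complex_vector.subspace_scale[OF assms]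
    by (intro exI[of _ "\<lambda>n. c *\<^sub>C f n"]) (auto intro: scaleC.tendsto)
  assume "y \<in> closure S"
  then obtain g where g: "\<And>n. g n \<in> S" "g \<longlonglongrightarrow> y" unfolding closure_sequential by blast
  show "x + y \<in> closure S"
    unfolding closure_sequential using f g complex_vector.subspace_add[OF assms]
    by (intro exI[of _ "\<lambda>n. f n + g n"]) (auto intro: tendsto_add)
qed

lemma csubspace_scaleR: "csubspace S \<Longrightarrow> x \<in> S \<Longrightarrow> r *\<^sub>R x \<in> S"
  by (simp add: scaleR_scaleC complex_vector.subspace_scale)

section \<open>Adjoints\<close>

lemma parallelogram: "(norm (x + y))\<^sup>2 + (norm (x - y))\<^sup>2 = 2 * (norm x)\<^sup>2 + 2 * (norm y)\<^sup>2"
  for x :: "'a::real_inner"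
  by (simp add: power2_norm_eq_inner inner_simps inner_commute)

lemma riesz_on:
  fixes M :: "'a::{complex_inner, banach} set"
  assumes M: "csubspace M" "closed M"
    and add: "\<And>x y. x \<in> M \<Longrightarrow> y \<in> M \<Longrightarrow> \<phi> (x + y) = \<phi> x + \<phi> y"
    and scale: "\<And>c x. x \<in> M \<Longrightarrow> \<phi> (c *\<^sub>C x) = c * \<phi> x"
    and bnd: "\<And>x. x \<in> M \<Longrightarrow> cmod (\<phi> x) \<le> C * norm x"
  shows "\<exists>z\<in>M. \<forall>x\<in>M. \<phi> x = cinner x z"
proof -
  \<comment> \<open>The representing vector is the minimiser of the functional \<open>J\<close>.\<close>
  define J where "J x = (norm x)\<^sup>2 - 2 * Re (\<phi> x)" for x
  define m where "m = (INF x\<in>M. J x)"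
  have ne: "M \<noteq> {}" using complex_vector.subspace_0[OF M(1)] by blast
  have scaleR: "\<phi> (r *\<^sub>R x) = of_real r * \<phi> x" if "x \<in> M" for r x
    using that by (simp add: scaleR_scaleC scale)
  have diff: "\<phi> (x - y) = \<phi> x - \<phi> y" if "x \<in> M" "y \<in> M" for x y
    using add[of x "(-1) *\<^sub>R y"] scaleR[of y "-1"] that csubspace_scaleR[OF M(1), of y "-1"] by simp
  have low: "- C\<^sup>2 \<le> J x" if "x \<in> M" for x
  proof -
    have "Re (\<phi> x) \<le> C * norm x"
      using bnd[OF that] abs_Re_le_cmod[of "\<phi> x"] by linarith
    moreover have "0 \<le> (norm x - C)\<^sup>2" by simp
    ultimately show ?thesis by (simp add: J_def power2_eq_square algebra_simps)
  qed
  have bdd: "bdd_below (J ` M)" using low by (auto simp: bdd_below_def)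
  have mle: "m \<le> J x" if "x \<in> M" for x
    unfolding m_def using bdd that by (rule cINF_lower)
  \<comment> \<open>The midpoint of \<open>x\<close> and \<open>y\<close> lies in \<open>M\<close>,
    so the parallelogram law bounds their distance by the excess of \<open>J\<close> over its
    infimum. Minimising sequences are therefore Cauchy.\<close>
  have par: "(norm (x - y))\<^sup>2 \<le> 2 * (J x - m) + 2 * (J y - m)" if "x \<in> M" "y \<in> M" for x y
  proof -
    have h: "(1 / 2) *\<^sub>R (x + y) \<in> M"
      using that by (intro csubspace_scaleR complex_vector.subspace_add M)
    have "4 * m \<le> 4 * J ((1 / 2) *\<^sub>R (x + y))" using mle[OF h] by simp
    also have "\<dots> = (norm (x + y))\<^sup>2 - 4 * Re (\<phi> x) - 4 * Re (\<phi> y)"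
      using that by (simp add: J_def scaleR add complex_vector.subspace_add M power_divide
        add_divide_distrib)
    finally show ?thesis using parallelogram[of x y] by (simp add: J_def)
  qed
  have "\<exists>x\<in>M. J x < m + 1 / real (Suc n)" for n
    using cINF_less_iff[OF ne bdd, of "m + 1 / real (Suc n)"] unfolding m_def by auto
  then obtain X where X: "\<And>n. X n \<in> M" "\<And>n. J (X n) < m + 1 / real (Suc n)" by metis
  have "Cauchy X"
  proof (rule metric_CauchyI)
    fix e :: real assume e: "0 < e"
    obtain N where N: "4 / e\<^sup>2 < real N" using reals_Archimedean2 by blast
    have bd: "(norm (X i - X j))\<^sup>2 < e\<^sup>2" if "i \<ge> N" "j \<ge> N" for i j
    proof -
      have *: "1 / real (Suc k) \<le> 1 / real (Suc N)" if "k \<ge> N" for k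
        using that by (simp add: frac_le)
      have "(norm (X i - X j))\<^sup>2 < 4 / real (Suc N)"
        using par[OF X(1)[of i] X(1)[of j]] X(2)[of i] X(2)[of j] *[OF that(1)] *[OF that(2)]
        by argo
      also have "\<dots> < e\<^sup>2"
      proof -
        have "4 < real N * e\<^sup>2" using N e by (simp add: divide_less_eq)
        also have "\<dots> \<le> real (Suc N) * e\<^sup>2" by (simp add: mult_right_mono)
        finally show ?thesis by (simp add: divide_less_eq mult.commute)
      qed
      finally show ?thesis .
    qed
    have "dist (X i) (X j) < e" if "i \<ge> N" "j \<ge> N" for i j
      using power_less_imp_less_base[OF bd[OF that]] e by (simp add: dist_norm)
    then show "\<exists>N. \<forall>i\<ge>N. \<forall>j\<ge>N. dist (X i) (X j) < e" by blast
  qed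
  then obtain z where z: "X \<longlonglongrightarrow> z" using Cauchy_convergent_iff convergent_def by blast
  have zM: "z \<in> M" using closed_sequentially[OF M(2) _ z] X(1) by blast
  have Xphi: "(\<lambda>n. \<phi> (X n)) \<longlonglongrightarrow> \<phi> z"
  proof (rule LIM_zero_cancel, rule Lim_null_comparison)
    show "(\<lambda>n. C * norm (X n - z)) \<longlonglongrightarrow> 0"
      using tendsto_mult_left[OF tendsto_norm[OF LIM_zero[OF z]], of C] by simp
    show "\<forall>\<^sub>F n in sequentially. norm (\<phi> (X n) - \<phi> z) \<le> C * norm (X n - z)"
      using bnd[of "X _ - z"] X(1) zM
      by (auto simp: diff intro!: always_eventually complex_vector.subspace_diff[OF M(1)]
          simp flip: diff)
  qed
  have "(\<lambda>n. J (X n)) \<longlonglongrightarrow> J z"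
    unfolding J_def by (intro tendsto_intros z Xphi)
  moreover have "(\<lambda>n. m + 1 / real (Suc n)) \<longlonglongrightarrow> m + 0"
    by (intro tendsto_intros LIMSEQ_Suc[OF lim_1_over_n])
  ultimately have "J z \<le> m + 0"
    by (rule LIMSEQ_le) (use X(2) in \<open>auto intro: less_imp_le\<close>)
  then have zmin: "J z \<le> J x" if "x \<in> M" for x using mle[OF that] by simp
  have re: "Re (\<phi> x) = inner x z" if x: "x \<in> M" for x
  proof -
    have *: "0 \<le> t * (t * (norm x)\<^sup>2 + 2 * (inner x z - Re (\<phi> x)))" for t :: real
    proof -
      have "J z \<le> J (z + t *\<^sub>R x)"
        using x zM by (intro zmin complex_vector.subspace_add csubspace_scaleR M)
      also have "\<dots> = J z + t * (t * (norm x)\<^sup>2 + 2 * (inner x z - Re (\<phi> x)))"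
      proof -
        have "(norm (z + t *\<^sub>R x))\<^sup>2 = (norm z)\<^sup>2 + 2 * t * inner x z + t\<^sup>2 * (norm x)\<^sup>2"
          by (simp only: power2_norm_eq_inner)
            (simp add: inner_simps inner_commute power2_eq_square algebra_simps)
        then show ?thesis
          using x zM by (simp add: J_def add csubspace_scaleR[OF M(1)] scaleR
              power2_eq_square[of t] algebra_simps)
      qed
      finally show ?thesis by simp
    qed
    define k where "k = inner x z - Re (\<phi> x)"
    \<comment> \<open>The quadratic in \<open>t\<close> is tested at \<open>t = - k / n\<close>. The
      summand 1 makes \<open>n\<close> positive even for \<open>x = 0\<close> and keeps the factor
      \<open>2 - (norm x)^2 / n\<close> positive, which forces \<open>k = 0\<close>.\<close>
    define n where "n = (norm x)\<^sup>2 + 1"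
    have n: "n > 0" by (auto simp: n_def intro: add_nonneg_pos)
    have "0 \<le> (- k / n) * ((- k / n) * (norm x)\<^sup>2 + 2 * k)" using *[of "- k / n"] by (simp add: k_def)
    also have "\<dots> = - (k\<^sup>2 / n) * (2 - (norm x)\<^sup>2 / n)"
      by (simp add: power2_eq_square algebra_simps)
    finally have "0 \<le> - (k\<^sup>2 / n) * (2 - (norm x)\<^sup>2 / n)" .
    moreover have "2 - (norm x)\<^sup>2 / n > 0" using n by (simp add: n_def field_simps)
    ultimately have "k\<^sup>2 / n \<le> 0"
      by (smt (verit) mult_neg_pos)
    then have "k = 0" using n by (simp add: divide_le_0_iff)
    then show ?thesis by (simp add: k_def)
  qed
  have "\<phi> x = cinner x z" if x: "x \<in> M" for x
  proof (rule complex_eqI)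
    show "Re (\<phi> x) = Re (cinner x z)" using re[OF x] by (simp add: inner_cinner)
    \<comment> \<open>Multiplying the argument by the imaginary unit turns the imaginary part into a
      real part, up to sign on both sides.\<close>
    have "Re (\<phi> (\<i> *\<^sub>C x)) = Re (cinner (\<i> *\<^sub>C x) z)"
      using re[OF complex_vector.subspace_scale[OF M(1) x]] by (simp add: inner_cinner)
    then show "Im (\<phi> x) = Im (cinner x z)" using x by (simp add: scale cinner_scaleC_left)
  qed
  then show ?thesis using zM by blast
qed

lemma cinner_eq_imp_eq_on:
  assumes "csubspace M" "a \<in> M" "b \<in> M" "\<And>x. x \<in> M \<Longrightarrow> cinner x a = cinner x b"
  shows "a = b"
proof -
  have "cinner (a - b) (a - b) = 0"
    using assms(4)[OF complex_vector.subspace_diff[OF assms(1-3)]] by (simp add: cinner_diff_right)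
  then show ?thesis by (simp add: cinner_self)
qed

text \<open>Vectors of \<open>M\<close> are separated by their inner products with \<open>M\<close>,
  so a candidate that satisfies the adjoint identity is the value picked by \<open>THE\<close>. All
  explicit adjoints are computed this way.\<close>

lemma adj_on_eqI:
  assumes "csubspace M" "z \<in> M" "\<And>x. x \<in> M \<Longrightarrow> cinner (T x) y = cinner x z"
  shows "adj_on M T y = z"
  unfolding adj_on_def
  using assms by (intro the_equality) (auto intro!: cinner_eq_imp_eq_on[OF assms(1)])

lemma adj_on_works:
  fixes M :: "'a::{complex_inner, banach} set"
  assumes M: "csubspace M" "closed M" and T: "clinear_on M T"
    and bnd: "\<And>x. x \<in> M \<Longrightarrow> norm (T x) \<le> C * norm x" and y: "y \<in> M"
  shows "adj_on M T y \<in> M" "\<And>x. x \<in> M \<Longrightarrow> cinner (T x) y = cinner x (adj_on M T y)"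
proof -
  have "\<exists>z\<in>M. \<forall>x\<in>M. cinner (T x) y = cinner x z"
  proof (rule riesz_on[OF M])
    fix x assume x: "x \<in> M"
    have "cmod (cinner (T x) y) \<le> norm (T x) * norm y" by (rule cinner_cauchy_schwarz)
    also have "\<dots> \<le> (C * norm x) * norm y" by (intro mult_right_mono bnd x) auto
    finally show "cmod (cinner (T x) y) \<le> (C * norm y) * norm x" by (simp add: mult_ac)
  qed (use T in \<open>auto simp: clinear_on_def cinner_simps\<close>)
  then obtain z where "z \<in> M" "\<And>x. x \<in> M \<Longrightarrow> cinner (T x) y = cinner x z" by blast
  with adj_on_eqI[OF M(1), of z T y] show "adj_on M T y \<in> M"
    "\<And>x. x \<in> M \<Longrightarrow> cinner (T x) y = cinner x (adj_on M T y)" by auto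
qed

section \<open>Operators with given singular value decomposition\<close>

text \<open>A singular value expansion whose coefficients may carry a phase: for orthonormal
  \<open>u\<close> and \<open>v\<close> the singular values are the moduli of the
  \<open>c n\<close>. The operator vanishes on everything orthogonal to all \<open>u n\<close>, so
  neither system has to be complete.\<close>

definition diag_op :: "(nat \<Rightarrow> complex) \<Rightarrow> (nat \<Rightarrow> 'a) \<Rightarrow> (nat \<Rightarrow> 'a) \<Rightarrow> 'a \<Rightarrow> 'a::{complex_inner, banach}"
  where "diag_op c u v f = (\<Sum>n. (c n * cinner f (u n)) *\<^sub>C v n)"

definition orthonormal_seq :: "(nat \<Rightarrow> 'a::complex_inner) \<Rightarrow> bool"
  where "orthonormal_seq u \<longleftrightarrow> (\<forall>m n. cinner (u m) (u n) = (if m = n then 1 else 0))"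

lemma orthonormal_seqD: "orthonormal_seq u \<Longrightarrow> cinner (u m) (u n) = (if m = n then 1 else 0)"
  by (simp add: orthonormal_seq_def)

lemma norm_orthonormal: assumes "orthonormal_seq u" shows "norm (u n) = 1"
proof -
  have "complex_of_real ((norm (u n))\<^sup>2) = of_real 1"
    using orthonormal_seqD[OF assms, of n n] unfolding cinner_self by simp
  then have "(norm (u n))\<^sup>2 = 1\<^sup>2" unfolding of_real_eq_iff by simp
  then show ?thesis by (rule power2_eq_imp_eq) auto
qed

lemma bessel_finite:
  assumes "orthonormal_seq u" "finite A"
  shows "(\<Sum>n\<in>A. (cmod (cinner f (u n)))\<^sup>2) \<le> (norm f)\<^sup>2"
proof -
  define g where "g = (\<Sum>n\<in>A. cinner f (u n) *\<^sub>C u n)"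
  have gu: "cinner g (u n) = cinner f (u n)" if "n \<in> A" for n
    using that assms(2) by (simp add: g_def cinner_sum_left cinner_scaleC_left
        orthonormal_seqD[OF assms(1)] sum.delta' if_distrib cong: if_cong)
  have fg: "cinner x g = (\<Sum>n\<in>A. cnj (cinner f (u n)) * cinner x (u n))" for x
    by (simp add: g_def cinner_sum_right cinner_scaleC_right)
  have "cinner f g = (\<Sum>n\<in>A. of_real ((cmod (cinner f (u n)))\<^sup>2))"
    unfolding fg by (intro sum.cong refl) (simp only: complex_norm_square mult.commute)
  moreover have "cinner g g = cinner f g"
    unfolding fg using gu by (intro sum.cong refl) simp
  moreover have "cinner g f = cnj (cinner f g)" by (rule cinner_commute)
  ultimately have "cinner (f - g) (f - g) =
      of_real ((norm f)\<^sup>2 - (\<Sum>n\<in>A. (cmod (cinner f (u n)))\<^sup>2))"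
    by (simp add: cinner_diff_left cinner_diff_right cinner_self[of f])
  then have "(norm (f - g))\<^sup>2 = (norm f)\<^sup>2 - (\<Sum>n\<in>A. (cmod (cinner f (u n)))\<^sup>2)"
    unfolding cinner_self of_real_eq_iff .
  then show ?thesis by (metis diff_ge_0_iff_ge zero_le_power2)
qed

lemma csubspace_suminf:
  fixes f :: "nat \<Rightarrow> 'a::{complex_inner, banach}"
  assumes "csubspace M" "closed M" "summable f" "\<And>n. f n \<in> M"
  shows "suminf f \<in> M"
  by (rule closed_sequentially[OF assms(2) _ summable_LIMSEQ[OF assms(3)]])
    (intro complex_vector.subspace_sum[OF assms(1)] assms(4))

text \<open>Square summability is the Hilbert-Schmidt condition: it gives absolute convergence of
  the series and makes the product of the adjoint with the operator trace class.\<close>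

locale svd =
  fixes M :: "'a::{complex_inner, banach} set" and c :: "nat \<Rightarrow> complex" and u v :: "nat \<Rightarrow> 'a"
  assumes csubspace: "csubspace M" and closed: "closed M"
    and u_in: "u n \<in> M" and v_in: "v n \<in> M"
    and u_on: "orthonormal_seq u" and v_on: "orthonormal_seq v"
    and summable_sq: "summable (\<lambda>n. (cmod (c n))\<^sup>2)"
begin

lemma svd_adjoint: "svd M (\<lambda>n. cnj (c n)) v u"
  using csubspace closed u_in v_in u_on v_on summable_sq by unfold_locales auto

text \<open>Cauchy-Schwarz against Bessel's inequality. The offset \<open>N\<close> lets a single
  estimate serve for convergence, for the operator bound (\<open>N = 0\<close>) and for the tails
  that compactness needs.\<close>

lemma block_bound:
  "(\<Sum>n<k. norm ((c (n + N) * cinner f (u (n + N))) *\<^sub>C v (n + N)))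
    \<le> sqrt (\<Sum>n. (cmod (c (n + N)))\<^sup>2) * norm f"
proof -
  have "(\<Sum>n<k. norm ((c (n + N) * cinner f (u (n + N))) *\<^sub>C v (n + N))) =
      (\<Sum>n<k. \<bar>cmod (c (n + N))\<bar> * \<bar>cmod (cinner f (u (n + N)))\<bar>)"
    by (simp add: norm_scaleC norm_mult norm_orthonormal[OF v_on])
  also have "\<dots> \<le> L2_set (\<lambda>n. cmod (c (n + N))) {..<k} * L2_set (\<lambda>n. cmod (cinner f (u (n + N)))) {..<k}"
    by (rule L2_set_mult_ineq)
  also have "\<dots> \<le> sqrt (\<Sum>n. (cmod (c (n + N)))\<^sup>2) * norm f"
  proof (rule mult_mono)
    show "L2_set (\<lambda>n. cmod (c (n + N))) {..<k} \<le> sqrt (\<Sum>n. (cmod (c (n + N)))\<^sup>2)"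
      unfolding L2_set_def using summable_ignore_initial_segment[OF summable_sq]
      by (intro real_sqrt_le_mono sum_le_suminf) auto
    have "(\<Sum>n<k. (cmod (cinner f (u (n + N))))\<^sup>2) \<le> (norm f)\<^sup>2"
      using bessel_finite[OF u_on, of "(\<lambda>n. n + N) ` {..<k}" f]
      by (simp add: sum.reindex o_def)
    then show "L2_set (\<lambda>n. cmod (cinner f (u (n + N)))) {..<k} \<le> norm f"
      unfolding L2_set_def by (simp add: real_le_lsqrt)
    show "0 \<le> sqrt (\<Sum>n. (cmod (c (n + N)))\<^sup>2)"
      using summable_ignore_initial_segment[OF summable_sq] by (simp add: suminf_nonneg)
  qed (simp add: L2_set_def sum_nonneg)
  finally show ?thesis .
qed

lemma summable_norm_terms: "summable (\<lambda>n. norm ((c n * cinner f (u n)) *\<^sub>C v n))"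
  using block_bound[where N = 0 and f = f] by (intro summableI_nonneg_bounded) auto

lemma summable_terms: "summable (\<lambda>n. (c n * cinner f (u n)) *\<^sub>C v n)"
  by (rule summable_norm_cancel[OF summable_norm_terms])

lemma diag_op_sums: "(\<lambda>n. (c n * cinner f (u n)) *\<^sub>C v n) sums diag_op c u v f"
  unfolding diag_op_def by (rule summable_sums[OF summable_terms])

lemma diag_op_tail:
  "norm (diag_op c u v f - (\<Sum>n<N. (c n * cinner f (u n)) *\<^sub>C v n))
    \<le> sqrt (\<Sum>n. (cmod (c (n + N)))\<^sup>2) * norm f"
proof -
  let ?t = "\<lambda>n. (c n * cinner f (u n)) *\<^sub>C v n"
  have "diag_op c u v f - (\<Sum>n<N. ?t n) = (\<Sum>n. ?t (n + N))"
    unfolding diag_op_def using suminf_minus_initial_segment[OF summable_terms] by simp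
  also have "norm \<dots> \<le> (\<Sum>n. norm (?t (n + N)))"
    by (rule summable_norm[OF summable_ignore_initial_segment[OF summable_norm_terms]])
  also have "\<dots> \<le> sqrt (\<Sum>n. (cmod (c (n + N)))\<^sup>2) * norm f"
    by (intro suminf_le_const block_bound summable_ignore_initial_segment[OF summable_norm_terms])
  finally show ?thesis .
qed

lemma diag_op_bound: "norm (diag_op c u v f) \<le> sqrt (\<Sum>n. (cmod (c n))\<^sup>2) * norm f"
  using diag_op_tail[of f 0] by simp

lemma diag_op_add: "diag_op c u v (f + g) = diag_op c u v f + diag_op c u v g"
  using diag_op_sums[of "f + g"] sums_add[OF diag_op_sums[of f] diag_op_sums[of g]]
  by (intro sums_unique2) (simp_all add: cinner_add_left distrib_left scaleC_add_left)

lemma diag_op_scaleC: "diag_op c u v (a *\<^sub>C f) = a *\<^sub>C diag_op c u v f"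
  using diag_op_sums[of "a *\<^sub>C f"]
    scaleC.bounded_linear_right[THEN bounded_linear.sums, OF diag_op_sums[of f], of a]
  by (intro sums_unique2) (simp_all add: cinner_scaleC_left scaleC_scaleC mult_ac)

lemma diag_op_in: "diag_op c u v f \<in> M"
  unfolding diag_op_def using v_in
  by (intro csubspace_suminf csubspace closed summable_terms complex_vector.subspace_scale)

lemma clinear_diag_op: "clinear_on M (diag_op c u v)"
  by (auto simp: clinear_on_def diag_op_add diag_op_scaleC diag_op_in)

lemma diag_op_adjoint: "cinner (diag_op c u v f) g = cinner f (diag_op (\<lambda>n. cnj (c n)) v u g)"
proof -
  interpret adj: svd M "\<lambda>n. cnj (c n)" v u by (rule svd_adjoint)
  have "(\<lambda>n. cinner ((c n * cinner f (u n)) *\<^sub>C v n) g) sums cinner (diag_op c u v f) g"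
    by (rule cinner.bounded_linear_left[THEN bounded_linear.sums, OF diag_op_sums])
  moreover have "(\<lambda>n. cinner f ((cnj (c n) * cinner g (v n)) *\<^sub>C u n)) sums
      cinner f (diag_op (\<lambda>n. cnj (c n)) v u g)"
    by (rule cinner.bounded_linear_right[THEN bounded_linear.sums, OF adj.diag_op_sums])
  moreover have "cinner ((c n * cinner f (u n)) *\<^sub>C v n) g = cinner f ((cnj (c n) * cinner g (v n)) *\<^sub>C u n)" for n
    using cinner_commute[of "v n" g] by (simp add: cinner_simps)
  ultimately show ?thesis using sums_unique2 by simp
qed

lemma diag_op_u: "diag_op c u v (u m) = c m *\<^sub>C v m"
proof -
  have "(\<lambda>n. (c n * cinner (u m) (u n)) *\<^sub>C v n) = (\<lambda>n. if n = m then c m *\<^sub>C v m else 0)"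
    by (auto simp: orthonormal_seqD[OF u_on])
  then show ?thesis
    using sums_unique2[OF diag_op_sums[of "u m"]] sums_single[of m "\<lambda>n. c n *\<^sub>C v n"]
    by (simp cong: if_cong)
qed

lemma cinner_diag_op_v: "cinner (diag_op c u v f) (v n) = c n * cinner f (u n)"
  using svd.diag_op_u[OF svd_adjoint, of n]
  by (simp add: diag_op_adjoint cinner_scaleC_right)

lemma adjoint_diag_op:
  "diag_op (\<lambda>n. cnj (c n)) v u (diag_op c u v f) = diag_op (\<lambda>n. of_real ((cmod (c n))\<^sup>2)) u u f"
  unfolding diag_op_def[of "\<lambda>n. cnj (c n)"] cinner_diag_op_v
  unfolding diag_op_def by (simp only: complex_norm_square mult_ac)

lemma adj_on_diag_op:
  assumes "\<And>f. f \<in> M \<Longrightarrow> T f = diag_op c u v f"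
  shows "adj_on M T g = diag_op (\<lambda>n. cnj (c n)) v u g"
  using assms svd.diag_op_in[OF svd_adjoint]
  by (intro adj_on_eqI csubspace) (auto simp: diag_op_adjoint)

lemma adj_on_self:
  assumes "\<And>f. f \<in> M \<Longrightarrow> T f = diag_op c u v f" and "f \<in> M"
  shows "adj_on M T (T f) = diag_op (\<lambda>n. of_real ((cmod (c n))\<^sup>2)) u u f"
  using assms by (simp add: adj_on_diag_op[OF assms(1)] adjoint_diag_op)

lemma coeff_tendsto_0: "c \<longlonglongrightarrow> 0"
proof -
  have "(\<lambda>n. sqrt ((cmod (c n))\<^sup>2)) \<longlonglongrightarrow> sqrt 0"
    by (intro tendsto_real_sqrt summable_LIMSEQ_zero summable_sq)
  then show ?thesis by (simp add: tendsto_norm_zero_iff)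
qed

lemma finite_level: assumes "s \<noteq> 0" shows "finite {n. c n = s}"
proof -
  have "eventually (\<lambda>n. c n \<noteq> s) sequentially"
    using assms by (intro tendsto_imp_eventually_ne[OF coeff_tendsto_0]) auto
  then obtain N where "\<And>n. n \<ge> N \<Longrightarrow> c n \<noteq> s" by (auto simp: eventually_sequentially)
  then have "{n. c n = s} \<subseteq> {..<N}" by (auto simp: not_less[symmetric])
  then show ?thesis by (rule finite_subset) auto
qed

lemma tail_tendsto_0: "(\<lambda>N. sqrt (\<Sum>n. (cmod (c (n + N)))\<^sup>2)) \<longlonglongrightarrow> 0"
  using tendsto_real_sqrt[OF suminf_exist_split2[OF summable_sq]] by simp

text \<open>Finite-dimensional truncations approximate the operator uniformly on the unit ball, so
  the image of the ball is totally bounded; completeness of the space does the rest.\<close>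

lemma compact_diag_op:
  assumes "\<And>f. f \<in> M \<Longrightarrow> T f = diag_op c u v f"
  shows "compact_op_on M T"
proof -
  let ?B = "\<lambda>k. \<Sum>n. (cmod (c (n + k)))\<^sup>2"
  \<comment> \<open>A compact set containing the \<open>N\<close>-term truncations of all images of
    the unit ball: their coefficients are inner products with \<open>v n\<close>, hence bounded by
    the operator bound \<open>sqrt (?B 0)\<close>.\<close>
  define box where "box N = {\<Sum>n<N. a n *\<^sub>C v n |a. \<forall>n. cmod (a n) \<le> sqrt (?B 0)}" for N
  have B0: "0 \<le> sqrt (?B 0)" using summable_sq by (simp add: suminf_nonneg)
  have box: "compact (box N)" for N
  proof (induction N)
    case 0
    have "box 0 = {0}" using B0 by (auto simp: box_def intro!: exI[of _ "\<lambda>_. 0"])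
    then show ?case by simp
  next
    case (Suc N)
    have "box (Suc N) = (\<lambda>(x, a). x + a *\<^sub>C v N) ` (box N \<times> cball 0 (sqrt (?B 0)))"
    proof (intro equalityI subsetI)
      fix x assume "x \<in> box (Suc N)"
      then obtain a where a: "\<And>n. cmod (a n) \<le> sqrt (?B 0)" "x = (\<Sum>n<Suc N. a n *\<^sub>C v n)"
        by (auto simp: box_def)
      then have "x = (\<lambda>(x, a). x + a *\<^sub>C v N) (\<Sum>n<N. a n *\<^sub>C v n, a N)" by simp
      moreover have "(\<Sum>n<N. a n *\<^sub>C v n, a N) \<in> box N \<times> cball 0 (sqrt (?B 0))"
        using a(1) by (auto simp: box_def)
      ultimately show "x \<in> (\<lambda>(x, a). x + a *\<^sub>C v N) ` (box N \<times> cball 0 (sqrt (?B 0)))"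
        by (rule image_eqI)
    next
      fix x assume "x \<in> (\<lambda>(x, a). x + a *\<^sub>C v N) ` (box N \<times> cball 0 (sqrt (?B 0)))"
      then obtain y b where y: "y \<in> box N" "cmod b \<le> sqrt (?B 0)" "x = y + b *\<^sub>C v N"
        by auto
      then obtain a where a: "\<And>n. cmod (a n) \<le> sqrt (?B 0)" "cmod b \<le> sqrt (?B 0)"
        "x = (\<Sum>n<N. a n *\<^sub>C v n) + b *\<^sub>C v N"
        by (auto simp: box_def)
      then have "x = (\<Sum>n<Suc N. (a(N := b)) n *\<^sub>C v n)" by simp
      then show "x \<in> box (Suc N)" using a by (auto simp: box_def intro!: exI[of _ "a(N := b)"])
    qed
    moreover have "compact \<dots>"
      by (intro compact_continuous_image compact_Times Suc.IH compact_cball)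
        (auto simp: case_prod_unfold intro!: continuous_intros scaleC.continuous_on)
    ultimately show ?case by simp
  qed
  let ?S = "T ` (M \<inter> cball 0 1)"
  have "\<exists>K. finite K \<and> closure ?S \<subseteq> (\<Union>x\<in>K. ball x e)" if e: "0 < e" for e
  proof -
    have "eventually (\<lambda>N. sqrt (?B N) < e / 3) sequentially"
      using e by (intro order_tendstoD(2)[OF tail_tendsto_0]) auto
    then obtain N where N: "sqrt (?B N) < e / 3" by (auto simp: eventually_sequentially)
    obtain K where K: "finite K" "box N \<subseteq> (\<Union>x\<in>K. ball x (e / 3))"
      using box[of N] e unfolding compact_eq_totally_bounded by (metis divide_pos_pos zero_less_numeral)
    have "?S \<subseteq> (\<Union>x\<in>K. cball x (2 * e / 3))"
    proof
      fix y assume "y \<in> ?S"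
      then obtain f where f: "f \<in> M" "norm f \<le> 1" "y = diag_op c u v f"
        using assms by auto
      let ?y = "\<Sum>n<N. (c n * cinner f (u n)) *\<^sub>C v n"
      have "norm (y - ?y) \<le> sqrt (?B N) * norm f"
        unfolding f(3) by (rule diag_op_tail)
      also have "\<dots> \<le> sqrt (?B N) * 1"
        using f(2) suminf_nonneg[OF summable_ignore_initial_segment[OF summable_sq]]
        by (intro mult_left_mono) auto
      finally have 1: "dist ?y y < e / 3" using N by (simp add: dist_norm norm_minus_commute)
      have "cmod (c n * cinner f (u n)) \<le> sqrt (?B 0)" for n
      proof -
        have "cmod (c n * cinner f (u n)) = cmod (cinner (diag_op c u v f) (v n))"
          by (simp add: cinner_diag_op_v)
        also have "\<dots> \<le> norm (diag_op c u v f) * 1"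
          using cinner_cauchy_schwarz[of _ "v n"] norm_orthonormal[OF v_on] by metis
        also have "\<dots> \<le> sqrt (?B 0) * norm f" using diag_op_bound[of f] by simp
        also have "\<dots> \<le> sqrt (?B 0) * 1" using f(2) B0 by (intro mult_left_mono)
        finally show ?thesis by simp
      qed
      then have "?y \<in> box N" by (auto simp: box_def)
      then obtain x where "x \<in> K" "dist x ?y < e / 3" using K(2) by auto
      with 1 have "dist x y \<le> 2 * e / 3" using dist_triangle[of x y ?y] by linarith
      then show "y \<in> (\<Union>x\<in>K. cball x (2 * e / 3))" using \<open>x \<in> K\<close> by auto
    qed
    \<comment> \<open>A finite union of closed balls is closed, so it also covers the closure; the
      radius \<open>2 * e / 3\<close> leaves room for open balls of radius \<open>e\<close>.\<close>
    then have "closure ?S \<subseteq> (\<Union>x\<in>K. cball x (2 * e / 3))"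
      using K(1) by (intro closure_minimal) auto
    also have "\<dots> \<subseteq> (\<Union>x\<in>K. ball x e)" using e by (intro UN_mono) auto
    finally show ?thesis using K(1) by blast
  qed
  then have "compact (closure ?S)"
    unfolding compact_eq_totally_bounded by (auto simp: complete_eq_closed)
  moreover have "clinear_on M T"
    using clinear_diag_op assms csubspace
    by (auto simp: clinear_on_def complex_vector.subspace_add complex_vector.subspace_scale)
  ultimately show ?thesis by (simp add: compact_op_on_def)
qed

end

section \<open>Eigenspaces and singular values of diagonal operators\<close>

lemma cdim_span_orthonormal:
  assumes "orthonormal_seq u"
  shows "cdim (complex_vector.span (u ` A)) = card A"
proof -
  have inj: "inj_on u A"
    using orthonormal_seqD[OF assms] by (intro inj_onI) (metis zero_neq_one)
  have "\<not> complex_vector.dependent (u ` A)"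
  proof
    assume "complex_vector.dependent (u ` A)"
    then obtain t w x where t: "finite t" "t \<subseteq> u ` A" "(\<Sum>y\<in>t. w y *\<^sub>C y) = 0" "x \<in> t" "w x \<noteq> 0"
      unfolding complex_vector.dependent_explicit by blast
    have on: "cinner y x = (if y = x then 1 else 0)" if yt: "y \<in> t" for y
    proof -
      obtain a b where "y = u a" "x = u b" using yt t(2,4) by blast
      then show ?thesis
        using orthonormal_seqD[OF assms, of a b] orthonormal_seqD[OF assms, of a a] by auto
    qed
    have "0 = cinner (\<Sum>y\<in>t. w y *\<^sub>C y) x" using t(3) by simp
    also have "\<dots> = (\<Sum>y\<in>t. if y = x then w y else 0)"
      unfolding cinner_sum_left cinner_scaleC_left using on by (intro sum.cong) auto
    also have "\<dots> = w x" using t(1,4) by simp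
    finally show False using t(5) by simp
  qed
  then show ?thesis
    unfolding cdim_def using complex_vector.dim_span_eq_card_independent card_image[OF inj] by metis
qed

locale diagonal = svd M d u u for M :: "'a::{complex_inner, banach} set" and d u
begin

text \<open>Pairing the eigenvalue equation with \<open>u n\<close> shows that an eigenvector is
  orthogonal to every \<open>u n\<close> with \<open>d n\<close> different from
  \<open>\<mu>\<close>. As \<open>d\<close> tends to 0, only finitely many indices remain and the
  series becomes a finite sum.\<close>

lemma eigenspace_diag_op:
  assumes D: "\<And>f. f \<in> M \<Longrightarrow> D f = diag_op d u u f" and mu: "\<mu> \<noteq> 0"
  shows "eigenspace_on M D \<mu> = complex_vector.span (u ` {n. d n = \<mu>})"
proof (intro equalityI subsetI)
  fix x assume "x \<in> eigenspace_on M D \<mu>"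
  then have x: "x \<in> M" "diag_op d u u x = \<mu> *\<^sub>C x" by (auto simp: eigenspace_on_def D)
  have zero: "cinner x (u n) = 0" if "d n \<noteq> \<mu>" for n
  proof -
    have "\<mu> * cinner x (u n) = d n * cinner x (u n)"
      using cinner_diag_op_v[of x n] by (simp add: x(2) cinner_scaleC_left)
    then show ?thesis using that by auto
  qed
  have "\<mu> *\<^sub>C x = (\<Sum>n. (d n * cinner x (u n)) *\<^sub>C u n)"
    using x(2) by (simp add: diag_op_def)
  also have "\<dots> = (\<Sum>n\<in>{n. d n = \<mu>}. (d n * cinner x (u n)) *\<^sub>C u n)"
    by (rule suminf_finite[OF finite_level[OF mu]]) (auto simp: zero)
  also have "\<dots> \<in> complex_vector.span (u ` {n. d n = \<mu>})"
    by (intro complex_vector.span_sum complex_vector.span_scale complex_vector.span_base) auto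
  finally have "(1 / \<mu>) *\<^sub>C (\<mu> *\<^sub>C x) \<in> complex_vector.span (u ` {n. d n = \<mu>})"
    by (rule complex_vector.span_scale)
  then show "x \<in> complex_vector.span (u ` {n. d n = \<mu>})" using mu by (simp add: scaleC_scaleC scaleC_one)
next
  fix x assume "x \<in> complex_vector.span (u ` {n. d n = \<mu>})"
  moreover have "complex_vector.span (u ` {n. d n = \<mu>}) \<subseteq> {x \<in> M. diag_op d u u x = \<mu> *\<^sub>C x}"
  proof (rule complex_vector.span_minimal)
    show "u ` {n. d n = \<mu>} \<subseteq> {x \<in> M. diag_op d u u x = \<mu> *\<^sub>C x}"
      using u_in by (auto simp: diag_op_u)
    show "csubspace {x \<in> M. diag_op d u u x = \<mu> *\<^sub>C x}"
      using csubspace diag_op_scaleC[of 0 0]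
      by (auto simp: complex_vector.subspace_def diag_op_add diag_op_scaleC scaleC_add_right
          scaleC_scaleC mult.commute)
  qed
  ultimately show "x \<in> eigenspace_on M D \<mu>" by (auto simp: eigenspace_on_def D)
qed

lemma cdim_eigenspace:
  assumes "\<And>f. f \<in> M \<Longrightarrow> D f = diag_op d u u f" and "\<mu> \<noteq> 0"
  shows "cdim (eigenspace_on M D \<mu>) = card {n. d n = \<mu>}"
  by (subst eigenspace_diag_op[where D = D, OF assms]) (simp_all only: cdim_span_orthonormal[OF u_on])

end

context svd
begin

text \<open>The squared moduli are bounded by their own sum, so they are again square summable and
  the diagonal theory applies to the adjoint times the operator.\<close>

lemma diagonal_self: "diagonal M (\<lambda>n. of_real ((cmod (c n))\<^sup>2)) u"
proof -
  define S where "S = (\<Sum>n. (cmod (c n))\<^sup>2)"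
  have "(cmod (c n))\<^sup>2 \<le> S" for n
    unfolding S_def using sum_le_suminf[OF summable_sq, of "{n}"] by simp
  then have "((cmod (c n))\<^sup>2)\<^sup>2 \<le> S * (cmod (c n))\<^sup>2" for n
    unfolding power2_eq_square[of "(cmod (c n))\<^sup>2"] by (intro mult_right_mono) auto
  then have "summable (\<lambda>n. ((cmod (c n))\<^sup>2)\<^sup>2)"
    by (intro summable_comparison_test'[OF summable_mult[OF summable_sq], of 0 _ S]) auto
  then show ?thesis
    using csubspace closed u_in u_on by unfold_locales (auto simp: norm_power)
qed

lemma singular_values_eq:
  assumes T: "\<And>f. f \<in> M \<Longrightarrow> T f = diag_op c u v f"
  shows "singular_values_on M T = {(s, k). s > 0 \<and> k < card {n. cmod (c n) = s}}"
proof -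
  interpret sq: diagonal M "\<lambda>n. of_real ((cmod (c n))\<^sup>2)" u by (rule diagonal_self)
  have "cdim (eigenspace_on M (\<lambda>f. adj_on M T (T f)) (of_real (s\<^sup>2))) = card {n. cmod (c n) = s}"
    if "s > 0" for s
  proof -
    have "cdim (eigenspace_on M (\<lambda>f. adj_on M T (T f)) (of_real (s\<^sup>2))) =
        card {n. complex_of_real ((cmod (c n))\<^sup>2) = of_real (s\<^sup>2)}"
      using that by (intro sq.cdim_eigenspace adj_on_self[where T = T, OF T]) auto
    also have "{n. complex_of_real ((cmod (c n))\<^sup>2) = of_real (s\<^sup>2)} = {n. cmod (c n) = s}"
      unfolding of_real_eq_iff using that by (auto simp: power2_eq_iff_nonneg)
    finally show ?thesis .
  qed
  then show ?thesis by (auto simp: singular_values_on_def)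
qed

lemma finite_norm_level:
  assumes "s > 0" shows "finite {n. cmod (c n) = s}"
proof -
  interpret sq: diagonal M "\<lambda>n. of_real ((cmod (c n))\<^sup>2)" u by (rule diagonal_self)
  have "finite {n. complex_of_real ((cmod (c n))\<^sup>2) = of_real (s\<^sup>2)}"
    using assms by (intro sq.finite_level) auto
  then show ?thesis by (rule finite_subset[rotated]) auto
qed

text \<open>For each \<open>s\<close>, the repetitions \<open>k\<close> of the singular value
  \<open>s\<close> are matched bijectively with the indices \<open>n\<close> of modulus
  \<open>s\<close>. Zero coefficients give no singular value and contribute
  \<open>0 powr r = 0\<close>. The form with \<open>has_sum\<close> yields summability and value at
  once.\<close>

lemma has_sum_singular_values:
  assumes T: "\<And>f. f \<in> M \<Longrightarrow> T f = diag_op c u v f"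
  shows "((\<lambda>(s, k). s powr r) has_sum S) (singular_values_on M T) \<longleftrightarrow>
    ((\<lambda>n. cmod (c n) powr r) has_sum S) UNIV"
proof -
  let ?A = "\<lambda>s. {n. cmod (c n) = s}"
  have sv: "singular_values_on M T = {(s, k). s > 0 \<and> k < card (?A s)}"
    by (rule singular_values_eq) (rule T)
  have "\<exists>g. bij_betw g {..<card (?A s)} (?A s)" if "s > 0" for s
    using ex_bij_betw_nat_finite[OF finite_norm_level[OF that]] by (simp add: atLeast0LessThan)
  then obtain g where g: "\<And>s. s > 0 \<Longrightarrow> bij_betw (g s) {..<card (?A s)} (?A s)" by metis
  have gc: "cmod (c (g s k)) = s" if "s > 0" "k < card (?A s)" for s k
    using bij_betwE[OF g[OF that(1)]] that(2) by auto
  have "bij_betw (\<lambda>(s, k). g s k) (singular_values_on M T) {n. c n \<noteq> 0}"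
    unfolding sv bij_betw_def
  proof
    show "inj_on (\<lambda>(s, k). g s k) {(s, k). s > 0 \<and> k < card (?A s)}"
    proof (rule inj_onI)
      fix x y assume xy: "x \<in> {(s, k). s > 0 \<and> k < card (?A s)}" "y \<in> {(s, k). s > 0 \<and> k < card (?A s)}"
        "(case x of (s, k) \<Rightarrow> g s k) = (case y of (s, k) \<Rightarrow> g s k)"
      obtain s k t l where eq: "x = (s, k)" "y = (t, l)" by (cases x, cases y)
      have a: "0 < s" "k < card (?A s)" "0 < t" "l < card (?A t)" "g s k = g t l"
        using xy unfolding eq by auto
      have "s = t" using gc[OF a(1,2)] gc[OF a(3,4)] a(5) by simp
      then show "x = y"
        using a bij_betw_imp_inj_on[OF g[OF a(1)]] by (auto simp: eq dest: inj_onD)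
    qed
    show "(\<lambda>(s, k). g s k) ` {(s, k). s > 0 \<and> k < card (?A s)} = {n. c n \<noteq> 0}"
    proof (intro equalityI subsetI)
      fix n assume "n \<in> (\<lambda>(s, k). g s k) ` {(s, k). s > 0 \<and> k < card (?A s)}"
      then obtain s k where "s > 0" "k < card (?A s)" "n = g s k" by auto
      then show "n \<in> {n. c n \<noteq> 0}" using gc by force
    next
      fix n assume "n \<in> {n. c n \<noteq> 0}"
      then have s: "cmod (c n) > 0" by simp
      then have "n \<in> g (cmod (c n)) ` {..<card (?A (cmod (c n)))}"
        using bij_betw_imp_surj_on[OF g[OF s]] by simp
      then show "n \<in> (\<lambda>(s, k). g s k) ` {(s, k). s > 0 \<and> k < card (?A s)}"
        using s by (auto intro!: image_eqI[of _ _ "(cmod (c n), _)"])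
    qed
  qed
  from has_sum_reindex_bij_betw[OF this, of "\<lambda>n. cmod (c n) powr r" S]
  have "((\<lambda>n. cmod (c n) powr r) has_sum S) {n. c n \<noteq> 0} \<longleftrightarrow>
    ((\<lambda>x. cmod (c (case x of (s, k) \<Rightarrow> g s k)) powr r) has_sum S) (singular_values_on M T)" by simp
  also have "\<dots> \<longleftrightarrow> ((\<lambda>(s, k). s powr r) has_sum S) (singular_values_on M T)"
    by (rule has_sum_cong) (auto simp: sv gc)
  also have "((\<lambda>n. cmod (c n) powr r) has_sum S) {n. c n \<noteq> 0} \<longleftrightarrow>
    ((\<lambda>n. cmod (c n) powr r) has_sum S) UNIV"
    by (rule has_sum_cong_neutral) auto
  finally show ?thesis by simp
qed

lemma schatten_diag_op:
  assumes T: "\<And>f. f \<in> M \<Longrightarrow> T f = diag_op c u v f"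
    and S: "(\<lambda>n. cmod (c n) powr r) sums S"
  shows "T \<in> schatten_class_on M r" "schatten_norm_on M r T = S powr (1 / r)"
proof -
  have "((\<lambda>(s, k). s powr r) has_sum S) (singular_values_on M T)"
    using S by (intro has_sum_singular_values[where T = T, OF T, THEN iffD2] sums_nonneg_imp_has_sum) auto
  then show "T \<in> schatten_class_on M r" "schatten_norm_on M r T = S powr (1 / r)"
    using compact_diag_op[where T = T, OF T]
    by (auto simp: schatten_class_on_def schatten_norm_on_def summable_on_def infsumI)
qed

end

section \<open>Fredholm determinants and the logarithmic Schatten series\<close>

context diagonal
begin

text \<open>Real coefficients make \<open>B\<close> symmetric on \<open>M\<close>, so
  \<open>B (B x) = 0\<close> forces \<open>B x\<close> to have norm 0. There are no Jordan chains,
  and algebraic multiplicity equals geometric multiplicity.\<close>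

lemma gen_eigenspace_eq:
  assumes D: "\<And>f. f \<in> M \<Longrightarrow> D f = diag_op d u u f"
    and real: "\<And>n. cnj (d n) = d n" "cnj \<mu> = \<mu>"
  shows "gen_eigenspace_on M (\<lambda>f. f - D f) \<mu> = eigenspace_on M (\<lambda>f. f - D f) \<mu>"
proof -
  define B where "B = (\<lambda>y. y - D y - \<mu> *\<^sub>C y)"
  have BM: "B y \<in> M" if "y \<in> M" for y
    using that csubspace diag_op_in
    by (auto simp: B_def D intro!: complex_vector.subspace_diff complex_vector.subspace_scale)
  have sym: "cinner (B x) y = cinner x (B y)" if "x \<in> M" "y \<in> M" for x y
    using that diag_op_adjoint[of x y] real by (simp add: B_def D cinner_simps)
  have *: "B x = 0" if "x \<in> M" "(B ^^ n) x = 0" for n x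
    using that
  proof (induction n arbitrary: x)
    case 0
    then show ?case using complex_vector.subspace_0[OF csubspace] diag_op_scaleC[of 0 0]
      by (simp add: B_def D)
  next
    case (Suc n)
    have "(B ^^ n) (B x) = 0" using Suc.prems(2) by (simp add: funpow_swap1)
    then have "B (B x) = 0" using Suc.IH[of "B x"] BM[OF Suc.prems(1)] by blast
    then have "cinner (B x) (B x) = 0"
      using sym[OF BM[OF Suc.prems(1)] Suc.prems(1)] by simp
    then show ?case by (simp add: cinner_self)
  qed
  have "(\<exists>n. (B ^^ n) x = 0) \<longleftrightarrow> x - D x = \<mu> *\<^sub>C x" if "x \<in> M" for x
  proof
    assume "\<exists>n. (B ^^ n) x = 0"
    then show "x - D x = \<mu> *\<^sub>C x" using *[OF that] by (auto simp: B_def)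
  next
    assume "x - D x = \<mu> *\<^sub>C x"
    then have "(B ^^ 1) x = 0" by (simp add: B_def)
    then show "\<exists>n. (B ^^ n) x = 0" by blast
  qed
  then show ?thesis unfolding gen_eigenspace_on_def eigenspace_on_def B_def by auto
qed

text \<open>With all factors \<open>1 - e n\<close> positive, the product over eigenvalues is the
  exponential of a sum of logarithms, grouped by the distinct values of
  \<open>1 - e n\<close>.\<close>

lemma fredholm_det_diag_op:
  assumes D: "\<And>f. f \<in> M \<Longrightarrow> D f = diag_op d u u f"
    and d: "\<And>n. d n = of_real (e n)" and e: "\<And>n. 0 \<le> e n" "\<And>n. e n < 1"
    and S: "(\<lambda>n. ln (1 - e n)) sums S"
  shows "fredholm_det_on M (\<lambda>f. f - D f) = of_real (exp S)"
proof -
  let ?T = "\<lambda>f. f - D f"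
  define A where "A \<mu> = {n. d n = 1 - \<mu>}" for \<mu>
  define E where "E = {\<mu>. \<mu> \<noteq> 1 \<and> eigenspace_on M ?T \<mu> \<noteq> {0}}"
  define g where "g \<mu> = real (card (A \<mu>)) * ln (Re \<mu>)" for \<mu>
  have eig: "eigenspace_on M ?T \<mu> = eigenspace_on M D (1 - \<mu>)" for \<mu>
    unfolding eigenspace_on_def
    by (auto simp: scaleC_one complex_vector.scale_left_diff_distrib algebra_simps)
  have finA: "finite (A \<mu>)" if "\<mu> \<noteq> 1" for \<mu>
    unfolding A_def using that by (intro finite_level) auto
  have E_iff: "\<mu> \<in> E \<longleftrightarrow> \<mu> \<noteq> 1 \<and> A \<mu> \<noteq> {}" for \<mu>
  proof (cases "\<mu> = 1")
    case False
    have "complex_vector.span (u ` A \<mu>) \<noteq> {0} \<longleftrightarrow> A \<mu> \<noteq> {}"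
    proof
      assume "A \<mu> \<noteq> {}"
      then obtain n where n: "n \<in> A \<mu>" by blast
      have "u n \<in> complex_vector.span (u ` A \<mu>)" using n by (intro complex_vector.span_base) auto
      moreover have "u n \<noteq> 0" using norm_orthonormal[OF u_on, of n] by auto
      ultimately show "complex_vector.span (u ` A \<mu>) \<noteq> {0}" by blast
    qed auto
    then show ?thesis
      using False by (auto simp: E_def eig A_def eigenspace_diag_op[where D = D, OF D])
  qed (simp add: E_def)
  have mu: "\<mu> = of_real (1 - e n)" if "n \<in> A \<mu>" for n \<mu>
    using that by (simp add: A_def d algebra_simps)
  \<comment> \<open>The logarithms have one sign, so their ordered sum is unconditional, as the
    limit over finite sets of eigenvalues requires. Indices with \<open>e n = 0\<close> belong to
    the excluded eigenvalue 1 and contribute \<open>ln 1 = 0\<close>.\<close>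
  have "((\<lambda>n. - ln (1 - e n)) has_sum - S) UNIV"
    using e by (intro sums_nonneg_imp_has_sum sums_minus S) (auto simp: less_imp_le)
  then have "((\<lambda>n. ln (1 - e n)) has_sum S) UNIV"
    by (simp add: has_sum_uminus)
  then have "((\<lambda>n. ln (1 - e n)) has_sum S) {n. d n \<noteq> 0}"
    by (rule has_sum_cong_neutral[THEN iffD1, rotated -1]) (auto simp: d)
  \<comment> \<open>The sets \<open>A \<mu>\<close> partition the remaining indices, so summing
    first within each set turns the sum over indices into a sum over eigenvalues.\<close>
  moreover have "bij_betw snd (Sigma E A) {n. d n \<noteq> 0}"
    unfolding bij_betw_def
  proof
    show "inj_on snd (Sigma E A)" by (auto simp: inj_on_def A_def)
    show "snd ` Sigma E A = {n. d n \<noteq> 0}"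
    proof (intro equalityI subsetI)
      fix n assume "n \<in> {n. d n \<noteq> 0}"
      then have "(1 - d n, n) \<in> Sigma E A" by (auto simp: E_iff A_def)
      then show "n \<in> snd ` Sigma E A" by force
    qed (auto simp: E_iff A_def)
  qed
  ultimately have "((\<lambda>x. ln (1 - e (snd x))) has_sum S) (Sigma E A)"
    using has_sum_reindex_bij_betw[of snd "Sigma E A" _ "\<lambda>n. ln (1 - e n)"] by blast
  then have gS: "(g has_sum S) E"
  proof (rule has_sum_SigmaD)
    fix \<mu> assume "\<mu> \<in> E"
    then have "finite (A \<mu>)" by (simp add: E_iff finA)
    moreover have "(\<Sum>n\<in>A \<mu>. ln (1 - e n)) = (\<Sum>n\<in>A \<mu>. ln (Re \<mu>))"
      by (intro sum.cong) (auto dest: mu)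
    then have "(\<Sum>n\<in>A \<mu>. ln (1 - e n)) = g \<mu>"
      by (simp add: g_def)
    ultimately show "((\<lambda>n. ln (1 - e (snd (\<mu>, n)))) has_sum g \<mu>) (A \<mu>)"
      by (metis (no_types, lifting) has_sum_cong has_sum_finite snd_conv)
  qed
  have prod: "(\<Prod>\<mu>\<in>F. \<mu> ^ cdim (gen_eigenspace_on M ?T \<mu>)) = of_real (exp (sum g F))"
    if F: "finite F" "F \<subseteq> E" for F
  proof -
    have "\<mu> ^ cdim (gen_eigenspace_on M ?T \<mu>) = of_real (exp (g \<mu>))" if "\<mu> \<in> F" for \<mu>
    proof -
      obtain n where n: "n \<in> A \<mu>" "\<mu> \<noteq> 1" using \<open>\<mu> \<in> F\<close> F(2) E_iff by blast
      have "cdim (gen_eigenspace_on M ?T \<mu>) = card (A \<mu>)"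
        using n cdim_eigenspace[of D "1 - \<mu>", OF D]
        by (subst gen_eigenspace_eq[where D = D, OF D]) (auto simp: d mu[OF n(1)] eig A_def)
      moreover have "exp (g \<mu>) = (1 - e n) ^ card (A \<mu>)"
        using e(2)[of n] mu[OF n(1)] by (simp add: g_def exp_of_nat_mult)
      ultimately show ?thesis using mu[OF n(1)] by simp
    qed
    then show ?thesis by (simp add: exp_sum F(1))
  qed
  have "((\<lambda>F. complex_of_real (exp (sum g F))) \<longlongrightarrow> of_real (exp S)) (finite_subsets_at_top E)"
    using gS unfolding has_sum_def by (intro tendsto_of_real tendsto_exp)
  moreover have "\<forall>\<^sub>F F in finite_subsets_at_top E.
      complex_of_real (exp (sum g F)) = (\<Prod>\<mu>\<in>F. \<mu> ^ cdim (gen_eigenspace_on M ?T \<mu>))"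
    using eventually_finite_subsets_at_top_weakI[of E] prod by simp
  ultimately have "((\<lambda>F. \<Prod>\<mu>\<in>F. \<mu> ^ cdim (gen_eigenspace_on M ?T \<mu>)) \<longlongrightarrow> of_real (exp S))
      (finite_subsets_at_top E)"
    by (rule Lim_transform_eventually)
  then show ?thesis
    unfolding fredholm_det_on_def E_def[symmetric]
    by (intro tendsto_Lim finite_subsets_at_top_neq_bot)
qed

end

context svd
begin

lemma determinant_and_schatten_series:
  assumes T: "\<And>f. f \<in> M \<Longrightarrow> T f = diag_op c u v f"
    and c: "\<And>n. cmod (c n) < 1" and L: "(\<lambda>n. ln (1 - (cmod (c n))\<^sup>2)) sums L"
  shows "trace_class_on M (\<lambda>f. adj_on M T (T f))"
    and "fredholm_det_on M (\<lambda>f. f - adj_on M T (T f)) = of_real (exp L)"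
    and "\<And>r. r \<ge> 1 \<Longrightarrow> T \<in> schatten_class_on M (2 * real r)"
    and "(\<lambda>n. 1 / real (Suc n) * schatten_norm_on M (2 * real (Suc n)) T ^ (2 * Suc n)) sums - L"
proof -
  define x where "x n = (cmod (c n))\<^sup>2" for n
  have x: "0 \<le> x n" "x n < 1" for n
    using c[of n] by (auto simp: x_def abs_square_less_1)
  interpret sq: diagonal M "\<lambda>n. of_real ((cmod (c n))\<^sup>2)" u by (rule diagonal_self)
  have TT: "adj_on M T (T f) = diag_op (\<lambda>n. of_real ((cmod (c n))\<^sup>2)) u u f" if "f \<in> M" for f
    using that by (intro adj_on_self T)
  have sx: "summable x" using summable_sq by (simp add: x_def[abs_def])
  \<comment> \<open>The singular values of this positive operator are the squared moduli of the
    \<open>c n\<close>, so the exponent 1 leads back to \<open>summable_sq\<close>.\<close>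
  show "trace_class_on M (\<lambda>f. adj_on M T (T f))"
    by (rule sq.schatten_diag_op(1)[OF TT])
      (use summable_sums[OF summable_sq] in \<open>auto simp: norm_power\<close>)
  show "fredholm_det_on M (\<lambda>f. f - adj_on M T (T f)) = of_real (exp L)"
    by (rule sq.fredholm_det_diag_op[OF TT, of x L])
      (use x L in \<open>auto simp: x_def\<close>)
  have pw: "cmod (c n) powr (2 * real r) = x n ^ r" if "r \<ge> 1" for n r
  proof (cases "c n = 0")
    case False
    then have "cmod (c n) powr (2 * real r) = cmod (c n) ^ (2 * r)"
      using powr_realpow[of "cmod (c n)" "2 * r"] by simp
    then show ?thesis by (simp add: x_def power_mult)
  qed (use that in \<open>simp add: x_def\<close>)
  have sums_pw: "(\<lambda>n. cmod (c n) powr (2 * real r)) sums (\<Sum>n. x n ^ r)" if "r \<ge> 1" for r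
  proof -
    have "x n ^ r \<le> x n" for n
      using power_decreasing[of 1 r "x n"] that x[of n] by auto
    then have "summable (\<lambda>n. x n ^ r)"
      using x by (intro summable_comparison_test'[OF sx, of 0]) auto
    then show ?thesis using that by (simp add: pw summable_sums)
  qed
  show schatten: "T \<in> schatten_class_on M (2 * real r)" if "r \<ge> 1" for r
    by (rule schatten_diag_op(1)[OF T sums_pw[OF that]])
  have norm_pow: "schatten_norm_on M (2 * real (Suc n)) T ^ (2 * Suc n) = (\<Sum>k. x k ^ Suc n)" for n
  proof -
    let ?S = "\<Sum>k. x k ^ Suc n"
    have s: "summable (\<lambda>k. x k ^ Suc n)"
      using sums_pw[of "Suc n"] pw[of "Suc n"] by (simp add: sums_iff)
    have S: "0 \<le> ?S" using x s by (intro suminf_nonneg) auto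
    have "schatten_norm_on M (2 * real (Suc n)) T = ?S powr (1 / (2 * real (Suc n)))"
      by (rule schatten_diag_op(2)[OF T sums_pw]) auto
    also have "\<dots> ^ (2 * Suc n) = ?S"
    proof (cases "?S = 0")
      case False
      then have "(?S powr (1 / (2 * real (Suc n)))) ^ (2 * Suc n) =
          (?S powr (1 / (2 * real (Suc n)))) powr (2 * real (Suc n))"
        using S by (subst powr_realpow[symmetric]) auto
      also have "\<dots> = ?S" using S by (simp add: powr_powr del: of_nat_Suc)
      finally show ?thesis .
    qed simp
    finally show ?thesis .
  qed
  have log: "((\<lambda>n. x k ^ Suc n / real (Suc n)) has_sum - ln (1 - x k)) UNIV" for k
  proof -
    have "(\<lambda>n. - (x k ^ n) / real n) sums ln (1 - x k)"
      using ln_series'[of "- x k"] x[of k] by simp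
    then have "(\<lambda>n. - (x k ^ Suc n) / real (Suc n)) sums ln (1 - x k)"
      by (subst sums_Suc_iff) simp
    from sums_minus[OF this] show ?thesis
      using x by (intro sums_nonneg_imp_has_sum) auto
  qed
  have logs: "((\<lambda>k. - ln (1 - x k)) has_sum - L) UNIV"
    using x L by (intro sums_nonneg_imp_has_sum sums_minus) (auto simp: x_def)
  \<comment> \<open>The double series has nonnegative terms. Summed over the powers first it gives
    the logarithms, summed over \<open>k\<close> first it gives the Schatten norms; the index
    \<open>n\<close> stands for the exponent \<open>Suc n\<close>.\<close>
  have "((\<lambda>(k, n). x k ^ Suc n / real (Suc n)) has_sum - L) (UNIV \<times> UNIV)"
  proof (rule has_sum_SigmaI)
    show "((\<lambda>n. case (k, n) of (k, n) \<Rightarrow> x k ^ Suc n / real (Suc n)) has_sum - ln (1 - x k)) UNIV" for k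
      using log by simp
    show "((\<lambda>k. - ln (1 - x k)) has_sum - L) UNIV" by (rule logs)
    show "(\<lambda>(k, n). x k ^ Suc n / real (Suc n)) summable_on UNIV \<times> UNIV"
      by (rule summable_on_SigmaI[where g = "\<lambda>k. - ln (1 - x k)"])
        (use log logs x in \<open>auto simp: summable_on_def\<close>)
  qed
  then have "((\<lambda>(n, k). x k ^ Suc n / real (Suc n)) has_sum - L) (UNIV \<times> UNIV)"
    by (subst has_sum_swap) simp
  then have "((\<lambda>n. (\<Sum>k. x k ^ Suc n) / real (Suc n)) has_sum - L) UNIV"
  proof (rule has_sum_SigmaD)
    fix n
    have "(\<lambda>k. x k ^ Suc n) sums (\<Sum>k. x k ^ Suc n)"
      using sums_pw[of "Suc n"] pw[of "Suc n"] by simp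
    then have "((\<lambda>k. x k ^ Suc n / real (Suc n)) has_sum (\<Sum>k. x k ^ Suc n) / real (Suc n)) UNIV"
      using x by (intro sums_nonneg_imp_has_sum sums_divide) auto
    then show "((\<lambda>k. case (n, k) of (n, k) \<Rightarrow> x k ^ Suc n / real (Suc n)) has_sum
        (\<Sum>k. x k ^ Suc n) / real (Suc n)) UNIV" by simp
  qed
  from has_sum_imp_sums[OF this]
  show "(\<lambda>n. 1 / real (Suc n) * schatten_norm_on M (2 * real (Suc n)) T ^ (2 * Suc n)) sums - L"
    unfolding norm_pow by simp
qed

end

section \<open>Bounded operators on a subspace\<close>

definition bounded_op_on :: "'a::complex_inner set \<Rightarrow> ('a \<Rightarrow> 'a) \<Rightarrow> bool"
  where "bounded_op_on M T \<longleftrightarrow> clinear_on M T \<and> (\<exists>C. \<forall>x\<in>M. norm (T x) \<le> C * norm x)"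

lemma bounded_op_onD:
  assumes "bounded_op_on M T"
  shows "x \<in> M \<Longrightarrow> T x \<in> M" "x \<in> M \<Longrightarrow> y \<in> M \<Longrightarrow> T (x + y) = T x + T y"
    "x \<in> M \<Longrightarrow> T (a *\<^sub>C x) = a *\<^sub>C T x"
  using assms by (auto simp: bounded_op_on_def clinear_on_def)

lemma bounded_op_on_adj:
  fixes M :: "'a::{complex_inner, banach} set"
  assumes M: "csubspace M" "closed M" and T: "bounded_op_on M T" "y \<in> M"
  shows "adj_on M T y \<in> M" "\<And>x. x \<in> M \<Longrightarrow> cinner (T x) y = cinner x (adj_on M T y)"
  using adj_on_works[OF M] T unfolding bounded_op_on_def by blast+

lemma bounded_op_on_adj_on:
  fixes M :: "'a::{complex_inner, banach} set"
  assumes M: "csubspace M" "closed M" and T: "bounded_op_on M T"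
  shows "bounded_op_on M (adj_on M T)"
  unfolding bounded_op_on_def clinear_on_def
proof (intro conjI ballI allI)
  show "adj_on M T ` M \<subseteq> M" using bounded_op_on_adj(1)[OF M T] by blast
  fix x y c assume x: "x \<in> M"
  show "adj_on M T (c *\<^sub>C x) = c *\<^sub>C adj_on M T x"
    using bounded_op_on_adj[OF M T] x
    by (intro adj_on_eqI M) (auto simp: cinner_simps complex_vector.subspace_scale M)
  assume y: "y \<in> M"
  show "adj_on M T (x + y) = adj_on M T x + adj_on M T y"
    using bounded_op_on_adj[OF M T] x y
    by (intro adj_on_eqI M) (auto simp: cinner_simps complex_vector.subspace_add M)
next
  obtain C where C: "\<And>x. x \<in> M \<Longrightarrow> norm (T x) \<le> C * norm x"
    using T by (auto simp: bounded_op_on_def)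
  have "norm (adj_on M T y) \<le> C * norm y" if y: "y \<in> M" for y
  proof (cases "adj_on M T y = 0")
    case False
    let ?z = "adj_on M T y"
    have z: "?z \<in> M" using bounded_op_on_adj(1)[OF M T y] .
    have "norm ?z * norm ?z = cmod (cinner ?z ?z)"
      by (simp add: cinner_self power2_eq_square norm_mult)
    also have "\<dots> = cmod (cinner (T ?z) y)"
      using bounded_op_on_adj(2)[OF M T y z] by simp
    also have "\<dots> \<le> norm (T ?z) * norm y" by (rule cinner_cauchy_schwarz)
    also have "\<dots> \<le> (C * norm ?z) * norm y" by (intro mult_right_mono C z) auto
    finally have "norm ?z * norm ?z \<le> norm ?z * (C * norm y)" by (simp add: mult_ac)
    then show ?thesis using False by (simp add: mult_le_cancel_left)
  next
    case True
    show ?thesis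
    proof (cases "y = 0")
      case False
      \<comment> \<open>\<open>C\<close> carries no sign condition; nonnegativity is read off from
        the bound at \<open>y\<close> itself.\<close>
      have "0 \<le> C * norm y" using C[OF y] norm_ge_zero[of "T y"] by linarith
      then show ?thesis using True by simp
    qed (use True in simp)
  qed
  then show "\<exists>C. \<forall>x\<in>M. norm (adj_on M T x) \<le> C * norm x" by blast
qed

lemma bounded_op_on_compose:
  assumes "bounded_op_on M S" "bounded_op_on M T"
  shows "bounded_op_on M (\<lambda>x. S (T x))"
proof -
  obtain A B where AB: "\<And>x. x \<in> M \<Longrightarrow> norm (S x) \<le> A * norm x" "\<And>x. x \<in> M \<Longrightarrow> norm (T x) \<le> B * norm x"
    using assms by (auto simp: bounded_op_on_def)
  have "norm (S (T x)) \<le> (\<bar>A\<bar> * B) * norm x" if "x \<in> M" for x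
  proof -
    have "norm (S (T x)) \<le> A * norm (T x)"
      using that assms(2) by (intro AB) (auto simp: bounded_op_on_def clinear_on_def)
    also have "\<dots> \<le> \<bar>A\<bar> * norm (T x)" by (intro mult_right_mono) auto
    also have "\<dots> \<le> \<bar>A\<bar> * (B * norm x)" using that by (intro mult_left_mono AB) auto
    finally show ?thesis by (simp add: mult_ac)
  qed
  then show ?thesis
    using assms unfolding bounded_op_on_def clinear_on_def
    by (intro conjI exI[of _ "\<bar>A\<bar> * B"]) (auto simp: image_subset_iff)
qed

lemma bounded_op_on_diff:
  assumes "csubspace M" "bounded_op_on M S" "bounded_op_on M T"
  shows "bounded_op_on M (\<lambda>x. S x - T x)"
proof -
  obtain A B where AB: "\<And>x. x \<in> M \<Longrightarrow> norm (S x) \<le> A * norm x" "\<And>x. x \<in> M \<Longrightarrow> norm (T x) \<le> B * norm x"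
    using assms by (auto simp: bounded_op_on_def)
  have "norm (S x - T x) \<le> (A + B) * norm x" if "x \<in> M" for x
    using AB[OF that] norm_triangle_ineq4[of "S x" "T x"] by (simp add: distrib_right)
  then show ?thesis
    using assms(2,3) complex_vector.subspace_diff[OF assms(1)] unfolding bounded_op_on_def clinear_on_def
    by (intro conjI exI[of _ "A + B"]) (auto simp: image_subset_iff complex_vector.scale_right_diff_distrib)
qed

lemma bounded_op_on_id: "bounded_op_on M (\<lambda>x. x)"
  unfolding bounded_op_on_def clinear_on_def by (auto intro!: exI[of _ 1])

lemma bounded_op_on_rank_one:
  assumes "csubspace M" "e \<in> M"
  shows "bounded_op_on M (rank_one_proj e)"
proof -
  have "norm (rank_one_proj e x) \<le> (norm e * norm e) * norm x" for x
    using mult_right_mono[OF cinner_cauchy_schwarz[of x e], of "norm e"]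
    by (simp add: rank_one_proj_def norm_scaleC mult_ac)
  then show ?thesis
    using assms unfolding bounded_op_on_def clinear_on_def rank_one_proj_def
    by (auto simp: cinner_simps scaleC_add_left scaleC_scaleC complex_vector.subspace_scale intro!: exI)
qed

lemma (in svd) bounded_op_on_diag_op: "bounded_op_on M (diag_op c u v)"
  unfolding bounded_op_on_def using clinear_diag_op diag_op_bound by blast

text \<open>This is what extends the agreement of two bounded operators from a generating set to the
  closure of its span.\<close>

lemma bounded_op_on_equaliser:
  assumes M: "csubspace M" "closed M" and S: "bounded_op_on M S" and T: "bounded_op_on M T"
  shows "csubspace {x \<in> M. S x = T x}" "closed {x \<in> M. S x = T x}"
proof -
  have D: "bounded_op_on M (\<lambda>x. S x - T x)" by (rule bounded_op_on_diff[OF M(1) S T])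
  then obtain C where C: "\<And>x. x \<in> M \<Longrightarrow> norm (S x - T x) \<le> C * norm x"
    by (auto simp: bounded_op_on_def)
  have "S 0 = T 0"
    using C[OF complex_vector.subspace_0[OF M(1)]] by simp
  then show "csubspace {x \<in> M. S x = T x}"
    using M bounded_op_onD[OF S] bounded_op_onD[OF T] unfolding complex_vector.subspace_def by auto
  show "closed {x \<in> M. S x = T x}"
    unfolding closed_sequential_limits
  proof (intro allI impI, elim conjE)
    fix f x assume f: "\<forall>n. f n \<in> {x \<in> M. S x = T x}" "f \<longlonglongrightarrow> x"
    have x: "x \<in> M" using closed_sequentially[OF M(2) _ f(2)] f(1) by auto
    have "norm (S x - T x) \<le> C * norm (x - f n)" for n
    proof -
      have xf: "x - f n \<in> M" using x f(1) by (intro complex_vector.subspace_diff M) auto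
      have "x = (x - f n) + f n" by simp
      then have "S x - T x = S (x - f n) - T (x - f n)"
        using bounded_op_onD(2)[OF S xf, of "f n"] bounded_op_onD(2)[OF T xf, of "f n"] f(1) by auto
      then show ?thesis using C[OF xf] by simp
    qed
    moreover have "(\<lambda>n. C * norm (x - f n)) \<longlonglongrightarrow> C * norm (x - x)"
      by (intro tendsto_intros f(2))
    ultimately have "norm (S x - T x) \<le> C * norm (x - x)"
      by (intro LIMSEQ_le_const) auto
    then show "x \<in> {x \<in> M. S x = T x}" using x by simp
  qed
qed

section \<open>The Szego recursion for a pair of commuting isometries\<close>

text \<open>
  The last two assumptions say that \<open>m\<^sup>2\<close> is the infimum in Szego's extremal problem.  Below,
  \<open>E n\<close>, \<open>F n\<close> and \<open>a n\<close> correspond to the monic orthogonal polynomials, their reversals and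
  the (conjugated) Verblunsky coefficients.
\<close>

locale szego_pair =
  fixes Z W :: "'a::{complex_inner, banach} \<Rightarrow> 'a" and p :: 'a and m :: real
  assumes Z_add: "Z (x + y) = Z x + Z y" and Z_scale: "Z (a *\<^sub>C x) = a *\<^sub>C Z x"
    and W_add: "W (x + y) = W x + W y" and W_scale: "W (a *\<^sub>C x) = a *\<^sub>C W x"
    and Z_isometry: "cinner (Z x) (Z y) = cinner x y"
    and W_isometry: "cinner (W x) (W y) = cinner x y"
    and commute: "Z (W x) = W (Z x)"
    and graded: "i + j \<noteq> k + l \<Longrightarrow> cinner ((Z ^^ i) ((W ^^ j) p)) ((Z ^^ k) ((W ^^ l) p)) = 0"
    and m_pos: "m > 0"
    and lower: "c 0 = 1 \<Longrightarrow> m\<^sup>2 \<le> (norm (\<Sum>k\<le>n. c k *\<^sub>C (Z ^^ k) ((W ^^ (n - k)) p)))\<^sup>2"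
    and upper: "\<epsilon> > 0 \<Longrightarrow>
      \<exists>n c. c 0 = 1 \<and> (norm (\<Sum>k\<le>n. c k *\<^sub>C (Z ^^ k) ((W ^^ (n - k)) p)))\<^sup>2 < m\<^sup>2 + \<epsilon>"
begin

definition mon :: "nat \<Rightarrow> nat \<Rightarrow> 'a"
  where "mon i j = (Z ^^ i) ((W ^^ j) p)"

definition M :: "'a set"
  where "M = closure (complex_vector.span (range (\<lambda>(i, j). mon i j)))"

definition form :: "nat \<Rightarrow> (nat \<Rightarrow> complex) \<Rightarrow> 'a"
  where "form n c = (\<Sum>k\<le>n. c k *\<^sub>C mon k (n - k))"

text \<open>The coefficient \<open>a\<close> projects \<open>Z E\<close> onto \<open>W F\<close>.
  Since \<open>E\<close> and \<open>F\<close> have equal norms, its conjugate is the coefficient of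
  the projection of \<open>W F\<close> onto \<open>Z E\<close>, so one number drives both
  sequences.\<close>

primrec EF :: "nat \<Rightarrow> 'a \<times> 'a" where
  "EF 0 = (p, p)"
| "EF (Suc n) =
    (let E = fst (EF n); F = snd (EF n); a = cinner (Z E) (W F) / of_real ((norm F)\<^sup>2)
     in (Z E - a *\<^sub>C W F, W F - cnj a *\<^sub>C Z E))"

definition E :: "nat \<Rightarrow> 'a" where "E n = fst (EF n)"
definition F :: "nat \<Rightarrow> 'a" where "F n = snd (EF n)"
definition a :: "nat \<Rightarrow> complex" where "a n = cinner (Z (E n)) (W (F n)) / of_real ((norm (F n))\<^sup>2)"

lemma E_0: "E 0 = p" and F_0: "F 0 = p"
  by (simp_all add: E_def F_def)

lemma E_Suc: "E (Suc n) = Z (E n) - a n *\<^sub>C W (F n)"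
  and F_Suc: "F (Suc n) = W (F n) - cnj (a n) *\<^sub>C Z (E n)"
  by (simp_all add: E_def F_def a_def Let_def)

lemma Z_0: "Z 0 = 0" and W_0: "W 0 = 0"
  using Z_scale[of 0 0] W_scale[of 0 0] by simp_all

lemma Z_diff: "Z (x - y) = Z x - Z y" and W_diff: "W (x - y) = W x - W y"
  using Z_add[of "x - y" y] W_add[of "x - y" y] by (simp_all add: eq_diff_eq)

lemma Z_sum: "Z (sum f A) = (\<Sum>i\<in>A. Z (f i))" and W_sum: "W (sum f A) = (\<Sum>i\<in>A. W (f i))"
  by (induction A rule: infinite_finite_induct) (simp_all add: Z_0 W_0 Z_add W_add)

lemma norm_Z: "norm (Z x) = norm x"
proof -
  have "complex_of_real ((norm (Z x))\<^sup>2) = of_real ((norm x)\<^sup>2)"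
    using Z_isometry[of x x] by (simp only: cinner_self)
  then show ?thesis unfolding of_real_eq_iff by (simp add: power2_eq_iff_nonneg)
qed

lemma norm_W: "norm (W x) = norm x"
proof -
  have "complex_of_real ((norm (W x))\<^sup>2) = of_real ((norm x)\<^sup>2)"
    using W_isometry[of x x] by (simp only: cinner_self)
  then show ?thesis unfolding of_real_eq_iff by (simp add: power2_eq_iff_nonneg)
qed

lemma continuous_Z: "continuous_on S Z"
proof -
  have "bounded_linear Z"
    by (rule bounded_linear_intro[of _ 1]) (simp_all add: Z_add Z_scale norm_Z scaleR_scaleC)
  then show ?thesis by (rule bounded_linear.continuous_on) (rule continuous_on_id)
qed

lemma continuous_W: "continuous_on S W"
proof -
  have "bounded_linear W"
    by (rule bounded_linear_intro[of _ 1]) (simp_all add: W_add W_scale norm_W scaleR_scaleC)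
  then show ?thesis by (rule bounded_linear.continuous_on) (rule continuous_on_id)
qed

lemma Z_mon: "Z (mon i j) = mon (Suc i) j"
  by (simp add: mon_def)

lemma W_mon: "W (mon i j) = mon i (Suc j)"
proof -
  have "W ((Z ^^ i) x) = (Z ^^ i) (W x)" for x
    by (induction i) (simp_all flip: commute)
  then show ?thesis by (simp add: mon_def)
qed

lemma mon_00: "mon 0 0 = p"
  by (simp add: mon_def)

lemma csubspace_M: "csubspace M" and closed_M: "closed M"
  unfolding M_def by (auto intro!: csubspace_closure complex_vector.subspace_span)

lemma mon_in: "mon i j \<in> M"
  unfolding M_def by (rule subsetD[OF closure_subset], rule complex_vector.span_base) auto

lemma M_minimal:
  assumes "csubspace S" "closed S" "\<And>i j. mon i j \<in> S"
  shows "M \<subseteq> S"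
  unfolding M_def using assms by (intro closure_minimal complex_vector.span_minimal) auto

lemma Z_in: "x \<in> M \<Longrightarrow> Z x \<in> M"
proof -
  have "M \<subseteq> Z -` M"
  proof (rule M_minimal)
    show "csubspace (Z -` M)"
      using csubspace_M by (auto simp: complex_vector.subspace_def Z_add Z_scale Z_0)
    show "closed (Z -` M)" by (rule closed_vimage[OF closed_M continuous_Z])
  qed (simp add: Z_mon mon_in)
  then show "x \<in> M \<Longrightarrow> Z x \<in> M" by auto
qed

lemma W_in: "x \<in> M \<Longrightarrow> W x \<in> M"
proof -
  have "M \<subseteq> W -` M"
  proof (rule M_minimal)
    show "csubspace (W -` M)"
      using csubspace_M by (auto simp: complex_vector.subspace_def W_add W_scale W_0)
    show "closed (W -` M)" by (rule closed_vimage[OF closed_M continuous_W])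
  qed (simp add: W_mon mon_in)
  then show "x \<in> M \<Longrightarrow> W x \<in> M" by auto
qed

lemmas M_closed = complex_vector.subspace_add[OF csubspace_M] complex_vector.subspace_diff[OF csubspace_M]
  complex_vector.subspace_scale[OF csubspace_M] complex_vector.subspace_sum[OF csubspace_M]
  complex_vector.subspace_0[OF csubspace_M] Z_in W_in mon_in

lemma form_in: "form n c \<in> M"
  unfolding form_def by (intro M_closed)

text \<open>The normalisation \<open>d 0 = 1\<close> makes \<open>F n\<close> admissible in the
  extremal problem, which bounds its norm below by \<open>m\<close>.\<close>

lemma EF_form: "\<exists>c d. E n = form n c \<and> F n = form n d \<and> d 0 = 1"
proof (induction n)
  case 0
  then show ?case
    by (auto simp: E_0 F_0 form_def mon_00 scaleC_one intro!: exI[of _ "\<lambda>_. 1"])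
next
  case (Suc n)
  then obtain c d where cd: "E n = form n c" "F n = form n d" "d 0 = 1" by blast
  \<comment> \<open>\<open>W\<close> keeps the index of a coefficient while \<open>Z\<close> raises
    it by one, so the coefficient of index 0 passes unchanged from \<open>F n\<close> to
    \<open>F (Suc n)\<close>.\<close>
  have W: "W (form n d) = form (Suc n) (\<lambda>k. if k \<le> n then d k else 0)" for d
  proof -
    have "form (Suc n) (\<lambda>k. if k \<le> n then d k else 0) =
        (\<Sum>k\<le>n. (if k \<le> n then d k else 0) *\<^sub>C mon k (Suc n - k))"
      unfolding form_def by simp
    also have "\<dots> = W (form n d)"
      unfolding form_def by (simp add: W_sum W_scale W_mon Suc_diff_le)
    finally show ?thesis by simp
  qed
  have Z: "Z (form n c) = form (Suc n) (\<lambda>k. case k of 0 \<Rightarrow> 0 | Suc k \<Rightarrow> c k)" for c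
    unfolding form_def by (subst sum.atMost_Suc_shift) (simp add: Z_sum Z_scale Z_mon)
  have lin: "form k c - s *\<^sub>C form k d = form k (\<lambda>i. c i - s * d i)" for k c d s
    by (simp add: form_def complex_vector.scale_sum_right scaleC_scaleC
        complex_vector.scale_left_diff_distrib sum_subtractf)
  show ?case
    by (intro exI conjI, simp only: E_Suc cd Z W lin, simp only: F_Suc cd Z W lin) (simp add: cd(3))
qed

lemma E_in: "E n \<in> M" and F_in: "F n \<in> M"
  using EF_form[of n] form_in by metis+

lemma graded_form: "i + j \<noteq> n \<Longrightarrow> cinner (form n c) (mon i j) = 0"
  unfolding form_def cinner_sum_left cinner_scaleC_left
  by (intro sum.neutral) (auto simp: mon_def graded)

lemma graded_EF: "i + j \<noteq> n \<Longrightarrow> cinner (E n) (mon i j) = 0" "i + j \<noteq> n \<Longrightarrow> cinner (F n) (mon i j) = 0"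
  using EF_form[of n] graded_form by metis+

lemma graded_EF': "k \<noteq> n \<Longrightarrow> cinner (E n) (E k) = 0" "k \<noteq> n \<Longrightarrow> cinner (F n) (F k) = 0"
  "k \<noteq> n \<Longrightarrow> cinner (E n) (F k) = 0"
proof -
  obtain c d where cd: "E k = form k c" "F k = form k d" using EF_form[of k] by blast
  show "k \<noteq> n \<Longrightarrow> cinner (E n) (E k) = 0" "k \<noteq> n \<Longrightarrow> cinner (F n) (F k) = 0"
    "k \<noteq> n \<Longrightarrow> cinner (E n) (F k) = 0"
    by (auto simp: cd form_def cinner_sum_right cinner_scaleC_right graded_EF)
qed

text \<open>The recursion divides by this norm; the lower bound by the positive number
  \<open>m\<close> shows that it never degenerates.\<close>

lemma norm_F_pos: "norm (F n) > 0"
proof -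
  obtain d where "F n = form n d" "d 0 = 1" using EF_form[of n] by blast
  then have "m\<^sup>2 \<le> (norm (F n))\<^sup>2" using lower[of d n] by (simp add: form_def mon_def)
  then have "0 < (norm (F n))\<^sup>2" using m_pos by (smt (verit) zero_less_power)
  then show ?thesis by auto
qed

text \<open>Monicity modulo the range of the other isometry. It allows \<open>mon n 0\<close> to be
  traded for \<open>E n\<close>, and \<open>mon 0 n\<close> for \<open>F n\<close>, in orthogonality
  and generation arguments.\<close>

lemma E_shape: "\<exists>y\<in>M. E n = mon n 0 + W y" and F_shape: "\<exists>y\<in>M. F n = mon 0 n + Z y"
proof (induction n)
  case 0
  show "\<exists>y\<in>M. E 0 = mon 0 0 + W y" "\<exists>y\<in>M. F 0 = mon 0 0 + Z y"
    by (auto simp: E_0 F_0 mon_00 W_0 Z_0 M_closed intro!: bexI[of _ 0])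
next
  case (Suc n)
  obtain y where y: "y \<in> M" "E n = mon n 0 + W y" using Suc(1) by blast
  have "E (Suc n) = mon (Suc n) 0 + W (Z y - a n *\<^sub>C F n)"
    unfolding E_Suc by (subst y(2)) (simp add: Z_add Z_mon commute W_diff W_scale)
  then show "\<exists>y\<in>M. E (Suc n) = mon (Suc n) 0 + W y"
    using y(1) by (intro bexI[of _ "Z y - a n *\<^sub>C F n"] M_closed F_in)
  obtain y where y: "y \<in> M" "F n = mon 0 n + Z y" using Suc(2) by blast
  have "F (Suc n) = mon 0 (Suc n) + Z (W y - cnj (a n) *\<^sub>C E n)"
    unfolding F_Suc by (subst y(2)) (simp add: W_add W_mon commute Z_diff Z_scale)
  then show "\<exists>y\<in>M. F (Suc n) = mon 0 (Suc n) + Z y"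
    using y(1) by (intro bexI[of _ "W y - cnj (a n) *\<^sub>C E n"] M_closed E_in)
qed

lemma cinner_zero_on_M:
  assumes add: "\<And>x y. T (x + y) = T x + T y" and scale: "\<And>s x. T (s *\<^sub>C x) = s *\<^sub>C T x"
    and cont: "continuous_on UNIV T" and mon: "\<And>i j. cinner g (T (mon i j)) = 0" and x: "x \<in> M"
  shows "cinner g (T x) = 0"
proof -
  have "M \<subseteq> {x. cinner g (T x) = 0}"
  proof (rule M_minimal)
    have "T 0 = 0" using scale[of 0 0] by simp
    then show "csubspace {x. cinner g (T x) = 0}"
      by (auto simp: complex_vector.subspace_def add scale cinner_simps)
    show "closed {x. cinner g (T x) = 0}"
      by (intro closed_Collect_eq continuous_intros cinner.continuous_on cont)
  qed (simp add: mon)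
  then show ?thesis using x by blast
qed

text \<open>Orthogonality to the range of \<open>W\<close> is tested on monomials. If
  \<open>Z\<close> occurs in the monomial, commutation and the isometry property lead back to the
  induction hypotheses. Otherwise the grading leaves one monomial, and \<open>a n\<close> is chosen
  to make its inner product vanish. The equality of norms is carried along because the same
  computation for \<open>F (Suc n)\<close> uses the conjugate coefficient.\<close>

lemma EF_main:
  "(\<forall>x\<in>M. cinner (E n) (W x) = 0) \<and> (\<forall>x\<in>M. cinner (F n) (Z x) = 0) \<and> norm (E n) = norm (F n)"
proof (induction n)
  case 0
  have "cinner p (W (mon i j)) = 0" "cinner p (Z (mon i j)) = 0" for i j
    using graded_EF(1)[of _ _ 0] by (simp_all add: E_0 W_mon Z_mon)
  then show ?case
    using cinner_zero_on_M[OF W_add W_scale continuous_W] cinner_zero_on_M[OF Z_add Z_scale continuous_Z]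
    by (auto simp: E_0 F_0)
next
  case (Suc n)
  then have EW: "\<And>x. x \<in> M \<Longrightarrow> cinner (E n) (W x) = 0" and FZ: "\<And>x. x \<in> M \<Longrightarrow> cinner (F n) (Z x) = 0"
    and nEF: "norm (E n) = norm (F n)" by auto
  define N where "N = complex_of_real ((norm (F n))\<^sup>2)"
  have N0: "N \<noteq> 0" using norm_F_pos[of n] by (auto simp: N_def)
  have FF: "cinner (F n) (F n) = N" and EE: "cinner (E n) (E n) = N"
    by (simp_all add: cinner_self N_def nEF)
  have EF: "cinner (Z (E n)) (W (F n)) = a n * N"
    using N0 by (simp add: a_def N_def)
  have FE: "cinner (W (F n)) (Z (E n)) = cnj (a n) * N"
    using cinner_commute[of "W (F n)" "Z (E n)"] EF by (simp add: N_def)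
  obtain y where y: "y \<in> M" "E n = mon n 0 + W y" using E_shape by blast
  obtain x where x: "x \<in> M" "F n = mon 0 n + Z x" using F_shape by blast
  \<comment> \<open>In the critical degree the pure powers are replaced by \<open>E n\<close> and
    \<open>F n\<close>; the corrections lie in the ranges of \<open>W\<close> and \<open>Z\<close>,
    where the hypotheses apply.\<close>
  have mon_n0: "mon n 0 = E n - W y" and mon_0n: "mon 0 n = F n - Z x"
    using x(2) y(2) by simp_all
  have "cinner (E (Suc n)) (W (mon i j)) = 0" for i j
  proof (cases i)
    case (Suc i')
    have "W (mon i j) = Z (W (mon i' j))" by (simp add: Suc Z_mon W_mon)
    moreover have "cinner (W (F n)) (Z (W (mon i' j))) = 0"
      unfolding commute W_isometry by (intro FZ mon_in)
    ultimately show ?thesis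
      by (simp add: E_Suc cinner_simps Z_isometry EW mon_in)
  next
    case 0
    show ?thesis
    proof (cases "j = n")
      case True
      have "cinner (Z (E n)) (W (Z x)) = 0"
        unfolding commute[symmetric] Z_isometry by (rule EW[OF x(1)])
      then show ?thesis
        by (simp add: 0 True E_Suc mon_0n W_diff cinner_simps W_isometry EF FF FZ x(1))
    qed (simp add: 0 W_mon graded_EF)
  qed
  then have A: "\<forall>x\<in>M. cinner (E (Suc n)) (W x) = 0"
    using cinner_zero_on_M[OF W_add W_scale continuous_W] by blast
  have "cinner (F (Suc n)) (Z (mon i j)) = 0" for i j
  proof (cases j)
    case (Suc j')
    have "Z (mon i j) = W (Z (mon i j'))" by (simp add: Suc Z_mon W_mon)
    moreover have "cinner (Z (E n)) (W (Z (mon i j'))) = 0"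
      unfolding commute[symmetric] Z_isometry by (intro EW mon_in)
    ultimately show ?thesis
      by (simp add: F_Suc cinner_simps W_isometry FZ mon_in)
  next
    case 0
    show ?thesis
    proof (cases "i = n")
      case True
      have "cinner (W (F n)) (Z (W y)) = 0"
        unfolding commute W_isometry by (rule FZ[OF y(1)])
      then show ?thesis
        by (simp add: 0 True F_Suc mon_n0 Z_diff cinner_simps Z_isometry FE EE EW y(1))
    qed (simp add: 0 Z_mon graded_EF)
  qed
  then have B: "\<forall>x\<in>M. cinner (F (Suc n)) (Z x) = 0"
    using cinner_zero_on_M[OF Z_add Z_scale continuous_Z] by blast
  have "cinner (E (Suc n)) (E (Suc n)) = cinner (F (Suc n)) (F (Suc n))"
    by (simp add: E_Suc F_Suc cinner_simps Z_isometry W_isometry EE FF EF FE algebra_simps)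
  then have "(norm (E (Suc n)))\<^sup>2 = (norm (F (Suc n)))\<^sup>2"
    unfolding cinner_self of_real_eq_iff .
  then have "norm (E (Suc n)) = norm (F (Suc n))" by (simp add: power2_eq_iff_nonneg)
  with A B show ?case by blast
qed

lemma E_perp_W: "x \<in> M \<Longrightarrow> cinner (E n) (W x) = 0" and F_perp_Z: "x \<in> M \<Longrightarrow> cinner (F n) (Z x) = 0"
  and norm_E: "norm (E n) = norm (F n)"
  using EF_main by auto

section \<open>Decay of the norms and square summability of the Verblunsky coefficients\<close>

definition N :: "nat \<Rightarrow> real" where "N n = (norm (F n))\<^sup>2"

lemma N_pos: "N n > 0" using norm_F_pos[of n] by (simp add: N_def)

text \<open>Pythagoras: \<open>F (Suc n)\<close> is \<open>W (F n)\<close> minus its projection onto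
  \<open>Z (E n)\<close>, and both of these vectors have squared norm \<open>N n\<close>.\<close>

lemma N_Suc: "N (Suc n) = N n * (1 - (cmod (a n))\<^sup>2)"
proof -
  have EF: "cinner (Z (E n)) (W (F n)) = a n * of_real (N n)"
    using N_pos[of n] by (simp add: a_def N_def)
  have FE: "cinner (W (F n)) (Z (E n)) = cnj (a n) * of_real (N n)"
    using cinner_commute[of "W (F n)" "Z (E n)"] EF by simp
  have FF: "cinner (F n) (F n) = of_real (N n)" and EE: "cinner (E n) (E n) = of_real (N n)"
    by (simp_all add: cinner_self N_def norm_E)
  have "complex_of_real (N (Suc n)) = cinner (F (Suc n)) (F (Suc n))"
    by (simp add: N_def cinner_self)
  also have "\<dots> = of_real (N n) - of_real (N n) * (a n * cnj (a n))"
    by (simp add: F_Suc cinner_simps Z_isometry W_isometry EF FE EE FF algebra_simps)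
  also have "\<dots> = of_real (N n * (1 - (cmod (a n))\<^sup>2))"
    by (simp add: algebra_simps flip: complex_norm_square)
  finally show ?thesis unfolding of_real_eq_iff .
qed

lemma a_less_1: "cmod (a n) < 1"
proof -
  have "N n * (1 - (cmod (a n))\<^sup>2) > 0" using N_pos[of "Suc n"] by (simp add: N_Suc)
  then have "(cmod (a n))\<^sup>2 < 1" using N_pos[of n] by (simp add: zero_less_mult_iff)
  then show ?thesis by (simp add: abs_square_less_1)
qed

lemma N_antimono: "N (Suc n) \<le> N n"
proof -
  have "N n * (1 - (cmod (a n))\<^sup>2) \<le> N n * 1"
    using N_pos[of n] by (intro mult_left_mono) auto
  then show ?thesis by (simp add: N_Suc)
qed

lemma N_lower: "m\<^sup>2 \<le> N n"
proof -
  obtain d where "F n = form n d" "d 0 = 1" using EF_form[of n] by blast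
  then show ?thesis using lower[of d n] by (simp add: form_def mon_def N_def)
qed

text \<open>Two forms with the same coefficient of index 0 differ by an element of the range of
  \<open>Z\<close>, to which \<open>F n\<close> is orthogonal. Hence \<open>F n\<close> solves the
  extremal problem in degree \<open>n\<close>.\<close>

lemma N_le_form:
  assumes "c 0 = 1"
  shows "N n \<le> (norm (form n c))\<^sup>2"
proof -
  obtain x where x: "x \<in> M" "F n = mon 0 n + Z x" using F_shape by blast
  have "\<exists>y\<in>M. form n c = mon 0 n + Z y"
  proof (cases n)
    case 0
    then show ?thesis using assms by (auto simp: form_def mon_00 scaleC_one Z_0 M_closed intro!: bexI[of _ 0])
  next
    case (Suc k)
    have "form n c = mon 0 n + Z (form k (\<lambda>i. c (Suc i)))"
      unfolding form_def Suc by (subst sum.atMost_Suc_shift) (simp add: assms scaleC_one Z_sum Z_scale Z_mon)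
    then show ?thesis using form_in by blast
  qed
  then obtain y where y: "y \<in> M" "form n c = mon 0 n + Z y" by blast
  have eq: "form n c = F n + Z (y - x)" using x(2) y(2) by (simp add: Z_diff)
  have "cinner (F n) (Z (y - x)) = 0" using x(1) y(1) by (intro F_perp_Z M_closed)
  then have "inner (F n) (Z (y - x)) = 0" by (simp add: inner_cinner)
  then have "(norm (form n c))\<^sup>2 = N n + (norm (Z (y - x)))\<^sup>2"
    unfolding eq N_def by (simp only: power2_norm_eq_inner) (simp add: inner_simps inner_commute)
  then show ?thesis by simp
qed

text \<open>A competitor of degree \<open>n\<close> close to the infimum bounds \<open>N n\<close>,
  and monotonicity carries the bound to all later indices.\<close>

lemma N_tendsto: "N \<longlonglongrightarrow> m\<^sup>2"
proof (rule decreasing_tendsto)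
  show "\<forall>\<^sub>F n in sequentially. m\<^sup>2 \<le> N n" using N_lower by simp
  fix x assume "m\<^sup>2 < x"
  then obtain n c where c: "c 0 = 1" "(norm (form n c))\<^sup>2 < m\<^sup>2 + (x - m\<^sup>2)"
    using upper[of "x - m\<^sup>2"] by (auto simp: form_def mon_def)
  have "N k < x" if "k \<ge> n" for k
  proof -
    have "N k \<le> N n" using that by (rule lift_Suc_antimono_le[of N, OF N_antimono])
    also have "\<dots> < x" using N_le_form[of c n] c by simp
    finally show ?thesis .
  qed
  then show "\<forall>\<^sub>F n in sequentially. N n < x" by (auto simp: eventually_sequentially)
qed

lemma log_sums: "(\<lambda>n. ln (1 - (cmod (a n))\<^sup>2)) sums ln (m\<^sup>2 / (norm p)\<^sup>2)"
proof -
  have pos: "1 - (cmod (a n))\<^sup>2 > 0" for n using a_less_1[of n] by (simp add: abs_square_less_1)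
  have "(\<Sum>k<n. ln (1 - (cmod (a k))\<^sup>2)) = ln (N n) - ln (N 0)" for n
    by (induction n) (simp_all add: N_Suc ln_mult_pos[OF N_pos pos])
  moreover have "(\<lambda>n. ln (N n) - ln (N 0)) \<longlonglongrightarrow> ln (m\<^sup>2) - ln (N 0)"
    using m_pos by (intro tendsto_intros N_tendsto) auto
  moreover have "ln (m\<^sup>2) - ln (N 0) = ln (m\<^sup>2 / (norm p)\<^sup>2)"
    using m_pos N_pos[of 0] by (subst ln_div) (auto simp: N_def F_0)
  ultimately show ?thesis by (simp add: sums_def)
qed

text \<open>Comparison through \<open>x \<le> - ln (1 - x)\<close>; this supplies the
  Hilbert-Schmidt condition for both operators.\<close>

lemma summable_a: "summable (\<lambda>n. (cmod (a n))\<^sup>2)"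
proof (rule summable_comparison_test')
  show "summable (\<lambda>n. - ln (1 - (cmod (a n))\<^sup>2))"
    using log_sums by (intro summable_minus) (rule sums_summable)
  fix n
  have "(cmod (a n))\<^sup>2 < 1" using a_less_1[of n] by (simp add: abs_square_less_1)
  then show "norm ((cmod (a n))\<^sup>2) \<le> - ln (1 - (cmod (a n))\<^sup>2)"
    using ln_le_minus_one[of "1 - (cmod (a n))\<^sup>2"] by simp
qed

section \<open>Orthonormal systems and the singular value expansions of X and K\<close>

definition e :: "nat \<Rightarrow> 'a" where "e n = (1 / of_real (norm (F n))) *\<^sub>C E n"
definition f :: "nat \<Rightarrow> 'a" where "f n = (1 / of_real (norm (F n))) *\<^sub>C F n"

lemma orthonormal_e: "orthonormal_seq e" and orthonormal_f: "orthonormal_seq f"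
  using norm_F_pos
  by (auto simp: orthonormal_seq_def e_def f_def cinner_simps graded_EF' cinner_self norm_E power2_eq_square)

lemma e_in: "e n \<in> M" and f_in: "f n \<in> M"
  unfolding e_def f_def by (intro M_closed E_in F_in)+

lemma bounded_Z: "bounded_op_on M Z" and bounded_W: "bounded_op_on M W"
  unfolding bounded_op_on_def clinear_on_def
  by (auto simp: Z_add W_add Z_scale W_scale Z_in W_in norm_Z norm_W intro!: exI[of _ 1])

abbreviation "Z' \<equiv> adj_on M Z"
abbreviation "W' \<equiv> adj_on M W"

lemma bounded_Z': "bounded_op_on M Z'" and bounded_W': "bounded_op_on M W'"
  by (intro bounded_op_on_adj_on csubspace_M closed_M bounded_Z bounded_W)+

lemma Z'_Z: "x \<in> M \<Longrightarrow> Z' (Z x) = x" and W'_W: "x \<in> M \<Longrightarrow> W' (W x) = x"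
  by (auto intro!: adj_on_eqI csubspace_M simp: Z_isometry W_isometry)

lemma Z'_F: "Z' (F n) = 0" and W'_E: "W' (E n) = 0"
  using F_perp_Z E_perp_W cinner_commute[of "Z _" "F n"] cinner_commute[of "W _" "E n"]
  by (auto intro!: adj_on_eqI csubspace_M M_closed)

definition Pz :: "'a \<Rightarrow> 'a" where "Pz x = x - Z (Z' x)"
definition Pw :: "'a \<Rightarrow> 'a" where "Pw x = x - W (W' x)"

lemma bounded_Pz: "bounded_op_on M Pz" and bounded_Pw: "bounded_op_on M Pw"
  unfolding Pz_def[abs_def] Pw_def[abs_def]
  by (rule bounded_op_on_diff[OF csubspace_M bounded_op_on_id bounded_op_on_compose[OF bounded_Z bounded_Z']],
      rule bounded_op_on_diff[OF csubspace_M bounded_op_on_id bounded_op_on_compose[OF bounded_W bounded_W']])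

definition X :: "'a \<Rightarrow> 'a" where "X x = Z' (W x) - W (Z' x)"
definition K :: "'a \<Rightarrow> 'a" where "K x = Pz (Pw x) - rank_one_proj (e 0) x"

lemma bounded_X: "bounded_op_on M X"
  unfolding X_def[abs_def]
  by (rule bounded_op_on_diff[OF csubspace_M bounded_op_on_compose[OF bounded_Z' bounded_W]
        bounded_op_on_compose[OF bounded_W bounded_Z']])

lemma bounded_K: "bounded_op_on M K"
  unfolding K_def[abs_def]
  by (rule bounded_op_on_diff[OF csubspace_M bounded_op_on_compose[OF bounded_Pz bounded_Pw]
        bounded_op_on_rank_one[OF csubspace_M e_in]])

text \<open>The vectors \<open>E n\<close> and the range of \<open>W\<close> generate
  \<open>M\<close>: a monomial containing \<open>W\<close> lies in that range, and
  \<open>mon i 0\<close> is \<open>E i\<close> up to an element of it. This version suits K, which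
  annihilates the range of \<open>W\<close>.\<close>

lemma eq_on_M_via_E:
  assumes "bounded_op_on M S" "bounded_op_on M T"
    and E: "\<And>n. S (E n) = T (E n)" and W: "\<And>x. x \<in> M \<Longrightarrow> S (W x) = T (W x)" and x: "x \<in> M"
  shows "S x = T x"
proof -
  have "M \<subseteq> {x \<in> M. S x = T x}"
  proof (rule M_minimal)
    show sub: "csubspace {x \<in> M. S x = T x}" and "closed {x \<in> M. S x = T x}"
      by (rule bounded_op_on_equaliser[OF csubspace_M closed_M assms(1,2)])+
    fix i j
    show "mon i j \<in> {x \<in> M. S x = T x}"
    proof (cases j)
      case (Suc k)
      then have "mon i j = W (mon i k)" by (simp add: W_mon)
      then show ?thesis using W[OF mon_in[of i k]] mon_in[of i j] by simp
    next
      case 0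
      obtain y where y: "y \<in> M" "E i = mon i 0 + W y" using E_shape by blast
      have "E i - W y \<in> {x \<in> M. S x = T x}"
        using y(1) by (intro complex_vector.subspace_diff[OF sub]) (auto simp: E W E_in W_in)
      then show ?thesis using y(2) 0 by simp
    qed
  qed
  then show ?thesis using x by blast
qed

text \<open>The mirror image, suited to X, which annihilates the range of \<open>Z\<close>.\<close>

lemma eq_on_M_via_F:
  assumes "bounded_op_on M S" "bounded_op_on M T"
    and F: "\<And>n. S (F n) = T (F n)" and Z: "\<And>x. x \<in> M \<Longrightarrow> S (Z x) = T (Z x)" and x: "x \<in> M"
  shows "S x = T x"
proof -
  have "M \<subseteq> {x \<in> M. S x = T x}"
  proof (rule M_minimal)
    show sub: "csubspace {x \<in> M. S x = T x}" and "closed {x \<in> M. S x = T x}"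
      by (rule bounded_op_on_equaliser[OF csubspace_M closed_M assms(1,2)])+
    fix i j
    show "mon i j \<in> {x \<in> M. S x = T x}"
    proof (cases i)
      case (Suc k)
      then have "mon i j = Z (mon k j)" by (simp add: Z_mon)
      then show ?thesis using Z[OF mon_in[of k j]] mon_in[of i j] by simp
    next
      case 0
      obtain y where y: "y \<in> M" "F j = mon 0 j + Z y" using F_shape by blast
      have "F j - Z y \<in> {x \<in> M. S x = T x}"
        using y(1) by (intro complex_vector.subspace_diff[OF sub]) (auto simp: F Z F_in Z_in)
      then show ?thesis using y(2) 0 by simp
    qed
  qed
  then show ?thesis using x by blast
qed

lemma svd_X: "svd M (\<lambda>n. cnj (a n)) f e"
  using csubspace_M closed_M e_in f_in orthonormal_e orthonormal_f summable_a by unfold_locales auto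

text \<open>Both systems start at index 1, because the common vector \<open>e 0\<close> has been
  removed by the rank-one projection.\<close>

lemma svd_K: "svd M (\<lambda>n. - a n) (\<lambda>n. e (Suc n)) (\<lambda>n. f (Suc n))"
  using csubspace_M closed_M e_in f_in orthonormal_e orthonormal_f summable_a
  by unfold_locales (auto simp: orthonormal_seq_def)

lemma E_eq: "E n = of_real (norm (F n)) *\<^sub>C e n" and F_eq: "F n = of_real (norm (F n)) *\<^sub>C f n"
  using norm_F_pos[of n] by (simp_all add: e_def f_def scaleC_scaleC scaleC_one)

text \<open>On the range of \<open>Z\<close> the two products cancel by commutation. On
  \<open>F n\<close> the recursion splits \<open>W (F n)\<close> into \<open>F (Suc n)\<close>,
  killed by the adjoint of \<open>Z\<close>, and a multiple of \<open>Z (E n)\<close>, on which the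
  adjoint undoes \<open>Z\<close>.\<close>

lemma X_eq:
  assumes "x \<in> M"
  shows "X x = diag_op (\<lambda>n. cnj (a n)) f e x"
proof (rule eq_on_M_via_F[OF bounded_X _ _ _ assms])
  interpret svd M "\<lambda>n. cnj (a n)" f e by (rule svd_X)
  show "bounded_op_on M (diag_op (\<lambda>n. cnj (a n)) f e)" by (rule bounded_op_on_diag_op)
  fix n
  have "W (F n) = F (Suc n) + cnj (a n) *\<^sub>C Z (E n)" by (simp add: F_Suc)
  then have "Z' (W (F n)) = Z' (F (Suc n)) + cnj (a n) *\<^sub>C Z' (Z (E n))"
    using bounded_op_onD[OF bounded_Z'] by (simp add: M_closed F_in E_in)
  then have "X (F n) = cnj (a n) *\<^sub>C E n"
    by (simp add: X_def Z'_F Z'_Z E_in W_0)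
  then show "X (F n) = diag_op (\<lambda>n. cnj (a n)) f e (F n)"
    by (subst F_eq) (simp add: diag_op_scaleC diag_op_u E_eq scaleC_scaleC mult_ac)
next
  fix x assume x: "x \<in> M"
  have "X (Z x) = 0"
    using x by (simp add: X_def Z'_Z W_in flip: commute)
  moreover have "cinner (Z x) (f n) = 0" for n
    using F_perp_Z[OF x, of n] cinner_commute[of "Z x" "F n"] by (simp add: f_def cinner_simps)
  ultimately show "X (Z x) = diag_op (\<lambda>n. cnj (a n)) f e (Z x)"
    by (simp add: diag_op_def)
qed

text \<open>\<open>Pw\<close> annihilates the range of \<open>W\<close> and fixes every
  \<open>E n\<close>, so everything rests on \<open>Pz\<close> applied to
  \<open>E n\<close>.\<close>

lemma K_eq:
  assumes "x \<in> M"
  shows "K x = diag_op (\<lambda>n. - a n) (\<lambda>n. e (Suc n)) (\<lambda>n. f (Suc n)) x"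
proof (rule eq_on_M_via_E[OF bounded_K _ _ _ assms])
  interpret svd M "\<lambda>n. - a n" "\<lambda>n. e (Suc n)" "\<lambda>n. f (Suc n)" by (rule svd_K)
  let ?D = "diag_op (\<lambda>n. - a n) (\<lambda>n. e (Suc n)) (\<lambda>n. f (Suc n))"
  show "bounded_op_on M ?D" by (rule bounded_op_on_diag_op)
  have Pz_Z: "Pz (Z x) = 0" if "x \<in> M" for x using that by (simp add: Pz_def Z'_Z)
  have Pz_F: "Pz (F n) = F n" for n by (simp add: Pz_def Z'_F Z_0)
  have Pw_E: "Pw (E n) = E n" for n by (simp add: Pw_def W'_E W_0)
  fix n
  show "K (E n) = ?D (E n)"
  proof (cases n)
    case 0
    \<comment> \<open>As \<open>E 0 = F 0\<close>, this vector is fixed by both defect projections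
      and the rank-one term cancels it exactly.\<close>
    have "?D (E 0) = 0"
      by (simp add: diag_op_def e_def cinner_simps graded_EF')
    moreover have "cinner (e 0) (e 0) = 1" using orthonormal_e by (simp add: orthonormal_seq_def)
    then have "rank_one_proj (e 0) (E 0) = E 0"
      by (simp add: rank_one_proj_def E_eq[of 0] cinner_simps)
    moreover have "Pz (E 0) = E 0" using Pz_F[of 0] by (simp add: E_0 F_0)
    ultimately show ?thesis by (simp add: 0 K_def Pw_E)
  next
    case (Suc k)
    have "W (F k) = F (Suc k) + cnj (a k) *\<^sub>C Z (E k)" by (simp add: F_Suc)
    \<comment> \<open>Eliminating \<open>W (F k)\<close> from the two recursion formulas expresses
      \<open>E (Suc k)\<close> through \<open>F (Suc k)\<close> and an element of the range of
      \<open>Z\<close>, which \<open>Pz\<close> fixes and kills respectively.\<close>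
    then have "E (Suc k) = (- a k) *\<^sub>C F (Suc k) + Z ((1 - a k * cnj (a k)) *\<^sub>C E k)"
      by (simp add: E_Suc scaleC_add_right scaleC_scaleC Z_scale complex_vector.scale_left_diff_distrib
          scaleC_one complex_vector.scale_minus_left Z_diff)
    then have "Pz (E (Suc k)) =
        Pz ((- a k) *\<^sub>C F (Suc k)) + Pz (Z ((1 - a k * cnj (a k)) *\<^sub>C E k))"
      by (simp only:) (intro bounded_op_onD(2)[OF bounded_Pz] M_closed F_in E_in)
    then have "Pz (E (Suc k)) = (- a k) *\<^sub>C F (Suc k)"
      by (simp only: bounded_op_onD(3)[OF bounded_Pz] F_in E_in M_closed Pz_Z Pz_F add_0_right)
    moreover have "rank_one_proj (e 0) (E (Suc k)) = 0"
      by (simp add: rank_one_proj_def e_def cinner_simps graded_EF')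
    moreover have "?D (E (Suc k)) = (- a k) *\<^sub>C F (Suc k)"
      using norm_F_pos[of "Suc k"]
      by (subst E_eq) (simp add: diag_op_scaleC diag_op_u, simp add: f_def scaleC_scaleC)
    ultimately show ?thesis by (simp add: Suc K_def Pw_E)
  qed
next
  fix x assume x: "x \<in> M"
  have e: "cinner (W x) (e n) = 0" for n
    using E_perp_W[OF x, of n] cinner_commute[of "W x" "E n"] by (simp add: e_def cinner_simps)
  have "Pw (W x) = 0" using x by (simp add: Pw_def W'_W)
  moreover have "Pz 0 = 0" using bounded_op_onD(3)[OF bounded_Pz, of 0 0] by (simp add: M_closed)
  ultimately have "K (W x) = 0" by (simp add: K_def rank_one_proj_def e)
  then show "K (W x) = diag_op (\<lambda>n. - a n) (\<lambda>n. e (Suc n)) (\<lambda>n. f (Suc n)) (W x)"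
    by (simp add: diag_op_def e)
qed

end

section \<open>The coefficient norm of a polynomial\<close>

text \<open>The norm of the one-variable Hardy space, taken on coefficients so that the extremal
  problem stays algebraic; Parseval later identifies it with \<open>circle_L2_norm\<close>.\<close>

definition coeff_norm :: "complex poly \<Rightarrow> real"
  where "coeff_norm g = L2_set (\<lambda>i. cmod (coeff g i)) {..degree g}"

lemma coeff_norm_eq:
  assumes "degree g \<le> n"
  shows "coeff_norm g = L2_set (\<lambda>i. cmod (coeff g i)) {..n}"
  unfolding coeff_norm_def L2_set_def
  using assms by (intro arg_cong[where f = sqrt] sum.mono_neutral_left) (auto simp: coeff_eq_0)

lemma coeff_norm_sq:
  assumes "degree g \<le> n"
  shows "(coeff_norm g)\<^sup>2 = (\<Sum>i\<le>n. (cmod (coeff g i))\<^sup>2)"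
  unfolding coeff_norm_eq[OF assms] L2_set_def by (simp add: sum_nonneg)

lemma coeff_norm_nonneg: "0 \<le> coeff_norm g"
  by (simp add: coeff_norm_def L2_set_def sum_nonneg)

lemma coeff_norm_0 [simp]: "coeff_norm 0 = 0"
  by (simp add: coeff_norm_def L2_set_def)

lemma coeff_norm_triangle: "coeff_norm (g + h) \<le> coeff_norm g + coeff_norm h"
proof -
  let ?n = "max (degree g) (degree h)"
  have "coeff_norm (g + h) = L2_set (\<lambda>i. cmod (coeff g i + coeff h i)) {..?n}"
    by (subst coeff_norm_eq[OF degree_add_le_max]) simp
  also have "\<dots> \<le> L2_set (\<lambda>i. cmod (coeff g i) + cmod (coeff h i)) {..?n}"
    by (intro L2_set_mono norm_triangle_ineq) auto
  also have "\<dots> \<le> coeff_norm g + coeff_norm h"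
    using L2_set_triangle_ineq by (simp add: coeff_norm_eq[of _ ?n])
  finally show ?thesis .
qed

lemma coeff_norm_smult: "coeff_norm (smult c g) = cmod c * coeff_norm g"
  unfolding coeff_norm_eq[OF degree_smult_le] coeff_norm_eq[OF order_refl]
  by (simp add: norm_mult flip: L2_set_right_distrib)

lemma coeff_norm_pCons_0: "coeff_norm (pCons 0 g) = coeff_norm g"
proof -
  have "coeff_norm (pCons 0 g) = L2_set (\<lambda>i. cmod (coeff (pCons 0 g) i)) {..Suc (degree g)}"
    by (rule coeff_norm_eq) (rule degree_pCons_le)
  also have "\<dots> = coeff_norm g"
    unfolding coeff_norm_eq[OF order_refl] L2_set_def by (subst sum.atMost_Suc_shift) simp
  finally show ?thesis .
qed

text \<open>The induction builds up \<open>C\<close> as the sum of the moduli of the coefficients of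
  \<open>g\<close>, each monomial being an isometric shift.\<close>

lemma coeff_norm_mult_bounded: "\<exists>C\<ge>0. \<forall>h. coeff_norm (h * g) \<le> C * coeff_norm h"
proof (induction g rule: pCons_induct)
  case 0
  then show ?case by auto
next
  case (pCons a g)
  then obtain C where C: "C \<ge> 0" "\<And>h. coeff_norm (h * g) \<le> C * coeff_norm h" by blast
  have "coeff_norm (h * pCons a g) \<le> (cmod a + C) * coeff_norm h" for h
    using coeff_norm_triangle[of "smult a h" "pCons 0 (h * g)"] C(2)[of h]
    by (simp add: coeff_norm_smult coeff_norm_pCons_0 distrib_right)
  then show ?case using C(1) by (intro exI[of _ "cmod a + C"]) auto
qed

lemma coeff_norm_ge_coeff_0: "cmod (coeff g 0) \<le> coeff_norm g"
  unfolding coeff_norm_def by (rule member_le_L2_set) auto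

text \<open>The constant 1 is orthogonal to the polynomials without constant term. This converts an
  approximation error into an upper bound in the extremal problem.\<close>

lemma coeff_norm_sq_split:
  assumes "coeff g 0 = 1"
  shows "(coeff_norm g)\<^sup>2 = 1 + (coeff_norm (g - 1))\<^sup>2"
proof -
  have d: "degree (g - 1) \<le> degree g"
    using degree_diff_le_max[of g 1] by simp
  have "(coeff_norm g)\<^sup>2 = (\<Sum>i\<le>degree g. (cmod (coeff g i))\<^sup>2)"
    by (rule coeff_norm_sq) simp
  also have "\<dots> = (\<Sum>i\<le>degree g. (cmod (coeff (g - 1) i))\<^sup>2 + (if i = 0 then 1 else 0))"
    using assms by (intro sum.cong) auto
  also have "\<dots> = 1 + (coeff_norm (g - 1))\<^sup>2"
    by (simp add: sum.distrib coeff_norm_sq[OF d])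
  finally show ?thesis .
qed

text \<open>The coefficient form of the equality of \<open>cmod (\<zeta> - a)\<close> and
  \<open>cmod (1 - cnj a * \<zeta>)\<close> on the unit circle.\<close>

lemma coeff_norm_reflect_root: "coeff_norm (g * [:- a, 1:]) = coeff_norm (g * [:1, - cnj a:])"
proof -
  let ?n = "degree g"
  define G where "G = coeff g"
  have G: "G (Suc ?n) = 0" by (simp add: G_def coeff_eq_0)
  have deg: "degree (g * [:b, c:]) \<le> Suc ?n" for b c
    using degree_mult_le[of g "[:b, c:]"] by (simp split: if_splits)
  have 0: "coeff (g * [:b, c:]) 0 = b * G 0" for b c by (simp add: G_def coeff_mult_0)
  have S: "coeff (g * [:b, c:]) (Suc i) = b * G (Suc i) + c * G i" for b c i
    by (simp add: G_def mult_pCons_right)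
  \<comment> \<open>Coefficientwise the squared moduli differ by \<open>1 - (cmod a)^2\<close> times
    a telescoping difference; its boundary term cancels the contribution of the constant
    coefficient.\<close>
  have diff: "(cmod (- a * G (Suc i) + 1 * G i))\<^sup>2 - (cmod (1 * G (Suc i) + - cnj a * G i))\<^sup>2 =
      (1 - (cmod a)\<^sup>2) * ((cmod (G i))\<^sup>2 - (cmod (G (Suc i)))\<^sup>2)" for i
    unfolding cmod_power2 by (simp add: power2_eq_square algebra_simps)
  have "(coeff_norm (g * [:- a, 1:]))\<^sup>2 - (coeff_norm (g * [:1, - cnj a:]))\<^sup>2 =
      ((cmod a)\<^sup>2 - 1) * (cmod (G 0))\<^sup>2 +
      (\<Sum>i\<le>?n. (1 - (cmod a)\<^sup>2) * ((cmod (G i))\<^sup>2 - (cmod (G (Suc i)))\<^sup>2))"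
    unfolding coeff_norm_sq[OF deg] sum.atMost_Suc_shift S 0 diff[symmetric] sum_subtractf
    by (simp add: norm_mult power_mult_distrib algebra_simps)
  also have "\<dots> = 0"
    unfolding sum_distrib_left[symmetric] sum_telescope[of "\<lambda>i. (cmod (G i))\<^sup>2"] by (simp add: G algebra_simps)
  finally show ?thesis
    using coeff_norm_nonneg by (simp add: power2_eq_iff_nonneg)
qed

section \<open>Szego's extremal problem for polynomials\<close>

text \<open>Parametrised by reciprocals of zeros, so that \<open>cmod b \<le> 1\<close> excludes
  zeros in the open disc and each factor has constant coefficient 1; the multiset records
  multiplicities.\<close>

definition unit_factors :: "complex multiset \<Rightarrow> complex poly"
  where "unit_factors B = (\<Prod>b\<in>#B. [:1, - b:])"

lemma unit_factors_simps [simp]: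
  "unit_factors {#} = 1" "unit_factors (add_mset b B) = [:1, - b:] * unit_factors B"
  by (simp_all add: unit_factors_def)

lemma coeff_unit_factors_0: "coeff (unit_factors B) 0 = 1"
  by (induction B) (simp_all add: coeff_mult_0)

text \<open>
  Cesaro means of the partial sums of the geometric series for \<open>1 / (1 - b \<zeta>)\<close>: their products with
  \<open>1 - b \<zeta>\<close> tend to 1 even if \<open>b\<close> is on the unit circle.
\<close>

lemma cesaro_inverse:
  assumes b: "cmod b \<le> 1" and N: "N > 0"
  shows "\<exists>S. coeff S 0 = 1 \<and> coeff_norm (S * [:1, - b:] - 1) \<le> 1 / sqrt (real N)"
proof -
  let ?x = "[:0, b:]"
  define S where "S = smult (1 / of_nat N) (\<Sum>n<N. \<Sum>k<Suc n. ?x ^ k)"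
  \<comment> \<open>Each partial sum times \<open>1 - b \<zeta>\<close> misses 1 by a single
    monomial. These \<open>N\<close> monomials are orthogonal, so their average has norm at most
    \<open>sqrt N / N\<close>.\<close>
  define h where "h = (\<Sum>n<N. monom (b ^ Suc n) (Suc n))"
  have x: "?x ^ k = monom (b ^ k) k" for k
    using monom_power[of b 1 k] by (simp add: monom_altdef)
  have "coeff (\<Sum>k<Suc n. ?x ^ k) 0 = 1" for n
    by (subst sum.lessThan_Suc_shift) (simp add: coeff_sum x)
  then have "coeff S 0 = 1" using N by (simp add: S_def coeff_sum)
  moreover have eq: "S * [:1, - b:] - 1 = smult (- 1 / of_nat N) h"
  proof -
    have "[:1, - b:] * (\<Sum>k<Suc n. ?x ^ k) = 1 - monom (b ^ Suc n) (Suc n)" for n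
      using one_diff_power_eq[of ?x "Suc n"] by (simp only: x) (simp add: one_pCons)
    then have "[:1, - b:] * (\<Sum>n<N. \<Sum>k<Suc n. ?x ^ k) = of_nat N - h"
      by (simp add: sum_distrib_left sum_subtractf h_def del: sum.lessThan_Suc mult_pCons_left)
    then have "S * [:1, - b:] = smult (1 / of_nat N) (of_nat N - h)"
      by (simp add: S_def mult.commute[of _ "[:1, - b:]"] del: mult_pCons_left mult_pCons_right)
    also have "\<dots> = 1 - smult (1 / of_nat N) h"
      using N by (simp add: smult_diff_right of_nat_poly one_pCons)
    finally show ?thesis by simp
  qed
  moreover have "coeff_norm h \<le> sqrt (real N)"
  proof -
    have c: "coeff h i = (if 1 \<le> i \<and> i \<le> N then b ^ i else 0)" for i
      unfolding h_def coeff_sum by (cases i) (auto simp: sum.delta)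
    have "degree h \<le> N" by (rule degree_le) (simp add: c)
    then have "coeff_norm h = L2_set (\<lambda>i. cmod (coeff h i)) {..N}" by (rule coeff_norm_eq)
    also have "\<dots> \<le> sqrt (\<Sum>i\<le>N. if 1 \<le> i then 1 else 0)"
      unfolding L2_set_def using b
      by (intro real_sqrt_le_mono sum_mono) (auto simp: c norm_power power_le_one)
    also have "(\<Sum>i\<le>N. if 1 \<le> i then 1 else 0) = real N"
      by (subst sum.atMost_shift) simp
    finally show ?thesis .
  qed
  then have "coeff_norm (smult (- 1 / of_nat N) h) \<le> sqrt (real N) / real N"
    unfolding coeff_norm_smult using N by (simp add: norm_divide divide_right_mono)
  then have "coeff_norm (S * [:1, - b:] - 1) \<le> sqrt (real N) / real N"
    unfolding eq .
  moreover have "sqrt (real N) / real N = 1 / sqrt (real N)"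
    by (metis divide_divide_eq_right div_by_1 mult_1 of_nat_0_le_iff real_div_sqrt)
  ultimately show ?thesis by auto
qed

text \<open>The factors are inverted one at a time. The error of the new approximate inverse is
  multiplied by \<open>P * unit_factors B\<close>, so \<open>P\<close> and the bound
  \<open>C\<close> for this product are fixed before \<open>N\<close> is chosen.\<close>

lemma unit_factors_cyclic:
  assumes "\<forall>b\<in>#B. cmod b \<le> 1" "\<epsilon> > 0"
  shows "\<exists>P. coeff P 0 = 1 \<and> coeff_norm (P * unit_factors B - 1) < \<epsilon>"
  using assms
proof (induction B arbitrary: \<epsilon>)
  case empty
  then show ?case by (intro exI[of _ 1]) simp
next
  case (add b B)
  obtain P where P: "coeff P 0 = 1" "coeff_norm (P * unit_factors B - 1) < \<epsilon> / 2"
    using add.IH[of "\<epsilon> / 2"] add.prems by auto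
  obtain C where C: "C \<ge> 0" "\<And>h. coeff_norm (h * (P * unit_factors B)) \<le> C * coeff_norm h"
    using coeff_norm_mult_bounded by blast
  obtain N where "(2 * C / \<epsilon>)\<^sup>2 < real N" using reals_Archimedean2 by blast
  then have N: "N > 0" "2 * C / \<epsilon> < sqrt (real N)"
    using real_less_rsqrt[of "2 * C / \<epsilon>" "real N"] by (auto intro: gr0I simp: not_less)
  obtain S where S: "coeff S 0 = 1" "coeff_norm (S * [:1, - b:] - 1) \<le> 1 / sqrt (real N)"
    using cesaro_inverse[of b N] add.prems N by auto
  have "P * S * unit_factors (add_mset b B) - 1 =
      (P * unit_factors B - 1) + (S * [:1, - b:] - 1) * (P * unit_factors B)"
    by (simp add: algebra_simps del: mult_pCons_left mult_pCons_right)
  then have "coeff_norm (P * S * unit_factors (add_mset b B) - 1) \<le>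
      coeff_norm (P * unit_factors B - 1) + C * coeff_norm (S * [:1, - b:] - 1)"
    using coeff_norm_triangle[of "P * unit_factors B - 1" "(S * [:1, - b:] - 1) * (P * unit_factors B)"]
      C(2)[of "S * [:1, - b:] - 1"]
    by (simp only:)
  also have "\<dots> \<le> coeff_norm (P * unit_factors B - 1) + C * (1 / sqrt (real N))"
    by (intro add_left_mono mult_left_mono S C)
  also have "\<dots> < \<epsilon>"
  proof -
    have "C / sqrt (real N) < \<epsilon> / 2" using N add.prems(2) by (simp add: field_simps)
    then have "C * (1 / sqrt (real N)) < \<epsilon> / 2" by simp
    then show ?thesis using P(2) by linarith
  qed
  finally show ?case using P(1) S(1) by (intro exI[of _ "P * S"]) (simp add: coeff_mult_0)
qed

lemma cmod_reflect_root:
  assumes "cmod \<zeta> = 1"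
  shows "cmod (\<zeta> - a) = cmod (1 - cnj a * \<zeta>)"
proof -
  have "\<zeta> * cnj \<zeta> = 1" using assms by (simp flip: complex_norm_square)
  then have "1 - cnj a * \<zeta> = \<zeta> * cnj (\<zeta> - a)" by (simp add: algebra_simps)
  then have "cmod (1 - cnj a * \<zeta>) = cmod \<zeta> * cmod (\<zeta> - a)" by (simp only: norm_mult complex_mod_cnj)
  then show ?thesis using assms by simp
qed

text \<open>A zero of modulus at most 1 is reflected at no cost, giving \<open>b = cnj a\<close>. A
  zero outside the disc gives \<open>b = 1 / a\<close> and releases the constant \<open>- a\<close>.
  Thus \<open>cmod c\<close> is the modulus of the leading coefficient times those of the zeros
  outside the disc, as in Jensen's formula. The multiplier \<open>g\<close> is arbitrary because the
  extremal problem varies it.\<close>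

lemma reflected_factorization:
  assumes "q \<noteq> 0"
  obtains c B where "c \<noteq> 0" "\<forall>b\<in>#B. cmod b \<le> 1"
    "\<And>g. coeff_norm (g * q) = cmod c * coeff_norm (g * unit_factors B)"
    "\<And>\<zeta>. cmod \<zeta> = 1 \<Longrightarrow> cmod (poly q \<zeta>) = cmod c * cmod (poly (unit_factors B) \<zeta>)"
proof -
  have main: "\<exists>c B. c \<noteq> 0 \<and> (\<forall>b\<in>#B. cmod b \<le> 1) \<and>
    (\<forall>g. coeff_norm (g * (\<Prod>x\<in>#A. [:- x, 1:])) = cmod c * coeff_norm (g * unit_factors B)) \<and>
    (\<forall>\<zeta>. cmod \<zeta> = 1 \<longrightarrow> cmod (poly (\<Prod>x\<in>#A. [:- x, 1:]) \<zeta>) = cmod c * cmod (poly (unit_factors B) \<zeta>))" for A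
  proof (induction A)
    case empty
    then show ?case by (intro exI[of _ 1] exI[of _ "{#}"]) simp
  next
    case (add a A)
    let ?R = "\<Prod>x\<in>#A. [:- x, 1:]"
    obtain c B where IH: "c \<noteq> 0" "\<forall>b\<in>#B. cmod b \<le> 1"
      "\<And>g. coeff_norm (g * ?R) = cmod c * coeff_norm (g * unit_factors B)"
      "\<And>\<zeta>. cmod \<zeta> = 1 \<Longrightarrow> cmod (poly ?R \<zeta>) = cmod c * cmod (poly (unit_factors B) \<zeta>)"
      using add.IH by blast
    have "\<exists>k b. k \<noteq> 0 \<and> cmod b \<le> 1 \<and>
      (\<forall>g. coeff_norm (g * [:- a, 1:]) = cmod k * coeff_norm (g * [:1, - b:])) \<and>
      (\<forall>\<zeta>. cmod \<zeta> = 1 \<longrightarrow> cmod (\<zeta> - a) = cmod k * cmod (1 - b * \<zeta>))"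
    proof (cases "cmod a \<le> 1")
      case True
      then show ?thesis
        using coeff_norm_reflect_root[of _ a] cmod_reflect_root[of _ a]
        by (intro exI[of _ 1] exI[of _ "cnj a"] conjI allI impI) simp_all
    next
      case False
      then have "1 < cmod a" by simp
      then have a: "a \<noteq> 0" "cmod (1 / a) \<le> 1" by (auto simp: norm_divide divide_le_eq)
      have "[:- a, 1:] = smult (- a) [:1, - (1 / a):]" using a by simp
      then have "coeff_norm (g * [:- a, 1:]) = cmod (- a) * coeff_norm (g * [:1, - (1 / a):])" for g
        by (simp only: mult_smult_right coeff_norm_smult)
      moreover have "\<zeta> - a = (- a) * (1 - 1 / a * \<zeta>)" for \<zeta> using a by (simp add: field_simps)
      then have "cmod (\<zeta> - a) = cmod (- a) * cmod (1 - 1 / a * \<zeta>)" for \<zeta> by (simp only: norm_mult)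
      moreover have "- a \<noteq> 0" using a by simp
      ultimately show ?thesis using a(2) by (intro exI[of _ "- a"] exI[of _ "1 / a"] conjI allI impI)
    qed
    then obtain k b where k: "k \<noteq> 0" "cmod b \<le> 1"
      "\<And>g. coeff_norm (g * [:- a, 1:]) = cmod k * coeff_norm (g * [:1, - b:])"
      "\<And>\<zeta>. cmod \<zeta> = 1 \<Longrightarrow> cmod (\<zeta> - a) = cmod k * cmod (1 - b * \<zeta>)" by blast
    have "coeff_norm (g * (\<Prod>x\<in>#add_mset a A. [:- x, 1:])) =
        cmod (c * k) * coeff_norm (g * unit_factors (add_mset b B))" for g
    proof -
      have "coeff_norm (g * (\<Prod>x\<in>#add_mset a A. [:- x, 1:])) = coeff_norm ((g * ?R) * [:- a, 1:])"
        by (simp only: image_mset_add_mset prod_mset.add_mset mult_ac)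
      also have "\<dots> = cmod k * coeff_norm ((g * [:1, - b:]) * ?R)"
        unfolding k(3) by (simp only: mult_ac)
      also have "\<dots> = cmod (c * k) * coeff_norm (g * unit_factors (add_mset b B))"
        unfolding IH(3) by (simp only: unit_factors_simps norm_mult mult_ac)
      finally show ?thesis .
    qed
    moreover have "cmod (poly (\<Prod>x\<in>#add_mset a A. [:- x, 1:]) \<zeta>) =
        cmod (c * k) * cmod (poly (unit_factors (add_mset b B)) \<zeta>)" if "cmod \<zeta> = 1" for \<zeta>
    proof -
      have "poly (\<Prod>x\<in>#add_mset a A. [:- x, 1:]) \<zeta> = (\<zeta> - a) * poly ?R \<zeta>"
        "poly (unit_factors (add_mset b B)) \<zeta> = (1 - b * \<zeta>) * poly (unit_factors B) \<zeta>"
        by (simp_all add: algebra_simps)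
      then show ?thesis by (simp only: norm_mult IH(4)[OF that] k(4)[OF that] mult_ac)
    qed
    ultimately show ?case
      using IH(1,2) k(1,2) by (intro exI[of _ "c * k"] exI[of _ "add_mset b B"]) auto
  qed
  obtain A where A: "q = smult (lead_coeff q) (\<Prod>x\<in>#A. [:- x, 1:])"
    using alg_closed_imp_factorization[OF assms] by blast
  define l where "l = lead_coeff q"
  have l: "l \<noteq> 0" "q = smult l (\<Prod>x\<in>#A. [:- x, 1:])" using assms A by (auto simp: l_def)
  from main[of A] obtain c B where cB: "c \<noteq> 0" "\<forall>b\<in>#B. cmod b \<le> 1"
    "\<And>g. coeff_norm (g * (\<Prod>x\<in>#A. [:- x, 1:])) = cmod c * coeff_norm (g * unit_factors B)"
    "\<And>\<zeta>. cmod \<zeta> = 1 \<Longrightarrow> cmod (poly (\<Prod>x\<in>#A. [:- x, 1:]) \<zeta>) = cmod c * cmod (poly (unit_factors B) \<zeta>)"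
    by blast
  show thesis
  proof (rule that[of "l * c" B])
    show "coeff_norm (g * q) = cmod (l * c) * coeff_norm (g * unit_factors B)" for g
      unfolding l(2) by (simp only: mult_smult_right coeff_norm_smult cB(3) norm_mult mult_ac)
    show "cmod (poly q \<zeta>) = cmod (l * c) * cmod (poly (unit_factors B) \<zeta>)" if "cmod \<zeta> = 1" for \<zeta>
      unfolding l(2) using cB(4)[OF that] by (simp only: poly_smult norm_mult mult_ac)
  qed (use l cB in auto)
qed

section \<open>Mahler measure\<close>

lemma emeasure_period: "emeasure lborel {0..<2 * pi} = ennreal (2 * pi)"
  by (simp add: emeasure_lborel_Ico)

lemma sets_circle_haar [simp, measurable_cong]: "sets circle_haar = sets borel"
  by (simp add: circle_haar_def)

lemma space_circle_haar [simp]: "space circle_haar = UNIV"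
  by (simp add: circle_haar_def)

lemma measurable_cis [measurable]: "cis \<in> borel_measurable borel"
  by (intro borel_measurable_continuous_onI continuous_intros)

lemma measurable_poly [measurable]: "poly q \<in> borel_measurable borel" for q :: "complex poly"
  by (intro borel_measurable_continuous_onI continuous_intros)

lemma measurable_powers [measurable]: "(\<lambda>\<zeta>. \<zeta> ^ k * cnj \<zeta> ^ l) \<in> borel_measurable borel"
  by (intro borel_measurable_continuous_onI continuous_intros)

lemma AE_circle_haar:
  assumes "Measurable.pred borel P" "AE t in lborel. t \<in> {0..<2 * pi} \<longrightarrow> P (cis t)"
  shows "AE \<zeta> in circle_haar. P \<zeta>"
proof -
  have "AE t in uniform_measure lborel {0..<2 * pi}. P (cis t)"
    by (rule AE_uniform_measureI[OF _ assms(2)]) simp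
  moreover have "cis \<in> measurable (uniform_measure lborel {0..<2 * pi}) borel" by simp
  ultimately show ?thesis
    unfolding circle_haar_def using assms(1) by (subst AE_distr_iff) auto
qed

lemma AE_circle_norm: "AE \<zeta> in circle_haar. cmod \<zeta> = 1"
  by (rule AE_circle_haar) auto

text \<open>A point of the circle has a single argument in the half-open period, and singletons are
  Lebesgue null.\<close>

lemma AE_circle_neq: "AE \<zeta> in circle_haar. \<zeta> \<noteq> a"
proof (rule AE_circle_haar)
  have "t = Arg2pi a" if "t \<in> {0..<2 * pi}" "cis t = a" for t
    using that Arg2pi_unique[of 1 t a] by (simp add: cis_conv_exp)
  then show "AE t in lborel. t \<in> {0..<2 * pi} \<longrightarrow> cis t \<noteq> a"
    using AE_lborel_singleton[of "Arg2pi a"] by (auto elim!: eventually_mono)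
qed simp

lemma prob_space_circle_haar: "emeasure circle_haar UNIV = 1"
proof -
  have "emeasure circle_haar UNIV = emeasure (uniform_measure lborel {0..<2 * pi}) UNIV"
    unfolding circle_haar_def by (subst emeasure_distr) auto
  also have "\<dots> = 1"
    by (subst emeasure_uniform_measure) (auto simp: emeasure_period divide_ennreal)
  finally show ?thesis .
qed

interpretation circle: finite_measure circle_haar
  by (rule finite_measureI) (simp add: prob_space_circle_haar)

lemma measure_circle_haar: "measure circle_haar UNIV = 1"
  by (simp add: measure_def prob_space_circle_haar)

lemma circle_integral:
  fixes f :: "complex \<Rightarrow> 'a::{banach, second_countable_topology}"
  assumes f [measurable]: "f \<in> borel_measurable borel"
  shows "(LINT \<zeta>|circle_haar. f \<zeta>) =
    (LINT t|lborel. (indicator {0..<2 * pi} t / (2 * pi)) *\<^sub>R f (cis t))"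
proof -
  have "uniform_measure lborel {0..<2 * pi} = density lborel (\<lambda>t. ennreal (indicator {0..<2 * pi} t / (2 * pi)))"
    unfolding uniform_measure_def
    using divide_ennreal[of 1 "2 * pi"]
    by (intro density_cong) (auto simp: emeasure_period split: split_indicator)
  then show ?thesis
    unfolding circle_haar_def
    by (subst integral_distr) (simp_all add: integral_density)
qed

lemma circle_bounded_integrable:
  fixes f :: "complex \<Rightarrow> 'a::{banach, second_countable_topology}"
  assumes [measurable]: "f \<in> borel_measurable borel" and "\<And>\<zeta>. cmod \<zeta> = 1 \<Longrightarrow> norm (f \<zeta>) \<le> C"
  shows "integrable circle_haar f"
  using assms(2) AE_circle_norm
  by (intro circle.integrable_const_bound[of _ C]) (auto elim!: eventually_mono)

lemma circle_integral_power:
  assumes "k \<noteq> l"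
  shows "(LINT \<zeta>|circle_haar. \<zeta> ^ k * cnj \<zeta> ^ l) = 0"
proof -
  \<comment> \<open>The exponent may be negative, so the difference is taken in the reals.\<close>
  define r where "r = real k - real l"
  have r: "r \<noteq> 0" using assms by (simp add: r_def)
  have eq: "cis t ^ k * cnj (cis t) ^ l = cis (r * t)" for t
    by (simp only: r_def Complex.DeMoivre cis_cnj cis_mult)
      (rule arg_cong[where f = cis], simp add: algebra_simps)
  have per: "cis (r * (2 * pi)) = 1"
    using cis_multiple_2pi[of r] by (simp add: r_def mult_ac)
  have "((\<lambda>t. cis (r * t) / (\<i> * of_real r)) has_vector_derivative cis (r * t)) (at t within {0..2 * pi})" for t
  proof -
    have "((\<lambda>z. exp (\<i> * (of_real r * z)) / (\<i> * of_real r)) has_field_derivative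
        exp (\<i> * (of_real r * of_real t))) (at (of_real t))"
      using r by (auto intro!: derivative_eq_intros simp: field_simps)
    from has_vector_derivative_real_field[OF this] show ?thesis
      by (simp add: cis_conv_exp)
  qed
  then have "has_bochner_integral lborel (\<lambda>t. indicator {0..2 * pi} t *\<^sub>R cis (r * t))
      (cis (r * (2 * pi)) / (\<i> * of_real r) - cis (r * 0) / (\<i> * of_real r))"
    by (intro has_bochner_integral_FTC_Icc) (auto intro!: continuous_intros)
  then have 0: "(LINT t|lborel. indicator {0..2 * pi} t *\<^sub>R cis (r * t)) = 0"
    by (simp add: per has_bochner_integral_iff)
  have "(LINT \<zeta>|circle_haar. \<zeta> ^ k * cnj \<zeta> ^ l) =
      (LINT t|lborel. (indicator {0..<2 * pi} t / (2 * pi)) *\<^sub>R cis (r * t))"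
    by (subst circle_integral) (simp_all add: eq)
  \<comment> \<open>The fundamental theorem is applied on the closed interval, which differs from
    the half-open one by a null point.\<close>
  also have "\<dots> = (LINT t|lborel. (1 / (2 * pi)) *\<^sub>R (indicator {0..2 * pi} t *\<^sub>R cis (r * t)))"
    by (rule integral_cong_AE)
      (use AE_lborel_singleton[of "2 * pi"] in \<open>auto elim!: eventually_mono split: split_indicator\<close>)
  also have "\<dots> = 0" by (simp only: integral_scaleR_right 0 scaleR_zero_right)
  finally show ?thesis .
qed

text \<open>Parseval: the squared modulus is expanded into a double sum, and the orthogonality of
  the powers on the circle leaves its diagonal.\<close>

lemma circle_L2_norm_eq: "circle_L2_norm q = coeff_norm q"
proof -
  let ?n = "degree q"
  have sq: "complex_of_real ((cmod (poly q \<zeta>))\<^sup>2) =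
      (\<Sum>k\<le>?n. \<Sum>l\<le>?n. (coeff q k * cnj (coeff q l)) * (\<zeta> ^ k * cnj \<zeta> ^ l))" for \<zeta>
    unfolding complex_norm_square poly_altdef
    by (simp add: sum_product mult_ac)
  have int: "integrable circle_haar (\<lambda>\<zeta>. \<zeta> ^ k * cnj \<zeta> ^ l)" for k l
    by (rule circle_bounded_integrable[of _ 1])
      (auto simp: norm_mult norm_power)
  have diag: "(LINT \<zeta>|circle_haar. \<zeta> ^ k * cnj \<zeta> ^ l) = (if k = l then 1 else 0)" for k l
  proof (cases "k = l")
    case True
    have "(LINT \<zeta>|circle_haar. \<zeta> ^ k * cnj \<zeta> ^ k) = (LINT \<zeta>|circle_haar. 1)"
    proof (rule integral_cong_AE)
      have "\<zeta> ^ k * cnj \<zeta> ^ k = 1" if "cmod \<zeta> = 1" for \<zeta>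
        using that by (simp flip: power_mult_distrib complex_norm_square)
      then show "AE \<zeta> in circle_haar. \<zeta> ^ k * cnj \<zeta> ^ k = 1"
        using AE_circle_norm by (auto elim!: eventually_mono)
    qed measurable
    then show ?thesis using True by (simp add: measure_circle_haar)
  qed (simp add: circle_integral_power)
  have "complex_of_real (LINT \<zeta>|circle_haar. (cmod (poly q \<zeta>))\<^sup>2) =
      (LINT \<zeta>|circle_haar. complex_of_real ((cmod (poly q \<zeta>))\<^sup>2))"
    by (rule integral_complex_of_real[symmetric])
  also have "\<dots> = (\<Sum>k\<le>?n. \<Sum>l\<le>?n. (coeff q k * cnj (coeff q l)) * (if k = l then 1 else 0))"
    unfolding sq using int by (simp add: diag)
  also have "\<dots> = (\<Sum>k\<le>?n. complex_of_real ((cmod (coeff q k))\<^sup>2))"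
    unfolding complex_norm_square by (simp add: if_distrib cong: if_cong)
  also have "\<dots> = of_real ((coeff_norm q)\<^sup>2)"
    by (simp add: coeff_norm_sq[OF order_refl])
  finally show ?thesis
    unfolding of_real_eq_iff circle_L2_norm_def using coeff_norm_nonneg by simp
qed

lemma measurable_log_factor [measurable]: "(\<lambda>\<zeta>. ln (cmod (1 - b * \<zeta>))) \<in> borel_measurable borel"
  by measurable

text \<open>Strictly inside the disc, \<open>Ln (1 - b * \<zeta>)\<close> has a power series
  dominated by a geometric one, so it may be integrated term by term; its real part is the logarithm
  of the modulus.\<close>

lemma log_factor_interior:
  assumes b: "cmod b < 1"
  shows "integrable circle_haar (\<lambda>\<zeta>. ln (cmod (1 - b * \<zeta>)))"
    "(LINT \<zeta>|circle_haar. ln (cmod (1 - b * \<zeta>))) = 0"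
proof -
  \<comment> \<open>The index is shifted by one because the logarithmic series has no constant term;
    hence every term has integral 0.\<close>
  define t :: "nat \<Rightarrow> complex \<Rightarrow> complex"
    where "t n \<zeta> = - (1 / of_nat (Suc n)) * b ^ Suc n * \<zeta> ^ Suc n" for n \<zeta>
  have summ_b: "summable (\<lambda>n. cmod b ^ Suc n)"
    using b by (simp add: summable_geometric summable_mult)
  have bnd: "norm (t n \<zeta>) \<le> cmod b ^ Suc n" if "cmod \<zeta> = 1" for n \<zeta>
    using that mult_right_mono[of "1 / real (Suc n)" 1 "cmod b ^ Suc n"]
    by (simp add: t_def norm_mult norm_power norm_divide del: of_nat_Suc)
  have Re: "ln (cmod (1 - b * \<zeta>)) = Re (\<Sum>n. t n \<zeta>)"
    and summ: "summable (\<lambda>n. norm (t n \<zeta>))" if z: "cmod \<zeta> = 1" for \<zeta>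
  proof -
    have bz: "cmod (b * \<zeta>) < 1" using b z by (simp add: norm_mult)
    then have "(\<lambda>n. - ((b * \<zeta>) ^ n) / of_nat n) sums Ln (1 - b * \<zeta>)"
      using Ln_series'[of "- (b * \<zeta>)"] by simp
    then have "(\<lambda>n. - ((b * \<zeta>) ^ Suc n) / of_nat (Suc n)) sums Ln (1 - b * \<zeta>)"
      by (subst sums_Suc_iff) simp
    then have "(\<lambda>n. t n \<zeta>) sums Ln (1 - b * \<zeta>)"
      by (simp add: t_def power_mult_distrib mult_ac divide_inverse)
    moreover have "1 - b * \<zeta> \<noteq> 0" using bz by auto
    ultimately show "ln (cmod (1 - b * \<zeta>)) = Re (\<Sum>n. t n \<zeta>)"
      by (simp add: sums_iff)
    show "summable (\<lambda>n. norm (t n \<zeta>))"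
      using bnd[OF z] by (intro summable_comparison_test'[OF summ_b, of 0]) auto
  qed
  have meas [measurable]: "t n \<in> borel_measurable borel" for n
    unfolding t_def[abs_def] by (intro borel_measurable_continuous_onI continuous_intros)
  have int: "integrable circle_haar (t n)" for n
    by (rule circle_bounded_integrable[OF meas bnd])
  have 0: "(LINT \<zeta>|circle_haar. t n \<zeta>) = 0" for n
    using circle_integral_power[of "Suc n" 0] by (simp add: t_def)
  have int_le: "(LINT \<zeta>|circle_haar. norm (t n \<zeta>)) \<le> cmod b ^ Suc n" for n
  proof -
    have "(LINT \<zeta>|circle_haar. norm (t n \<zeta>)) \<le> (LINT \<zeta>|circle_haar. cmod b ^ Suc n)"
      using AE_circle_norm bnd by (intro integral_mono_AE integrable_norm int) (auto elim!: eventually_mono)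
    then show ?thesis by (simp add: measure_circle_haar)
  qed
  have summ_int: "summable (\<lambda>n. LINT \<zeta>|circle_haar. norm (t n \<zeta>))"
  proof (rule summable_comparison_test'[OF summ_b, of 0])
    show "norm (LINT \<zeta>|circle_haar. norm (t n \<zeta>)) \<le> cmod b ^ Suc n" for n
      using int_le[of n] by (simp add: abs_of_nonneg del: power_Suc)
  qed
  have AEs: "AE \<zeta> in circle_haar. summable (\<lambda>n. norm (t n \<zeta>))"
    using AE_circle_norm summ by (auto elim!: eventually_mono)
  have i: "integrable circle_haar (\<lambda>\<zeta>. (\<Sum>n. t n \<zeta>))"
    by (rule integrable_suminf[OF int AEs summ_int])
  have "(LINT \<zeta>|circle_haar. (\<Sum>n. t n \<zeta>)) = (\<Sum>n. LINT \<zeta>|circle_haar. t n \<zeta>)"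
    by (rule integral_suminf[OF int AEs summ_int])
  then have z: "(LINT \<zeta>|circle_haar. (\<Sum>n. t n \<zeta>)) = 0" using 0 by simp
  have AEeq: "AE \<zeta> in circle_haar. ln (cmod (1 - b * \<zeta>)) = Re (\<Sum>n. t n \<zeta>)"
    using AE_circle_norm Re by (auto elim!: eventually_mono)
  have iR: "integrable circle_haar (\<lambda>\<zeta>. Re (\<Sum>n. t n \<zeta>))"
    using i by (rule integrable_Re)
  show "integrable circle_haar (\<lambda>\<zeta>. ln (cmod (1 - b * \<zeta>)))"
    by (rule integrable_cong_AE[THEN iffD2, OF _ _ AEeq iR])
      (use iR in \<open>auto intro: borel_measurable_integrable\<close>)
  have "(LINT \<zeta>|circle_haar. ln (cmod (1 - b * \<zeta>))) = (LINT \<zeta>|circle_haar. Re (\<Sum>n. t n \<zeta>))"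
    using iR by (intro integral_cong_AE AEeq) auto
  also have "\<dots> = Re (LINT \<zeta>|circle_haar. (\<Sum>n. t n \<zeta>))"
    using i by simp
  finally show "(LINT \<zeta>|circle_haar. ln (cmod (1 - b * \<zeta>))) = 0" using z by simp
qed

text \<open>
  On the circle \<open>\<bar>1 - b \<zeta>\<bar> \<le> 2 \<bar>1 - r b \<zeta>\<bar>\<close> for \<open>0 \<le> r \<le> 1\<close>.  Fatou's lemma for \<open>r \<rightarrow> 1\<close> yields the integrability
  of the singular function \<open>ln \<bar>1 - b \<zeta>\<bar>\<close>, which then dominates \<open>ln \<bar>1 - r b \<zeta>\<bar>\<close>.
\<close>

lemma log_factor:
  assumes b: "cmod b \<le> 1"
  shows "integrable circle_haar (\<lambda>\<zeta>. ln (cmod (1 - b * \<zeta>)))"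
    "(LINT \<zeta>|circle_haar. ln (cmod (1 - b * \<zeta>))) = 0"
proof -
  \<comment> \<open>The double successor keeps \<open>r n\<close> strictly between 0 and 1 already
    for \<open>n = 0\<close>.\<close>
  define r where "r n = 1 - 1 / real (Suc (Suc n))" for n
  have r: "0 < r n" "r n < 1" for n by (auto simp: r_def)
  have "(\<lambda>n. 1 / real (Suc (Suc n))) \<longlonglongrightarrow> 0"
    using LIMSEQ_Suc[OF LIMSEQ_Suc[OF lim_1_over_n]] .
  then have "r \<longlonglongrightarrow> 1 - 0" unfolding r_def by (intro tendsto_diff tendsto_const)
  then have rlim: "r \<longlonglongrightarrow> 1" by simp
  define g where "g \<zeta> = ln (cmod (1 - b * \<zeta>))" for \<zeta>
  define s where "s n \<zeta> = ln (cmod (1 - (of_real (r n) * b) * \<zeta>))" for n \<zeta>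
  have meas [measurable]: "g \<in> borel_measurable borel" "s n \<in> borel_measurable borel" for n
    unfolding g_def[abs_def] s_def[abs_def] by measurable
  have rb: "cmod (of_real (r n) * b) < 1" for n
  proof -
    have "cmod (of_real (r n) * b) = r n * cmod b" using r[of n] by (simp add: norm_mult)
    also have "\<dots> \<le> r n * 1" using b r[of n] by (intro mult_left_mono) auto
    finally show ?thesis using r[of n] by simp
  qed
  have s: "integrable circle_haar (s n)" "(LINT \<zeta>|circle_haar. s n \<zeta>) = 0" for n
    unfolding s_def[abs_def] using log_factor_interior[OF rb[of n]] by auto
  have upper: "cmod (1 - c * \<zeta>) \<le> 2" if "cmod \<zeta> = 1" "cmod c \<le> 1" for c \<zeta>
    using that norm_triangle_ineq4[of 1 "c * \<zeta>"] by (simp add: norm_mult)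
  have s_le: "s n \<zeta> \<le> ln 2" if "cmod \<zeta> = 1" for n \<zeta>
  proof -
    have "cmod (of_real (r n) * b * \<zeta>) < 1" using rb[of n] that by (simp add: norm_mult)
    then have "1 - of_real (r n) * b * \<zeta> \<noteq> 0" by auto
    then have "cmod (1 - of_real (r n) * b * \<zeta>) > 0" by simp
    then show ?thesis unfolding s_def using upper[OF that less_imp_le[OF rb[of n]]] by simp
  qed
  \<comment> \<open>The triangle inequality costs at most \<open>1 - r n\<close>, which is itself at
    most \<open>cmod (1 - r n * b * \<zeta>)\<close>; hence the factor 2.\<close>
  have s_ge: "g \<zeta> - ln 2 \<le> s n \<zeta>" if z: "cmod \<zeta> = 1" "1 - b * \<zeta> \<noteq> 0" for n \<zeta>
  proof -
    have bz: "cmod (b * \<zeta>) \<le> 1" using b z by (simp add: norm_mult)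
    have "1 - b * \<zeta> = (1 - of_real (r n) * b * \<zeta>) - of_real (1 - r n) * (b * \<zeta>)"
      by (simp add: algebra_simps)
    then have "cmod (1 - b * \<zeta>) \<le> cmod (1 - of_real (r n) * b * \<zeta>) + (1 - r n) * cmod (b * \<zeta>)"
      using norm_triangle_ineq4[of "1 - of_real (r n) * b * \<zeta>" "of_real (1 - r n) * (b * \<zeta>)"] r[of n]
      by (simp only: norm_mult[of "of_real _"] norm_of_real)
    also have "(1 - r n) * cmod (b * \<zeta>) \<le> (1 - r n) * 1" using bz r[of n] by (intro mult_left_mono) auto
    also have "(1 - r n) * 1 \<le> cmod (1 - of_real (r n) * b * \<zeta>)"
    proof -
      have "cmod (of_real (r n) * (b * \<zeta>)) \<le> r n * 1"
        unfolding norm_mult[of "of_real _"] using bz r[of n] by (auto intro: mult_left_mono)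
      then show ?thesis using norm_triangle_ineq2[of 1 "of_real (r n) * (b * \<zeta>)"] by (simp add: mult.assoc)
    qed
    finally have "cmod (1 - b * \<zeta>) \<le> 2 * cmod (1 - of_real (r n) * b * \<zeta>)" by simp
    moreover have "0 < cmod (1 - b * \<zeta>)" using z by simp
    ultimately have "ln (cmod (1 - b * \<zeta>)) \<le> ln (2 * cmod (1 - of_real (r n) * b * \<zeta>))"
      by (intro ln_mono) auto
    also have "\<dots> = ln 2 + s n \<zeta>"
      unfolding s_def using \<open>0 < cmod (1 - b * \<zeta>)\<close> \<open>cmod (1 - b * \<zeta>) \<le> 2 * _\<close>
      by (subst ln_mult_pos) auto
    finally show ?thesis by (simp add: g_def)
  qed
  have lim: "(\<lambda>n. s n \<zeta>) \<longlonglongrightarrow> g \<zeta>" if "1 - b * \<zeta> \<noteq> 0" for \<zeta>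
    unfolding s_def g_def using that rlim by (auto intro!: tendsto_eq_intros)
  have ne: "AE \<zeta> in circle_haar. cmod \<zeta> = 1 \<and> 1 - b * \<zeta> \<noteq> 0"
    using AE_circle_norm AE_circle_neq[of "1 / b"]
  proof eventually_elim
    case (elim \<zeta>)
    then show ?case by (cases "b = 0") (auto simp: field_simps)
  qed
  \<comment> \<open>On the circle the modulus is at most 2, which makes \<open>h\<close> nonnegative
    almost everywhere and Fatou's lemma applicable; the approximating integrals all equal
    \<open>ln 2\<close>.\<close>
  define h where "h \<zeta> = ln 2 - g \<zeta>" for \<zeta>
  have [measurable]: "h \<in> borel_measurable borel" unfolding h_def[abs_def] by measurable
  have h0: "AE \<zeta> in circle_haar. 0 \<le> h \<zeta>"
    using ne
  proof eventually_elim
    case (elim \<zeta>)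
    then have "cmod (1 - b * \<zeta>) > 0" by simp
    then show ?case unfolding h_def g_def using upper[of \<zeta> b] elim b by simp
  qed
  have "(\<integral>\<^sup>+\<zeta>. ennreal (h \<zeta>) \<partial>circle_haar) = (\<integral>\<^sup>+\<zeta>. liminf (\<lambda>n. ennreal (ln 2 - s n \<zeta>)) \<partial>circle_haar)"
  proof (rule nn_integral_cong_AE)
    show "AE \<zeta> in circle_haar. ennreal (h \<zeta>) = liminf (\<lambda>n. ennreal (ln 2 - s n \<zeta>))"
      using ne
    proof eventually_elim
      case (elim \<zeta>)
      then have "(\<lambda>n. ennreal (ln 2 - s n \<zeta>)) \<longlonglongrightarrow> ennreal (h \<zeta>)"
        unfolding h_def by (intro tendsto_ennrealI tendsto_intros lim) auto
      then show ?case by (simp add: lim_imp_Liminf)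
    qed
  qed
  also have "\<dots> \<le> liminf (\<lambda>n. \<integral>\<^sup>+\<zeta>. ennreal (ln 2 - s n \<zeta>) \<partial>circle_haar)"
    by (rule nn_integral_liminf) measurable
  also have "(\<lambda>n. \<integral>\<^sup>+\<zeta>. ennreal (ln 2 - s n \<zeta>) \<partial>circle_haar) = (\<lambda>n. ennreal (ln 2))"
  proof
    fix n
    have "(\<integral>\<^sup>+\<zeta>. ennreal (ln 2 - s n \<zeta>) \<partial>circle_haar) = ennreal (LINT \<zeta>|circle_haar. ln 2 - s n \<zeta>)"
      using AE_circle_norm s_le by (intro nn_integral_eq_integral) (auto simp: s elim!: eventually_mono)
    also have "(LINT \<zeta>|circle_haar. ln 2 - s n \<zeta>) = ln 2"
      by (simp add: s measure_circle_haar)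
    finally show "(\<integral>\<^sup>+\<zeta>. ennreal (ln 2 - s n \<zeta>) \<partial>circle_haar) = ennreal (ln 2)" .
  qed
  also have "liminf (\<lambda>n. ennreal (ln 2)) = ennreal (ln 2)"
    by (simp add: Liminf_const)
  finally have "(\<integral>\<^sup>+\<zeta>. ennreal (h \<zeta>) \<partial>circle_haar) < \<infinity>"
    by (rule le_less_trans) simp
  then have "integrable circle_haar h"
    using h0 by (intro integrableI_nonneg) auto
  then have "integrable circle_haar (\<lambda>\<zeta>. ln 2 - h \<zeta>)" by simp
  then have g: "integrable circle_haar g" by (simp add: h_def)
  then show "integrable circle_haar (\<lambda>\<zeta>. ln (cmod (1 - b * \<zeta>)))"
    unfolding g_def[abs_def] .
  have "(\<lambda>n. LINT \<zeta>|circle_haar. s n \<zeta>) \<longlonglongrightarrow> (LINT \<zeta>|circle_haar. g \<zeta>)"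
  proof (rule integral_dominated_convergence)
    show "integrable circle_haar (\<lambda>\<zeta>. ln 2 + \<bar>g \<zeta>\<bar>)" using g by simp
    show "AE \<zeta> in circle_haar. (\<lambda>n. s n \<zeta>) \<longlonglongrightarrow> g \<zeta>"
      using ne by eventually_elim (rule lim, rule conjunct2)
    show "AE \<zeta> in circle_haar. norm (s n \<zeta>) \<le> ln 2 + \<bar>g \<zeta>\<bar>" for n
      using ne
    proof eventually_elim
      case (elim \<zeta>)
      then show ?case using s_ge[of \<zeta> n] s_le[of \<zeta> n] by (auto simp: abs_le_iff)
    qed
  qed auto
  then have "(LINT \<zeta>|circle_haar. g \<zeta>) = 0"
    unfolding s by (simp add: LIMSEQ_const_iff)
  then show "(LINT \<zeta>|circle_haar. ln (cmod (1 - b * \<zeta>))) = 0"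
    unfolding g_def .
qed

text \<open>Nonvanishing almost everywhere is part of the induction, since the logarithm of a
  product splits only where both factors are nonzero.\<close>

lemma log_unit_factors:
  assumes "\<forall>b\<in>#B. cmod b \<le> 1"
  shows "integrable circle_haar (\<lambda>\<zeta>. ln (cmod (poly (unit_factors B) \<zeta>))) \<and>
    (LINT \<zeta>|circle_haar. ln (cmod (poly (unit_factors B) \<zeta>))) = 0 \<and>
    (AE \<zeta> in circle_haar. poly (unit_factors B) \<zeta> \<noteq> 0)"
  using assms
proof (induction B)
  case empty
  then show ?case by simp
next
  case (add b B)
  let ?f = "\<lambda>\<zeta>. ln (cmod (1 - b * \<zeta>))" and ?g = "\<lambda>\<zeta>. ln (cmod (poly (unit_factors B) \<zeta>))"
  have b: "cmod b \<le> 1" using add.prems by simp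
  have IH: "integrable circle_haar ?g" "(LINT \<zeta>|circle_haar. ?g \<zeta>) = 0"
    "AE \<zeta> in circle_haar. poly (unit_factors B) \<zeta> \<noteq> 0"
    using add by auto
  have p: "poly (unit_factors (add_mset b B)) \<zeta> = (1 - b * \<zeta>) * poly (unit_factors B) \<zeta>" for \<zeta>
    by (simp add: algebra_simps)
  have ne: "AE \<zeta> in circle_haar. 1 - b * \<zeta> \<noteq> 0 \<and> poly (unit_factors B) \<zeta> \<noteq> 0"
    using IH(3) AE_circle_neq[of "1 / b"]
  proof eventually_elim
    case (elim \<zeta>)
    then show ?case by (cases "b = 0") (auto simp: field_simps)
  qed
  have eq: "AE \<zeta> in circle_haar. ln (cmod (poly (unit_factors (add_mset b B)) \<zeta>)) = ?f \<zeta> + ?g \<zeta>"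
    using ne
  proof eventually_elim
    case (elim \<zeta>)
    then show ?case unfolding p norm_mult by (subst ln_mult_pos) auto
  qed
  have sum: "integrable circle_haar (\<lambda>\<zeta>. ?f \<zeta> + ?g \<zeta>)"
    by (intro Bochner_Integration.integrable_add log_factor(1)[OF b] IH(1))
  have i: "integrable circle_haar (\<lambda>\<zeta>. ln (cmod (poly (unit_factors (add_mset b B)) \<zeta>)))"
    by (rule integrable_cong_AE[THEN iffD2, OF _ _ eq sum]) measurable
  have "(LINT \<zeta>|circle_haar. ln (cmod (poly (unit_factors (add_mset b B)) \<zeta>))) =
      (LINT \<zeta>|circle_haar. ?f \<zeta> + ?g \<zeta>)"
    by (rule integral_cong_AE[OF _ _ eq]) measurable
  also have "\<dots> = 0"
    using log_factor[OF b] IH by simp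
  finally show ?case using i ne by (auto simp only: p mult_eq_0_iff elim!: eventually_mono)
qed

lemma mahler_measure_eq:
  assumes c: "c \<noteq> 0" and B: "\<forall>b\<in>#B. cmod b \<le> 1"
    and q: "\<And>\<zeta>. cmod \<zeta> = 1 \<Longrightarrow> cmod (poly q \<zeta>) = cmod c * cmod (poly (unit_factors B) \<zeta>)"
  shows "mahler_measure q = cmod c"
proof -
  let ?g = "\<lambda>\<zeta>. ln (cmod (poly (unit_factors B) \<zeta>))"
  have g: "integrable circle_haar ?g" "(LINT \<zeta>|circle_haar. ?g \<zeta>) = 0"
    "AE \<zeta> in circle_haar. poly (unit_factors B) \<zeta> \<noteq> 0"
    using log_unit_factors[OF B] by auto
  have "(LINT \<zeta>|circle_haar. ln (cmod (poly q \<zeta>))) = (LINT \<zeta>|circle_haar. ln (cmod c) + ?g \<zeta>)"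
  proof (rule integral_cong_AE)
    show "AE \<zeta> in circle_haar. ln (cmod (poly q \<zeta>)) = ln (cmod c) + ?g \<zeta>"
      using g(3) AE_circle_norm
    proof eventually_elim
      case (elim \<zeta>)
      then show ?case unfolding q[OF elim(2)] using c by (subst ln_mult_pos) auto
    qed
  qed measurable
  also have "\<dots> = ln (cmod c)" using g by (simp add: measure_circle_haar)
  finally show ?thesis using c by (simp add: mahler_measure_def)
qed

section \<open>Homogeneous elements of the Hardy space\<close>

lemma hardy_coeff_surj: "square_summable a \<Longrightarrow> \<exists>f. hardy_coeff f = a"
  using hardy_coeff_Abs[OF hardy_expansion_ex] by blast

lemma hardy_eqI: "(\<And>i j. hardy_coeff f (i, j) = hardy_coeff g (i, j)) \<Longrightarrow> f = g"
  by (auto simp: hardy_coeff_inject[symmetric])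

lemma norm_hardy_sq: "(norm f)\<^sup>2 = (\<Sum>\<^sub>\<infinity>k. (cmod (hardy_coeff f k))\<^sup>2)" for f :: hardy
  by (simp add: power2_norm_eq_inner inner_hardy_self)

lemma hardy_coeff_sq_summable: "(\<lambda>k. (cmod (hardy_coeff f k))\<^sup>2) summable_on UNIV"
  using square_summable_hardy_coeff[of f] by (simp add: square_summable_def)

lemma sum_hardy_coeff_le: "finite A \<Longrightarrow> (\<Sum>k\<in>A. (cmod (hardy_coeff f k))\<^sup>2) \<le> (norm f)\<^sup>2"
  unfolding norm_hardy_sq by (intro finite_sum_le_infsum hardy_coeff_sq_summable) auto

lemma hardy_coeff_le_norm: "cmod (hardy_coeff f k) \<le> norm f"
  using sum_hardy_coeff_le[of "{k}" f] by (simp add: power2_le_iff_abs_le)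

text \<open>Completeness of square-summable sequences, carried over through
  \<open>hardy_coeff\<close>: coefficients converge one by one, and bounds on finite partial sums
  survive the limit.\<close>

instance hardy :: banach
proof
  fix X :: "nat \<Rightarrow> hardy" assume X: "Cauchy X"
  have "Cauchy (\<lambda>n. hardy_coeff (X n) k)" for k
  proof (rule metric_CauchyI)
    fix e :: real assume "0 < e"
    then obtain N where N: "\<And>m n. m \<ge> N \<Longrightarrow> n \<ge> N \<Longrightarrow> dist (X m) (X n) < e"
      using metric_CauchyD[OF X] by blast
    have "dist (hardy_coeff (X m) k) (hardy_coeff (X n) k) < e" if "m \<ge> N" "n \<ge> N" for m n
      using hardy_coeff_le_norm[of "X m - X n" k] N[OF that]
      by (simp add: dist_norm hardy_coeff_minus)
    then show "\<exists>N. \<forall>m\<ge>N. \<forall>n\<ge>N. dist (hardy_coeff (X m) k) (hardy_coeff (X n) k) < e" by blast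
  qed
  then have "\<exists>l. (\<lambda>n. hardy_coeff (X n) k) \<longlonglongrightarrow> l" for k
    using Cauchy_convergent_iff convergent_def by blast
  then obtain c where c: "\<And>k. (\<lambda>n. hardy_coeff (X n) k) \<longlonglongrightarrow> c k" by metis
  \<comment> \<open>Uniform in the finite set \<open>A\<close>, this bound yields both the square
    summability of the limit coefficients and the convergence in norm.\<close>
  have bound: "(\<Sum>k\<in>A. (cmod (hardy_coeff (X m) k - c k))\<^sup>2) \<le> e\<^sup>2"
    if "finite A" "\<And>n. n \<ge> N \<Longrightarrow> dist (X m) (X n) < e" for A m N e
  proof (rule LIMSEQ_le_const2)
    show "(\<lambda>n. \<Sum>k\<in>A. (cmod (hardy_coeff (X m) k - hardy_coeff (X n) k))\<^sup>2) \<longlonglongrightarrow>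
        (\<Sum>k\<in>A. (cmod (hardy_coeff (X m) k - c k))\<^sup>2)"
      by (intro tendsto_intros c)
    have "(\<Sum>k\<in>A. (cmod (hardy_coeff (X m) k - hardy_coeff (X n) k))\<^sup>2) \<le> e\<^sup>2" if "n \<ge> N" for n
    proof -
      have "(\<Sum>k\<in>A. (cmod (hardy_coeff (X m) k - hardy_coeff (X n) k))\<^sup>2) \<le> (norm (X m - X n))\<^sup>2"
        using sum_hardy_coeff_le[OF \<open>finite A\<close>, of "X m - X n"] by (simp add: hardy_coeff_minus)
      also have "\<dots> \<le> e\<^sup>2"
        using \<open>\<And>n. n \<ge> N \<Longrightarrow> dist (X m) (X n) < e\<close>[OF that] by (intro power_mono) (auto simp: dist_norm)
      finally show ?thesis .
    qed
    then show "\<exists>N. \<forall>n\<ge>N. (\<Sum>k\<in>A. (cmod (hardy_coeff (X m) k - hardy_coeff (X n) k))\<^sup>2) \<le> e\<^sup>2" by blast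
  qed
  obtain N where "\<And>m n. m \<ge> N \<Longrightarrow> n \<ge> N \<Longrightarrow> dist (X m) (X n) < 1"
    using metric_CauchyD[OF X, of 1] by auto
  then have "square_summable (\<lambda>k. hardy_coeff (X N) k - c k)"
    unfolding square_summable_def using bound[of _ N N 1]
    by (intro nonneg_bdd_above_summable_on) (auto intro!: bdd_aboveI[of _ 1])
  then have "square_summable (\<lambda>k. hardy_coeff (X N) k + (-1) * (hardy_coeff (X N) k - c k))"
    by (intro square_summable_add square_summable_cmult square_summable_hardy_coeff)
  then have "square_summable c" by simp
  then obtain f where f: "hardy_coeff f = c" using hardy_coeff_surj by blast
  have "X \<longlonglongrightarrow> f"
  proof (rule metric_LIMSEQ_I)
    fix e :: real assume e: "0 < e"
    obtain N where N: "\<And>m n. m \<ge> N \<Longrightarrow> n \<ge> N \<Longrightarrow> dist (X m) (X n) < e / 2"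
      using metric_CauchyD[OF X, of "e / 2"] e by auto
    have "dist (X m) f < e" if "m \<ge> N" for m
    proof -
      have "(norm (X m - f))\<^sup>2 \<le> (e / 2)\<^sup>2"
        unfolding norm_hardy_sq using bound[of _ N m "e / 2"] N[OF that]
        by (intro infsum_le_finite_sums hardy_coeff_sq_summable) (auto simp: hardy_coeff_minus f)
      then have "norm (X m - f) \<le> e / 2" by (rule power2_le_imp_le) (use e in auto)
      then show ?thesis using e by (simp add: dist_norm)
    qed
    then show "\<exists>N. \<forall>m\<ge>N. dist (X m) f < e" by blast
  qed
  then show "convergent X" by (auto simp: convergent_def)
qed

lemma hardy_coeff_mult_z:
  "hardy_coeff (mult_z f) (i, j) = (if i = 0 then 0 else hardy_coeff f (i - 1, j))"
proof -
  have "Rep_hardy (mult_z f) = (\<lambda>(z, w). z * Rep_hardy f (z, w))"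
    by (auto simp: Rep_hardy_mult_z)
  then show ?thesis
    using hardy_coeff_eqI[of _ "mult_z f"] hardy_expansion_mult_z[OF hardy_expansion_coeff[of f]] by simp
qed

lemma hardy_coeff_mult_w:
  "hardy_coeff (mult_w f) (i, j) = (if j = 0 then 0 else hardy_coeff f (i, j - 1))"
proof -
  have "Rep_hardy (mult_w f) = (\<lambda>(z, w). w * Rep_hardy f (z, w))"
    by (auto simp: Rep_hardy_mult_w)
  then show ?thesis
    using hardy_coeff_eqI[of _ "mult_w f"] hardy_expansion_mult_w[OF hardy_expansion_coeff[of f]] by simp
qed

lemma cinner_mult_z: "cinner (mult_z f) (mult_z g) = cinner f g"
proof -
  let ?S = "\<lambda>(i, j). (Suc i, j :: nat)"
  have inj: "inj ?S" by (auto simp: inj_on_def)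
  have "cinner (mult_z f) (mult_z g) =
      infsum (\<lambda>k. hardy_coeff (mult_z f) k * cnj (hardy_coeff (mult_z g) k)) (range ?S)"
    unfolding cinner_hardy_def
  proof (rule infsum_cong_neutral)
    fix x assume "x \<in> UNIV - range ?S"
    moreover have "(Suc i, j) \<in> range ?S" for i j by (rule image_eqI[of _ _ "(i, j)"]) auto
    ultimately obtain j where "x = (0, j)" by (metis DiffD2 not0_implies_Suc surj_pair)
    then show "hardy_coeff (mult_z f) x * cnj (hardy_coeff (mult_z g) x) = 0"
      by (simp add: hardy_coeff_mult_z)
  qed auto
  also have "\<dots> = cinner f g"
    unfolding cinner_hardy_def infsum_reindex[OF inj]
    by (intro infsum_cong) (auto simp: hardy_coeff_mult_z)
  finally show ?thesis .
qed

lemma cinner_mult_w: "cinner (mult_w f) (mult_w g) = cinner f g"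
proof -
  let ?S = "\<lambda>(i :: nat, j). (i, Suc j)"
  have inj: "inj ?S" by (auto simp: inj_on_def)
  have "cinner (mult_w f) (mult_w g) =
      infsum (\<lambda>k. hardy_coeff (mult_w f) k * cnj (hardy_coeff (mult_w g) k)) (range ?S)"
    unfolding cinner_hardy_def
  proof (rule infsum_cong_neutral)
    fix x assume "x \<in> UNIV - range ?S"
    moreover have "(i, Suc j) \<in> range ?S" for i j by (rule image_eqI[of _ _ "(i, j)"]) auto
    ultimately obtain i where "x = (i, 0)" by (metis DiffD2 not0_implies_Suc surj_pair)
    then show "hardy_coeff (mult_w f) x * cnj (hardy_coeff (mult_w g) x) = 0"
      by (simp add: hardy_coeff_mult_w)
  qed auto
  also have "\<dots> = cinner f g"
    unfolding cinner_hardy_def infsum_reindex[OF inj]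
    by (intro infsum_cong) (auto simp: hardy_coeff_mult_w)
  finally show ?thesis .
qed

lemma mult_z_add: "mult_z (f + g) = mult_z f + mult_z g"
  and mult_w_add: "mult_w (f + g) = mult_w f + mult_w g"
  and mult_z_scaleC: "mult_z (a *\<^sub>C f) = a *\<^sub>C mult_z f"
  and mult_w_scaleC: "mult_w (a *\<^sub>C f) = a *\<^sub>C mult_w f"
  and mult_z_mult_w: "mult_z (mult_w f) = mult_w (mult_z f)"
  by (rule hardy_eqI, simp add: hardy_coeff_simps hardy_coeff_mult_z hardy_coeff_mult_w)+

text \<open>\<open>hom_elem n g\<close> is the homogenization \<open>w\<^sup>n g(z/w)\<close>, provided that \<open>degree g \<le> n\<close>.\<close>

definition hom_elem :: "nat \<Rightarrow> complex poly \<Rightarrow> hardy"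
  where "hom_elem n g = (SOME f. hardy_coeff f = (\<lambda>(i, j). if i + j = n then coeff g i else 0))"

lemma hardy_coeff_hom_elem: "hardy_coeff (hom_elem n g) (i, j) = (if i + j = n then coeff g i else 0)"
proof -
  let ?a = "\<lambda>(i, j). if i + j = n then coeff g i else 0"
  have "square_summable ?a"
    unfolding square_summable_def
    by (rule summable_on_cong_neutral[THEN iffD1, OF _ _ _ summable_on_finite[of "{..n} \<times> {..n}"]])
      (auto split: if_splits)
  from someI_ex[OF hardy_coeff_surj[OF this]] show ?thesis
    unfolding hom_elem_def by simp
qed

lemma hom_elem_add: "hom_elem n (g + h) = hom_elem n g + hom_elem n h"
  and hom_elem_smult: "hom_elem n (smult a g) = a *\<^sub>C hom_elem n g"
  and mult_z_hom_elem: "mult_z (hom_elem n g) = hom_elem (Suc n) (pCons 0 g)"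
  and hom_elem_0: "hom_elem n 0 = 0"
  by (rule hardy_eqI,
      auto simp: hardy_coeff_simps hardy_coeff_mult_z hardy_coeff_hom_elem coeff_pCons split: nat.split)+

lemma hom_elem_sum: "hom_elem n (sum g A) = (\<Sum>k\<in>A. hom_elem n (g k))"
  by (induction A rule: infinite_finite_induct) (auto simp: hom_elem_add hom_elem_0)

text \<open>The degree bound excludes a coefficient of index \<open>Suc n\<close>, which
  \<open>hom_elem n g\<close> would drop but \<open>hom_elem (Suc n) g\<close> would keep.\<close>

lemma mult_w_hom_elem: "degree g \<le> n \<Longrightarrow> mult_w (hom_elem n g) = hom_elem (Suc n) g"
  by (rule hardy_eqI) (auto simp: hardy_coeff_mult_w hardy_coeff_hom_elem coeff_eq_0)

lemma cinner_hom_elem: "n \<noteq> k \<Longrightarrow> cinner (hom_elem n g) (hom_elem k h) = 0"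
  unfolding cinner_hardy_def by (rule infsum_0) (auto simp: hardy_coeff_hom_elem)

lemma norm_hom_elem:
  assumes "degree g \<le> n"
  shows "norm (hom_elem n g) = coeff_norm g"
proof -
  have "(norm (hom_elem n g))\<^sup>2 =
      infsum (\<lambda>k. (cmod (hardy_coeff (hom_elem n g) k))\<^sup>2) ((\<lambda>i. (i, n - i)) ` {..n})"
    unfolding norm_hardy_sq
  proof (rule infsum_cong_neutral)
    fix x assume x: "x \<in> UNIV - (\<lambda>i. (i, n - i)) ` {..n}"
    obtain i j where ij: "x = (i, j)" by (cases x)
    have "i + j \<noteq> n" using x ij by force
    then show "(cmod (hardy_coeff (hom_elem n g) x))\<^sup>2 = 0" by (simp add: ij hardy_coeff_hom_elem)
  qed auto
  also have "\<dots> = (\<Sum>i\<le>n. (cmod (coeff g i))\<^sup>2)"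
    by (subst infsum_finite) (auto simp: sum.reindex inj_on_def hardy_coeff_hom_elem)
  also have "\<dots> = (coeff_norm g)\<^sup>2" by (rule coeff_norm_sq[OF assms, symmetric])
  finally show ?thesis using coeff_norm_nonneg by (simp add: power2_eq_iff_nonneg)
qed

lemma mult_w_power_hom_elem:
  "degree g \<le> n \<Longrightarrow> (mult_w ^^ j) (hom_elem n g) = hom_elem (n + j) g"
  by (induction j) (auto simp: mult_w_hom_elem)

lemma mult_z_power_hom_elem: "(mult_z ^^ i) (hom_elem n g) = hom_elem (n + i) (monom 1 i * g)"
  by (induction i) (auto simp: mult_z_hom_elem monom_Suc one_pCons monom_0)

lemma hardy_of_poly_add: "hardy_of_poly (r + s) = hardy_of_poly r + hardy_of_poly s"
  and hardy_of_poly_scale: "hardy_of_poly (smult [:a:] r) = a *\<^sub>C hardy_of_poly r"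
  and mult_z_hardy_of_poly: "mult_z (hardy_of_poly r) = hardy_of_poly (smult [:0, 1:] r)"
  and mult_w_hardy_of_poly: "mult_w (hardy_of_poly r) = hardy_of_poly (pCons 0 r)"
  and hardy_of_poly_0: "hardy_of_poly 0 = 0"
  by (rule hardy_eqI,
      auto simp: hardy_coeff_of_poly hardy_coeff_simps hardy_coeff_mult_z hardy_coeff_mult_w coeff_pCons
        split: nat.split)+

text \<open>The polynomial multiples of \<open>p\<close> and the span of its monomial shifts agree
  even before closure, which brings the submodule into the form used for a pair of
  isometries.\<close>

lemma submodule_of_eq:
  "submodule_of p = closure (complex_vector.span
     (range (\<lambda>(i, j). (mult_z ^^ i) ((mult_w ^^ j) (hardy_of_poly p)))))"
proof -
  let ?mon = "\<lambda>i j. (mult_z ^^ i) ((mult_w ^^ j) (hardy_of_poly p))"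
  let ?S = "complex_vector.span (range (\<lambda>(i, j). ?mon i j))"
  let ?R = "range (\<lambda>r. hardy_of_poly (p * r))"
  have "?S \<subseteq> ?R"
  proof (rule complex_vector.span_minimal)
    have w: "(mult_w ^^ j) (hardy_of_poly p) \<in> ?R" for j
    proof (induction j)
      case 0
      show ?case by (rule range_eqI[of _ _ 1]) simp
    next
      case (Suc j)
      then obtain r where "(mult_w ^^ j) (hardy_of_poly p) = hardy_of_poly (p * r)" by auto
      then show ?case by (intro range_eqI[of _ _ "pCons 0 r"]) (simp add: mult_w_hardy_of_poly)
    qed
    have "?mon i j \<in> ?R" for i j
    proof (induction i)
      case (Suc i)
      then obtain r where "?mon i j = hardy_of_poly (p * r)" by auto
      then show ?case by (intro range_eqI[of _ _ "smult [:0, 1:] r"]) (simp add: mult_z_hardy_of_poly)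
    qed (use w in simp)
    then show "range (\<lambda>(i, j). ?mon i j) \<subseteq> ?R" by auto
    show "csubspace ?R"
    proof (rule complex_vector.subspaceI)
      show "0 \<in> ?R" by (rule range_eqI[of _ _ 0]) (simp add: hardy_of_poly_0)
      fix x y a assume "x \<in> ?R"
      then obtain r where r: "x = hardy_of_poly (p * r)" by auto
      show "a *\<^sub>C x \<in> ?R"
        by (rule range_eqI[of _ _ "smult [:a:] r"]) (simp only: r mult_smult_right hardy_of_poly_scale)
      assume "y \<in> ?R"
      then obtain s where s: "y = hardy_of_poly (p * s)" by auto
      show "x + y \<in> ?R"
        by (rule range_eqI[of _ _ "r + s"]) (simp only: r s distrib_left hardy_of_poly_add)
    qed
  qed
  moreover have "hardy_of_poly (p * r) \<in> ?S" for r
  proof -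
    have Z: "mult_z x \<in> ?S" if "x \<in> ?S" for x
    proof -
      have "?S \<subseteq> {x. mult_z x \<in> ?S}"
      proof (rule complex_vector.span_minimal)
        have "mult_z (?mon i j) \<in> ?S" for i j
          by (rule complex_vector.span_base, rule range_eqI[of _ _ "(Suc i, j)"]) simp
        then show "range (\<lambda>(i, j). ?mon i j) \<subseteq> {x. mult_z x \<in> ?S}" by auto
        show "csubspace {x. mult_z x \<in> ?S}"
          using mult_z_scaleC[of 0 0]
          by (auto simp: complex_vector.subspace_def mult_z_add mult_z_scaleC
              complex_vector.span_zero complex_vector.span_add complex_vector.span_scale)
      qed
      then show ?thesis using that by auto
    qed
    have W: "mult_w x \<in> ?S" if "x \<in> ?S" for x
    proof -
      have "?S \<subseteq> {x. mult_w x \<in> ?S}"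
      proof (rule complex_vector.span_minimal)
        have comm: "mult_w ((mult_z ^^ i) x) = (mult_z ^^ i) (mult_w x)" for i x
          by (induction i) (simp_all flip: mult_z_mult_w)
        have "mult_w (?mon i j) \<in> ?S" for i j
          by (rule complex_vector.span_base, rule range_eqI[of _ _ "(i, Suc j)"]) (simp add: comm)
        then show "range (\<lambda>(i, j). ?mon i j) \<subseteq> {x. mult_w x \<in> ?S}" by auto
        show "csubspace {x. mult_w x \<in> ?S}"
          using mult_w_scaleC[of 0 0]
          by (auto simp: complex_vector.subspace_def mult_w_add mult_w_scaleC
              complex_vector.span_zero complex_vector.span_add complex_vector.span_scale)
      qed
      then show ?thesis using that by auto
    qed
    have p: "hardy_of_poly p \<in> ?S"
      by (rule complex_vector.span_base, rule range_eqI[of _ _ "(0, 0)"]) simp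
    \<comment> \<open>Multiples by polynomials in \<open>z\<close> alone come first; multiplication
      by \<open>w\<close> then builds up the outer variable.\<close>
    have c: "hardy_of_poly (smult c p) \<in> ?S" for c
    proof (induction c rule: pCons_induct)
      case (pCons a c)
      have "smult (pCons a c) p = smult [:a:] p + smult [:0, 1:] (smult c p)"
        by (simp flip: smult_add_left)
      then show ?case
        using p Z[OF pCons.IH]
        by (simp only: hardy_of_poly_add hardy_of_poly_scale flip: mult_z_hardy_of_poly)
          (intro complex_vector.span_add complex_vector.span_scale)
    qed (simp add: hardy_of_poly_0 complex_vector.span_zero)
    show ?thesis
    proof (induction r rule: pCons_induct)
      case (pCons c r)
      show ?case
        using c W[OF pCons.IH]
        by (simp only: mult_pCons_right hardy_of_poly_add flip: mult_w_hardy_of_poly)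
          (intro complex_vector.span_add)
    qed (simp add: hardy_of_poly_0 complex_vector.span_zero)
  qed
  ultimately have "?R = ?S" by auto
  then show ?thesis by (simp add: submodule_of_def)
qed

text \<open>In a fixed total degree the exponent of \<open>z\<close> determines that of
  \<open>w\<close>, so setting \<open>w = 1\<close> merges no coefficients. The total degree
  \<open>d\<close> exceeds that of \<open>poly p 1\<close> when \<open>w\<close> divides
  \<open>p\<close>.\<close>

lemma homogeneous_hardy_of_poly:
  assumes "p \<noteq> 0" "homogeneous_poly p"
  obtains d where "degree (poly p 1) \<le> d" "poly p 1 \<noteq> 0" "hardy_of_poly p = hom_elem d (poly p 1)"
proof -
  obtain d where d: "\<And>i j. coeff (coeff p j) i \<noteq> 0 \<Longrightarrow> i + j = d"
    using assms(2) by (auto simp: homogeneous_poly_def)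
  have sum: "coeff (poly p 1) i = (\<Sum>j\<le>degree p. coeff (coeff p j) i)" for i
    by (simp add: poly_altdef coeff_sum)
  have c: "coeff (poly p 1) i = coeff (coeff p j) i" if "i + j = d" for i j
  proof -
    have "coeff (poly p 1) i = (\<Sum>k\<le>degree p. if k = j then coeff (coeff p j) i else 0)"
      unfolding sum using d that by (intro sum.cong) fastforce+
    also have "\<dots> = coeff (coeff p j) i" by (simp add: coeff_eq_0)
    finally show ?thesis .
  qed
  have "coeff (poly p 1) i = 0" if "i > d" for i
    unfolding sum using d that by (intro sum.neutral) fastforce
  then have deg: "degree (poly p 1) \<le> d" by (intro degree_le) auto
  have "coeff p (degree p) \<noteq> 0" using assms(1) by simp
  then obtain i where i: "coeff (coeff p (degree p)) i \<noteq> 0" by (metis leading_coeff_0_iff)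
  then have "poly p 1 \<noteq> 0" using c[OF d[OF i]] by auto
  moreover have "hardy_of_poly p = hom_elem d (poly p 1)"
    using d c by (intro hardy_eqI) (auto simp: hardy_coeff_of_poly hardy_coeff_hom_elem)
  ultimately show thesis using deg that by blast
qed

text \<open>Forms over \<open>p\<close> become products of a polynomial with
  \<open>poly p 1\<close>, whose norm is \<open>cmod c\<close> times the norm of the product with
  \<open>unit_factors B\<close>. The lower bound then comes from the constant coefficient 1, the
  upper one from \<open>unit_factors_cyclic\<close>.\<close>

lemma szego_pair_hardy:
  assumes "p \<noteq> 0" "homogeneous_poly p"
  shows "szego_pair mult_z mult_w (hardy_of_poly p) (mahler_measure (poly p 1))"
    and "norm (hardy_of_poly p) = circle_L2_norm (poly p 1)"
proof -
  let ?q = "poly p 1"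
  obtain d where d: "degree ?q \<le> d" and q: "?q \<noteq> 0" and p: "hardy_of_poly p = hom_elem d ?q"
    using homogeneous_hardy_of_poly[OF assms] by blast
  obtain c B where c: "c \<noteq> 0" and B: "\<forall>b\<in>#B. cmod b \<le> 1"
    and norm: "\<And>g. coeff_norm (g * ?q) = cmod c * coeff_norm (g * unit_factors B)"
    and circ: "\<And>\<zeta>. cmod \<zeta> = 1 \<Longrightarrow> cmod (poly ?q \<zeta>) = cmod c * cmod (poly (unit_factors B) \<zeta>)"
    using reflected_factorization[OF q] by blast
  have m: "mahler_measure ?q = cmod c" by (rule mahler_measure_eq[OF c B circ])
  show "norm (hardy_of_poly p) = circle_L2_norm ?q"
    by (simp add: p norm_hom_elem[OF d] circle_L2_norm_eq)
  have mon: "(mult_z ^^ i) ((mult_w ^^ j) (hardy_of_poly p)) = hom_elem (d + j + i) (monom 1 i * ?q)" for i j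
    by (simp add: p mult_w_power_hom_elem[OF d] mult_z_power_hom_elem)
  have form: "norm (\<Sum>k\<le>n. a k *\<^sub>C (mult_z ^^ k) ((mult_w ^^ (n - k)) (hardy_of_poly p))) =
      cmod c * coeff_norm ((\<Sum>k\<le>n. monom (a k) k) * unit_factors B)" for n a
  proof -
    have deg: "degree (\<Sum>k\<le>n. monom (a k) k) \<le> n"
      by (intro degree_sum_le) (auto intro: order_trans[OF degree_monom_le])
    have "a k *\<^sub>C hom_elem (d + n) (monom 1 k * ?q) = hom_elem (d + n) (monom (a k) k * ?q)" for k
      by (simp add: hom_elem_smult[symmetric] smult_monom flip: mult_smult_left)
    then have "(\<Sum>k\<le>n. a k *\<^sub>C (mult_z ^^ k) ((mult_w ^^ (n - k)) (hardy_of_poly p))) =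
        hom_elem (d + n) ((\<Sum>k\<le>n. monom (a k) k) * ?q)"
      by (simp add: mon hom_elem_sum sum_distrib_right)
    then show ?thesis
      using deg d degree_mult_le[of "\<Sum>k\<le>n. monom (a k) k" ?q] by (simp add: norm_hom_elem norm)
  qed
  show "szego_pair mult_z mult_w (hardy_of_poly p) (mahler_measure ?q)"
  proof unfold_locales
    show "0 < mahler_measure ?q" using c m by simp
    show "cinner ((mult_z ^^ i) ((mult_w ^^ j) (hardy_of_poly p)))
        ((mult_z ^^ k) ((mult_w ^^ l) (hardy_of_poly p))) = 0" if "i + j \<noteq> k + l" for i j k l
      unfolding mon using that by (intro cinner_hom_elem) simp
    fix a :: "nat \<Rightarrow> complex" and n assume a: "a 0 = 1"
    have "coeff (\<Sum>k\<le>n. monom (a k) k) 0 = 1" using a by (simp add: coeff_sum sum.delta')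
    then have "1 \<le> coeff_norm ((\<Sum>k\<le>n. monom (a k) k) * unit_factors B)"
      using coeff_norm_ge_coeff_0[of "(\<Sum>k\<le>n. monom (a k) k) * unit_factors B"]
      by (simp add: coeff_mult_0 coeff_unit_factors_0)
    then show "(mahler_measure ?q)\<^sup>2 \<le>
        (norm (\<Sum>k\<le>n. a k *\<^sub>C (mult_z ^^ k) ((mult_w ^^ (n - k)) (hardy_of_poly p))))\<^sup>2"
      unfolding form m by (intro power_mono) (auto simp: mult_le_cancel_left1)
  next
    fix \<epsilon> :: real assume \<epsilon>: "0 < \<epsilon>"
    \<comment> \<open>Chosen so that the squared error, scaled by \<open>(cmod c)^2\<close>, is
      exactly \<open>\<epsilon>\<close>.\<close>
    define \<delta> where "\<delta> = sqrt \<epsilon> / cmod c"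
    have \<delta>: "\<delta> > 0" "(cmod c)\<^sup>2 * \<delta>\<^sup>2 = \<epsilon>" using \<epsilon> c by (auto simp: \<delta>_def power_divide)
    obtain P where P: "coeff P 0 = 1" "coeff_norm (P * unit_factors B - 1) < \<delta>"
      using unit_factors_cyclic[OF B \<delta>(1)] by blast
    have "(coeff_norm (P * unit_factors B))\<^sup>2 = 1 + (coeff_norm (P * unit_factors B - 1))\<^sup>2"
      by (rule coeff_norm_sq_split) (simp add: coeff_mult_0 coeff_unit_factors_0 P(1))
    also have "\<dots> < 1 + \<delta>\<^sup>2"
      using P(2) coeff_norm_nonneg by (intro add_strict_left_mono power_strict_mono) auto
    finally have "(cmod c)\<^sup>2 * (coeff_norm (P * unit_factors B))\<^sup>2 < (cmod c)\<^sup>2 * (1 + \<delta>\<^sup>2)"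
      using c by (intro mult_strict_left_mono) auto
    also have "\<dots> = (mahler_measure ?q)\<^sup>2 + \<epsilon>" using \<delta>(2) by (simp add: m distrib_left)
    finally show "\<exists>n a. a 0 = 1 \<and> (norm (\<Sum>k\<le>n. a k *\<^sub>C (mult_z ^^ k)
        ((mult_w ^^ (n - k)) (hardy_of_poly p))))\<^sup>2 < (mahler_measure ?q)\<^sup>2 + \<epsilon>"
      unfolding form
      by (intro exI[of _ "degree P"] exI[of _ "coeff P"])
        (simp add: P(1) poly_as_sum_of_monoms power_mult_distrib)
  qed (simp_all add: mult_z_add mult_w_add mult_z_scaleC mult_w_scaleC cinner_mult_z cinner_mult_w
      mult_z_mult_w)
qed

theorem corollary4p4:
  fixes p :: "complex poly poly" and q :: "complex poly" and M :: "hardy set"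
    and e\<^sub>0 :: hardy and X K :: "hardy \<Rightarrow> hardy"
  assumes "p \<noteq> 0" and "homogeneous_poly p"
    and "q = poly p 1"
    and "M = submodule_of p"
    and "e\<^sub>0 = inverse (norm (hardy_of_poly p)) *\<^sub>R hardy_of_poly p"
    and "X = cross_commutator M"
    and "K = (\<lambda>f. defect_z M (defect_w M f) - rank_one_proj e\<^sub>0 f)"
  shows "trace_class_on M (\<lambda>f. adj_on M K (K f))
    \<and> trace_class_on M (\<lambda>f. adj_on M X (X f))
    \<and> fredholm_det_on M (\<lambda>f. f - adj_on M K (K f)) =
        complex_of_real ((mahler_measure q)\<^sup>2 / (circle_L2_norm q)\<^sup>2)
    \<and> fredholm_det_on M (\<lambda>f. f - adj_on M X (X f)) =
        complex_of_real ((mahler_measure q)\<^sup>2 / (circle_L2_norm q)\<^sup>2)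
    \<and> (\<forall>r::nat. r \<ge> 1 \<longrightarrow>
        X \<in> schatten_class_on M (2 * real r) \<and> K \<in> schatten_class_on M (2 * real r))
    \<and> (\<lambda>n. 1 / real (Suc n) * schatten_norm_on M (2 * real (Suc n)) X ^ (2 * Suc n)) sums
        ln ((circle_L2_norm q)\<^sup>2 / (mahler_measure q)\<^sup>2)
    \<and> (\<lambda>n. 1 / real (Suc n) * schatten_norm_on M (2 * real (Suc n)) K ^ (2 * Suc n)) sums
        ln ((circle_L2_norm q)\<^sup>2 / (mahler_measure q)\<^sup>2)"
proof -
  interpret S: szego_pair mult_z mult_w "hardy_of_poly p" "mahler_measure q"
    unfolding assms(3) by (rule szego_pair_hardy[OF assms(1,2)])
  have norm: "norm (hardy_of_poly p) = circle_L2_norm q"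
    unfolding assms(3) by (rule szego_pair_hardy[OF assms(1,2)])
  have M: "M = S.M" unfolding assms(4) submodule_of_eq S.M_def S.mon_def ..
  have X: "X = S.X" unfolding assms(6) M by (simp add: fun_eq_iff cross_commutator_def S.X_def)
  have e0: "e\<^sub>0 = S.e 0"
    unfolding assms(5) S.e_def S.E_0 S.F_0 scaleR_scaleC by (simp add: divide_inverse)
  have K: "K = S.K"
    unfolding assms(7) M e0
    by (simp add: fun_eq_iff S.K_def S.Pz_def S.Pw_def defect_z_def defect_w_def)
  \<comment> \<open>\<open>exp L\<close> is the common determinant and \<open>- L\<close> the common
    value of the two Schatten series.\<close>
  define L where "L = ln ((mahler_measure q)\<^sup>2 / (circle_L2_norm q)\<^sup>2)"
  have sums: "(\<lambda>n. ln (1 - (cmod (S.a n))\<^sup>2)) sums L"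
    using S.log_sums by (simp add: L_def norm)
  have pos: "mahler_measure q > 0" "circle_L2_norm q > 0"
    using S.m_pos S.norm_F_pos[of 0] by (simp_all add: S.F_0 norm)
  have exp: "exp L = (mahler_measure q)\<^sup>2 / (circle_L2_norm q)\<^sup>2"
    unfolding L_def using pos by simp
  have neg: "- L = ln ((circle_L2_norm q)\<^sup>2 / (mahler_measure q)\<^sup>2)"
    unfolding L_def using pos by (simp add: ln_div)
  note XS = svd.determinant_and_schatten_series[OF S.svd_X, of S.X L]
  note KS = svd.determinant_and_schatten_series[OF S.svd_K, of S.K L]
  show ?thesis
    unfolding M X K exp[symmetric] neg[symmetric]
    using XS KS S.X_eq S.K_eq S.a_less_1 sums by (simp del: of_nat_Suc power_Suc)
qed

end
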